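(* Let $\mathbb{F}_q$ be a finite field of characteristic $p$, let $n$ be a divisor of $q-1$, and let $a,b\in\mathbb{F}_q$ satisfy $ab\notin\{0,1\}$. Let $\mathcal{G}$ be the projective plane curve over $\mathbb{F}_q$ with affine equation $aX^nY^n-X^n-Y^n+b=0$, and let $N_q(\mathcal{G})$ be the number of $\mathbb{F}_q$-rational points on the nonsingular model $\mathcal{Y}$ of $\mathcal{G}$. Let $s\in\{2,\ldots,n-1\}$, put $N=\binom{s+2}{2}-3$ and $\delta=2n(s-1)$, and let $\mathcal{D}_s^{P_1,P_2}$ be the linear series on $\mathcal{Y}$ defined in the context. If $\mathcal{D}_s^{P_1,P_2}$ is $\mathbb{F}_q$-Frobenius classical, then $$N_q(\mathcal{G})\leqslant (N-1)(n^2-2n)+\frac{\delta(q+N)}{N}-2\cdot\frac{n_1\alpha+n_2\beta+n\gamma}{N},$$ where - $n_1$ and $n_2$ are the numbers of roots in $\mathbb{F}_q$ of the polynomials $T^n-b$ and $T^n-a^{-1}$, respectively; - $\alpha=1+(s-1)n-N$; - $\beta=(s-1)(n+1)-N$; - $\gamma=2(n+1)-s(4n+3)-N(N-1)+\bigl(s(2n+3)-3\bigr)\cdot\frac{N+3}{3}$.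
   Context: When $n\mid q-1$ and $ab\notin\{0,1\}$, the curve $\mathcal{G}$ is geometrically irreducible. Its nonsingular model over $\mathbb{F}_q$ is denoted $\mathcal{Y}$, with function field $\overline{\mathbb{F}_q}(\mathcal{Y})=\overline{\mathbb{F}_q}(x,y)$, where $ax^ny^n-x^n-y^n+b=0$. Let $P_1=(1:0:0)$ and $P_2=(0:1:0)$, the singular points of $\mathcal{G}$. For $s\in\{2,\ldots,n-1\}$, $\mathcal{D}_s^{P_1,P_2}$ is the base-point-free linear series on $\mathcal{Y}$ associated with the nondegenerate morphism $(\cdots:x^iy^j:\cdots):\mathcal{Y}\to\mathbb{P}^N(\overline{\mathbb{F}_q})$, where $(i,j)$ runs over all pairs of integers with $0\leqslant i,j\leqslant s-1$ and $0\leqslant i+j\leqslant s$ (there are $N+1$ such pairs). Equivalently, it is the series cut out on $\mathcal{G}$ by all (not necessarily irreducible) plane curves of degree $s$ passing through $P_1$ and $P_2$, with its base locus removed. Frobenius classicality. Let $\phi=(x_0:\cdots:x_M):\mathcal{X}\to\mathbb{P}^M$ be a nondegenerate morphism defined over $\mathbb{F}_q$ from a nonsingular curve $\mathcal{X}$ over $\mathbb{F}_q$, let $t\in\mathbb{F}_q(\mathcal{X})$ be a separating variable, and let $D_t^{(i)}$ denote the $i$-th Hasse derivative with respect to $t$. The $\mathbb{F}_q$-Frobenius order sequence $(\nu_0,\ldots,\nu_{M-1})$ of $\phi$ (or of the associated linear series) is the lexicographically minimal sequence $0\leqslant \nu_0<\cdots<\nu_{M-1}$ such that the $(M+1)\times(M+1)$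 determinant with first row $(x_0^q,\ldots,x_M^q)$ and following rows $(D_t^{(\nu_i)}x_0,\ldots,D_t^{(\nu_i)}x_M)$, $i=0,\ldots,M-1$, is nonzero. The morphism (or linear series) is called $\mathbb{F}_q$-Frobenius classical if $(\nu_0,\ldots,\nu_{M-1})=(0,1,\ldots,M-1)$. *)

theory Defs
  imports "Jordan_Normal_Form.Determinant" "HOL-Computational_Algebra.Polynomial"
    "HOL-Library.Cardinality"
begin

text \<open>
  Function fields over the finite field \<open>'k\<close> (with \<open>q = CARD('k)\<close>) are realised as subfields
  \<open>K\<close> of an ambient field type \<open>'a\<close>, into which \<open>'k\<close> is embedded by a field homomorphism \<open>\<iota>\<close>.
\<close>

definition eval1 :: "('k::field \<Rightarrow> 'a::field) \<Rightarrow> 'k poly \<Rightarrow> 'a \<Rightarrow> 'a" where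
  "eval1 \<iota> P u = poly (map_poly \<iota> P) u"

text \<open>The inner variable of a \<open>'k poly poly\<close> is \<open>X\<close>, the outer one is \<open>Y\<close>.\<close>

definition eval2 :: "('k::field \<Rightarrow> 'a::field) \<Rightarrow> 'k poly poly \<Rightarrow> 'a \<Rightarrow> 'a \<Rightarrow> 'a" where
  "eval2 \<iota> P u v = poly (map_poly (\<lambda>p. eval1 \<iota> p u) P) v"

definition adjoin1 :: "('k::field \<Rightarrow> 'a::field) \<Rightarrow> 'a \<Rightarrow> 'a set" where
  "adjoin1 \<iota> u = {eval1 \<iota> P u / eval1 \<iota> Q u | P Q. eval1 \<iota> Q u \<noteq> 0}"

definition adjoin2 :: "('k::field \<Rightarrow> 'a::field) \<Rightarrow> 'a \<Rightarrow> 'a \<Rightarrow> 'a set" where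
  "adjoin2 \<iota> u v = {eval2 \<iota> P u v / eval2 \<iota> Q u v | P Q. eval2 \<iota> Q u v \<noteq> 0}"

text \<open>
  For a generic point \<open>(x, y)\<close> of the affine curve \<open>F = 0\<close>, the map \<open>X \<mapsto> x, Y \<mapsto> y\<close> has kernel
  \<open>(F)\<close>. So \<open>adjoin2 \<iota> x y\<close> is the fraction field of \<open>k[X,Y]/(F)\<close>, i.e. the function field
  over \<open>k\<close> of the curve and of its nonsingular model.
\<close>

definition generic_point ::
    "('k::field \<Rightarrow> 'a::field) \<Rightarrow> 'k poly poly \<Rightarrow> 'a \<Rightarrow> 'a \<Rightarrow> bool" where
  "generic_point \<iota> F x y \<longleftrightarrow> field_hom \<iota> \<and> (\<forall>P. eval2 \<iota> P x y = 0 \<longleftrightarrow> F dvd P)"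

definition curve_poly :: "'k::field \<Rightarrow> 'k \<Rightarrow> nat \<Rightarrow> 'k poly poly" where
  "curve_poly a b n =
     (let X = [:[:0, 1:]:]; Y = [:0, 1:] in [:[:a:]:] * X ^ n * Y ^ n - X ^ n - Y ^ n + [:[:b:]:])"

text \<open>
  The closed points of the nonsingular model with function field \<open>K\<close> are the places of \<open>K/k\<close>,
  given here by their valuation rings (\<open>K/k\<close> being of transcendence degree one, these are
  discrete). A point is \<open>k\<close>-rational iff its residue field is \<open>k\<close>.
\<close>

definition valuation_ring_of :: "('k::field \<Rightarrow> 'a::field) \<Rightarrow> 'a set \<Rightarrow> 'a set \<Rightarrow> bool" where
  "valuation_ring_of \<iota> K V \<longleftrightarrow>
     range \<iota> \<subset> V \<and> V \<subset> K \<and>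
     (\<forall>u\<in>V. \<forall>v\<in>V. u - v \<in> V \<and> u * v \<in> V) \<and>
     (\<forall>z\<in>K. z \<noteq> 0 \<longrightarrow> z \<in> V \<or> inverse z \<in> V)"

definition maximal_ideal_of :: "'a::field set \<Rightarrow> 'a set" where
  "maximal_ideal_of V = {z \<in> V. z = 0 \<or> inverse z \<notin> V}"

definition rational_points :: "('k::field \<Rightarrow> 'a::field) \<Rightarrow> 'a set \<Rightarrow> 'a set set" where
  "rational_points \<iota> K =
     {V. valuation_ring_of \<iota> K V \<and> (\<forall>z\<in>V. \<exists>c. z - \<iota> c \<in> maximal_ideal_of V)}"

text \<open>
  \<open>K\<close> is separable algebraic over \<open>k(t)\<close>. Finiteness of \<open>K\<close> over \<open>k(t)\<close> is then automatic, as
  \<open>K\<close> is finitely generated over \<open>k\<close>.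
\<close>

definition separating_variable :: "('k::field \<Rightarrow> 'a::field) \<Rightarrow> 'a set \<Rightarrow> 'a \<Rightarrow> bool" where
  "separating_variable \<iota> K t \<longleftrightarrow> t \<in> K \<and>
     (\<forall>z\<in>K. \<exists>g :: 'a poly. (\<forall>i. coeff g i \<in> adjoin1 \<iota> t) \<and>
        coprime g (pderiv g) \<and> poly g z = 0)"

text \<open>
  For a separating variable \<open>t\<close> there is exactly one such family on \<open>K\<close>: the values on \<open>k[t]\<close> are
  prescribed, and the product rule forces the extension to \<open>k(t)\<close> and to \<open>K\<close>.
\<close>

definition hasse_derivatives ::
    "('k::field \<Rightarrow> 'a::field) \<Rightarrow> 'a set \<Rightarrow> 'a \<Rightarrow> (nat \<Rightarrow> 'a \<Rightarrow> 'a) \<Rightarrow> bool" where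
  "hasse_derivatives \<iota> K t D \<longleftrightarrow>
     (\<forall>i. \<forall>f\<in>K. D i f \<in> K) \<and>
     (\<forall>f\<in>K. D 0 f = f) \<and>
     (\<forall>i. \<forall>f\<in>K. \<forall>g\<in>K. D i (f + g) = D i f + D i g) \<and>
     (\<forall>i c. \<forall>f\<in>K. D i (\<iota> c * f) = \<iota> c * D i f) \<and>
     (\<forall>i. \<forall>f\<in>K. \<forall>g\<in>K. D i (f * g) = (\<Sum>j\<le>i. D j f * D (i - j) g)) \<and>
     (\<forall>i m. D i (t ^ m) = of_nat (m choose i) * t ^ (m - i))"

text \<open>
  A morphism to \<open>\<P>\<^sup>M\<close> is given by the list \<open>fs = [x\<^sub>0, \<dots>, x\<^sub>M]\<close> of its coordinate functions.
\<close>

definition frobenius_matrix ::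
    "nat \<Rightarrow> (nat \<Rightarrow> 'a::field \<Rightarrow> 'a) \<Rightarrow> 'a list \<Rightarrow> nat list \<Rightarrow> 'a mat" where
  "frobenius_matrix q D fs \<nu> = mat (length fs) (length fs)
     (\<lambda>(r, c). case r of 0 \<Rightarrow> (fs ! c) ^ q | Suc i \<Rightarrow> D (\<nu> ! i) (fs ! c))"

definition frobenius_admissible ::
    "nat \<Rightarrow> (nat \<Rightarrow> 'a::field \<Rightarrow> 'a) \<Rightarrow> 'a list \<Rightarrow> nat list set" where
  "frobenius_admissible q D fs =
     {\<nu>. length \<nu> = length fs - 1 \<and> sorted_wrt (<) \<nu> \<and> det (frobenius_matrix q D fs \<nu>) \<noteq> 0}"

text \<open>The sequence does not depend on the separating variable \<open>t\<close>.\<close>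

definition frobenius_order_sequence ::
    "('k::{field,finite} \<Rightarrow> 'a::field) \<Rightarrow> 'a set \<Rightarrow> 'a list \<Rightarrow> nat list \<Rightarrow> bool" where
  "frobenius_order_sequence \<iota> K fs \<nu> \<longleftrightarrow>
     (\<exists>t D. separating_variable \<iota> K t \<and> hasse_derivatives \<iota> K t D \<and>
        \<nu> \<in> frobenius_admissible CARD('k) D fs \<and>
        (\<forall>\<mu> \<in> frobenius_admissible CARD('k) D fs. \<mu> = \<nu> \<or> (\<nu>, \<mu>) \<in> lexord less_than))"

definition frobenius_classical ::
    "('k::{field,finite} \<Rightarrow> 'a::field) \<Rightarrow> 'a set \<Rightarrow> 'a list \<Rightarrow> bool" where
  "frobenius_classical \<iota> K fs \<longleftrightarrow> frobenius_order_sequence \<iota> K fs [0..<length fs - 1]"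

text \<open>
  Coordinate functions of the morphism defining \<open>\<D>\<^sub>s\<close>; their order is irrelevant, as permuting
  them only changes the sign of the determinants above.
\<close>

definition series_coords :: "'a::field \<Rightarrow> 'a \<Rightarrow> nat \<Rightarrow> 'a list" where
  "series_coords x y s = [x ^ i * y ^ j. i \<leftarrow> [0..<s], j \<leftarrow> [0..<s], i + j \<le> s]"

end

theory Submission
  imports Defs "HOL-Computational_Algebra.Formal_Power_Series"
begin

text \<open>
  This is the Stoehr--Voloch argument, carried out on the quotient of the curve by \<open>\<mu>\<^sub>n \<times> \<mu>\<^sub>n\<close>,
  which is rational. Put \<open>X = x ^ n\<close>, \<open>Y = y ^ n\<close> and \<open>q = n m + 1\<close>; then \<open>Y = (X - b) / (a X - 1)\<close>.
  The functions \<open>x ^ i y ^ j\<close> and their Hasse derivatives are \<open>x ^ i y ^ j\<close> times elements of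
  \<open>k(X)\<close>, and so are their \<open>q\<close>-th powers because \<open>n\<close> divides \<open>q - 1\<close>. Up to a monomial
  factor the Frobenius--Wronskian determinant is therefore a nonzero rational function \<open>\<Delta>\<close> of \<open>X\<close>,
  and the orders of \<open>\<Delta>\<close> on the projective line add up to \<open>0\<close>.

  The curve is branched over \<open>X = 0, \<infinity>\<close> (where \<open>Y\<close> is close to \<open>b\<close>, \<open>1 / a\<close>) and over
  \<open>Y = 0, \<infinity>\<close> (where \<open>X\<close> is). There, replacing \<open>y ^ j\<close> by \<open>(y - d) ^ j\<close>, resp. \<open>x ^ i\<close> by
  \<open>(x - c) ^ i\<close>, makes the columns of the determinant divisible by powers of the parameter, which
  bounds the order of \<open>\<Delta>\<close> from below. At any value \<open>X = c\<close> under rational points with \<open>x y \<noteq> 0\<close> the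
  row of \<open>q\<close>-th powers is congruent to a combination of the rows of derivatives, and \<open>\<Delta>\<close> vanishes
  to order \<open>N\<close>. Above such a value lie at most \<open>n\<^sup>2\<close> rational points, and the remaining
  rational points are counted by \<open>n\<^sub>1\<close> and \<open>n\<^sub>2\<close>.
\<close>

section \<open>Filtrations and determinants\<close>

text \<open>Divisors on the curve are avoided: orders are taken only in k(X), and only as lower
  bounds, which suffices because a nonzero rational function has total order 0. Since only
  membership in \<open>G e\<close> matters, one set of determinant lemmas serves finite points,
  infinity and regularity off \<open>b\<close> and \<open>1 / a\<close>. The Hasse derivatives of x
  ^ i y ^ j are read off from \<open>A ^ i * B ^ j\<close>, where the Taylor series \<open>A\<close>
  and \<open>B\<close> are scaled to constant term 1. A change of parameter makes
  \<open>A = 1 + fps_X\<close>; then \<open>B ^ n\<close> is rational in X and \<open>fps_X\<close>,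
  and its root \<open>B\<close> has coefficients in k(X) because n is invertible. This suits X = 0
  and infinity. At X = \<open>b\<close> and \<open>1 / a\<close>, where Y has its zero and its pole,
  \<open>B\<close> is normalised instead. The two determinants differ by
  \<open>(B $ 1 * inverse (A $ 1)) ^ T\<close> with T = N (N - 1) / 2; the base has simple poles at
  \<open>b\<close> and \<open>1 / a\<close>, the origin of the term N (N - 1) in the bound. On the
  curve itself one fact is needed: a rational place is determined by the residues of its
  coordinates, or of their inverses at poles.\<close>

no_notation vec_index (infixl "$" 100)
unbundle fps_syntax

text \<open>\<open>u \<in> G e\<close> stands for the condition that \<open>u\<close> has order at least \<open>e\<close> at some place.\<close>

locale filtration =
  fixes G :: "int \<Rightarrow> 'a::field set"
  assumes zero_mem [simp, intro]: "0 \<in> G e"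
    and add_mem: "u \<in> G e \<Longrightarrow> v \<in> G e \<Longrightarrow> u + v \<in> G e"
    and uminus_mem: "u \<in> G e \<Longrightarrow> - u \<in> G e"
    and mult_mem: "u \<in> G e \<Longrightarrow> v \<in> G f \<Longrightarrow> u * v \<in> G (e + f)"
    and one_mem [simp, intro]: "1 \<in> G 0"
    and antimono: "u \<in> G f \<Longrightarrow> e \<le> f \<Longrightarrow> u \<in> G e"
begin

lemma diff_mem: "u \<in> G e \<Longrightarrow> v \<in> G e \<Longrightarrow> u - v \<in> G e"
  using add_mem[OF _ uminus_mem, of u e v] by simp

lemma mult_mem0: "u \<in> G 0 \<Longrightarrow> v \<in> G e \<Longrightarrow> u * v \<in> G e"
  using mult_mem[of u 0 v e] by simp

lemma sum_mem: "(\<And>i. i \<in> S \<Longrightarrow> h i \<in> G e) \<Longrightarrow> sum h S \<in> G e"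
  by (induction S rule: infinite_finite_induct) (auto intro: add_mem)

lemma prod_mem: "(\<And>i. i \<in> S \<Longrightarrow> h i \<in> G (w i)) \<Longrightarrow> prod h S \<in> G (sum w S)"
  by (induction S rule: infinite_finite_induct) (auto intro: mult_mem)

lemma power_mem: "u \<in> G e \<Longrightarrow> u ^ k \<in> G (int k * e)"
proof (induction k)
  case (Suc k)
  thus ?case using mult_mem[of u e "u ^ k" "int k * e"] by (simp add: algebra_simps)
qed simp

lemma power_mem0: "u \<in> G 0 \<Longrightarrow> u ^ k \<in> G 0"
  using power_mem[of u 0 k] by simp

lemma of_nat_mem: "of_nat k \<in> G 0"
  by (induction k) (auto intro: add_mem)

lemma signof_mem: "signof p \<in> G 0"
  by (auto simp: sign_def intro: uminus_mem)

text \<open>In the Leibniz sum, row 0 meets only column \<open>p 0\<close>. Trading \<open>w\<close>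
  for \<open>v\<close> there gives the permutation \<open>p\<close> the total
  \<open>v (p 0) - w (p 0)\<close> plus the full sum of \<open>w\<close>, which \<open>e\<close>
  must not exceed.\<close>

lemma det_mem:
  assumes A: "A \<in> carrier_mat (Suc N) (Suc N)"
    and row0: "\<And>c. c \<le> N \<Longrightarrow> A $$ (0, c) \<in> G (v c)"
    and rows: "\<And>i c. i < N \<Longrightarrow> c \<le> N \<Longrightarrow> A $$ (Suc i, c) \<in> G (w c)"
    and e: "\<And>c. c \<le> N \<Longrightarrow> e \<le> v c - w c + (\<Sum>c\<le>N. w c)"
  shows "det A \<in> G e"
  unfolding det_def'[OF A]
proof (rule sum_mem)
  fix p assume p: "p \<in> {p. p permutes {0..<Suc N}}"
  hence p': "p permutes {..N}" by (simp add: atLeast0LessThan lessThan_Suc_atMost)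
  let ?h = "\<lambda>i. if i = 0 then v (p i) else w (p i)"
  have le: "p i \<le> N" if "i \<le> N" for i using permutes_in_image[OF p'] that by auto
  have "(\<Prod>i = 0..<Suc N. A $$ (i, p i)) \<in> G (sum ?h {0..<Suc N})"
  proof (rule prod_mem)
    fix i assume i: "i \<in> {0..<Suc N}"
    show "A $$ (i, p i) \<in> G (?h i)"
      using i row0[OF le] rows[OF _ le] by (cases i) auto
  qed
  moreover have "sum ?h {0..<Suc N} = v (p 0) - w (p 0) + (\<Sum>c\<le>N. w c)"
  proof -
    have "sum ?h {..N} = v (p 0) + (\<Sum>i\<in>{..N} - {0}. w (p i))"
      by (subst sum.remove[of _ 0]) (auto intro!: sum.cong)
    also have "(\<Sum>i\<in>{..N} - {0}. w (p i)) = (\<Sum>i\<le>N. w (p i)) - w (p 0)"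
      by (subst sum.remove[of "{..N}" 0]) auto
    also have "(\<Sum>i\<le>N. w (p i)) = (\<Sum>c\<le>N. w c)"
      using sum.permute[OF p', of w] by (simp add: o_def)
    finally show ?thesis by (simp add: atLeast0LessThan lessThan_Suc_atMost)
  qed
  ultimately have "(\<Prod>i = 0..<Suc N. A $$ (i, p i)) \<in> G e"
    using antimono e[OF le, of 0] by simp
  thus "signof p * (\<Prod>i = 0..<Suc N. A $$ (i, p i)) \<in> G e"
    by (intro mult_mem0 signof_mem)
qed

lemma det_mem0:
  assumes "A \<in> carrier_mat (Suc N) (Suc N)" "\<And>r c. r \<le> N \<Longrightarrow> c \<le> N \<Longrightarrow> A $$ (r, c) \<in> G 0"
  shows "det A \<in> G 0"
  using assms by (intro det_mem[where v = "\<lambda>_. 0" and w = "\<lambda>_. 0" and N = N]) auto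

end

text \<open>Row 0 is meant for the q-th powers. Row \<open>Suc i\<close> holds i-th Taylor
  coefficients, so the derivative orders are 0, ..., N - 1, the classical sequence.\<close>

definition frobenius_fps_matrix :: "(nat \<Rightarrow> 'a::field) \<Rightarrow> (nat \<Rightarrow> 'a fps) \<Rightarrow> nat \<Rightarrow> 'a mat" where
  "frobenius_fps_matrix r0 f N =
     mat (Suc N) (Suc N) (\<lambda>(r, c). case r of 0 \<Rightarrow> r0 c | Suc i \<Rightarrow> f c $ i)"

lemma frobenius_fps_matrix_carrier [simp]:
  "frobenius_fps_matrix r0 f N \<in> carrier_mat (Suc N) (Suc N)"
  by (simp add: frobenius_fps_matrix_def)

lemma frobenius_fps_matrix_dim [simp]:
  "dim_row (frobenius_fps_matrix r0 f N) = Suc N" "dim_col (frobenius_fps_matrix r0 f N) = Suc N"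
  by (simp_all add: frobenius_fps_matrix_def)

lemma frobenius_fps_matrix_0 [simp]:
  "c \<le> N \<Longrightarrow> frobenius_fps_matrix r0 f N $$ (0, c) = r0 c"
  by (simp add: frobenius_fps_matrix_def)

lemma frobenius_fps_matrix_Suc [simp]:
  "i < N \<Longrightarrow> c \<le> N \<Longrightarrow> frobenius_fps_matrix r0 f N $$ (Suc i, c) = f c $ i"
  by (simp add: frobenius_fps_matrix_def)

lemma frobenius_fps_matrix_cong:
  assumes "\<And>c. c \<le> N \<Longrightarrow> r0 c = r0' c" "\<And>c. c \<le> N \<Longrightarrow> f c = f' c"
  shows "frobenius_fps_matrix r0 f N = frobenius_fps_matrix r0' f' N"
  unfolding frobenius_fps_matrix_def
  by (rule cong_mat) (use assms in \<open>auto split: nat.split\<close>)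

lemma times_mat_index:
  assumes "A \<in> carrier_mat n n" "B \<in> carrier_mat n n" "r < n" "c < n"
  shows "(A * B) $$ (r, c) = (\<Sum>k<n. A $$ (r, k) * B $$ (k, c))"
  using assms by (auto simp: scalar_prod_def atLeast0LessThan intro!: sum.cong)

text \<open>A change of parameter: substituting \<phi> acts on coefficient vectors by the triangular
  matrix with entries \<open>(\<phi> ^ j) $ i\<close>, whose diagonal is
  \<open>(\<phi> $ 1) ^ j\<close>. Row 0 contains no derivative and is left alone.\<close>

lemma det_frobenius_fps_matrix_compose:
  assumes "\<phi> $ 0 = 0"
  shows "det (frobenius_fps_matrix r0 (\<lambda>c. f c oo \<phi>) N) =
    (\<phi> $ 1) ^ (\<Sum>i<N. i) * det (frobenius_fps_matrix r0 f N)"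
proof -
  define L where "L = mat (Suc N) (Suc N) (\<lambda>(r, k). case r of 0 \<Rightarrow> if k = 0 then 1 else 0
    | Suc i \<Rightarrow> (case k of 0 \<Rightarrow> 0 | Suc j \<Rightarrow> (\<phi> ^ j) $ i))"
  have L: "L \<in> carrier_mat (Suc N) (Suc N)" by (simp add: L_def)
  have zero: "(\<phi> ^ j) $ i = 0" if "i < j" for i j
    using startsby_zero_power_prefix[OF assms, of j] that by blast
  have "frobenius_fps_matrix r0 (\<lambda>c. f c oo \<phi>) N = L * frobenius_fps_matrix r0 f N"
  proof (rule eq_matI)
    fix r c assume "r < dim_row (L * frobenius_fps_matrix r0 f N)"
      "c < dim_col (L * frobenius_fps_matrix r0 f N)"
    hence rc: "r < Suc N" "c < Suc N" using L by auto
    have *: "(L * frobenius_fps_matrix r0 f N) $$ (r, c) = L $$ (r, 0) * r0 c +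
        (\<Sum>j<N. L $$ (r, Suc j) * f c $ j)"
      using rc by (simp add: times_mat_index[OF L] sum.lessThan_Suc_shift del: sum.lessThan_Suc)
    show "frobenius_fps_matrix r0 (\<lambda>c. f c oo \<phi>) N $$ (r, c) =
        (L * frobenius_fps_matrix r0 f N) $$ (r, c)"
    proof (cases r)
      case 0
      thus ?thesis unfolding * using rc by (simp add: L_def)
    next
      case (Suc i)
      have "(\<Sum>j<N. (\<phi> ^ j) $ i * f c $ j) = (\<Sum>j=0..i. f c $ j * (\<phi> ^ j) $ i)"
        using zero rc Suc by (intro sum.mono_neutral_cong_right) auto
      thus ?thesis unfolding * using rc Suc by (simp add: L_def fps_compose_nth)
    qed
  qed (use L in auto)
  moreover have "det L = (\<phi> $ 1) ^ (\<Sum>i<N. i)"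
  proof -
    have "det L = prod_list (diag_mat L)"
      by (rule det_lower_triangular[OF _ L]) (auto simp: L_def zero split: nat.split)
    also have "\<dots> = (\<Prod>i<Suc N. L $$ (i, i))"
      using L by (simp add: prod_list_diag_prod atLeast0LessThan)
    also have "\<dots> = (\<Prod>i<N. (\<phi> $ 1) ^ i)"
      using startsby_zero_power_nth_same[OF assms]
      by (simp add: prod.lessThan_Suc_shift L_def del: prod.lessThan_Suc)
    finally show ?thesis by (simp add: power_sum)
  qed
  ultimately show ?thesis using det_mult[OF L frobenius_fps_matrix_carrier] by simp
qed

text \<open>Used to take the monomial x ^ i y ^ j, common to all entries of a column, out of the
  determinant.\<close>

lemma det_frobenius_fps_matrix_scale:
  fixes g :: "nat \<Rightarrow> 'a::field"
  shows "det (frobenius_fps_matrix (\<lambda>c. g c * r0 c) (\<lambda>c. fps_const (g c) * f c) N) =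
    (\<Prod>c\<le>N. g c) * det (frobenius_fps_matrix r0 f N)"
proof -
  define U where "U = mat (Suc N) (Suc N) (\<lambda>(r, c). if r = c then g c else 0)"
  have U: "U \<in> carrier_mat (Suc N) (Suc N)" by (simp add: U_def)
  have "frobenius_fps_matrix (\<lambda>c. g c * r0 c) (\<lambda>c. fps_const (g c) * f c) N =
      frobenius_fps_matrix r0 f N * U" (is "?A = ?B * U")
  proof (rule eq_matI)
    fix r c assume "r < dim_row (?B * U)" "c < dim_col (?B * U)"
    hence rc: "r < Suc N" "c < Suc N" using U by auto
    have "(?B * U) $$ (r, c) = (\<Sum>k<Suc N. if k = c then ?B $$ (r, k) * g c else 0)"
      unfolding times_mat_index[OF frobenius_fps_matrix_carrier U rc]
      using rc by (intro sum.cong) (auto simp: U_def)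
    also have "\<dots> = ?B $$ (r, c) * g c" using rc by (subst sum.delta) auto
    finally show "?A $$ (r, c) = (?B * U) $$ (r, c)" using rc by (cases r) auto
  qed (use U in auto)
  moreover have "det U = (\<Prod>c\<le>N. g c)"
  proof -
    have "det U = prod_list (diag_mat U)"
      by (rule det_lower_triangular[OF _ U]) (auto simp: U_def)
    also have "\<dots> = (\<Prod>i<Suc N. U $$ (i, i))"
      using U by (simp add: prod_list_diag_prod atLeast0LessThan)
    also have "\<dots> = (\<Prod>c\<le>N. g c)"
      unfolding lessThan_Suc_atMost by (rule prod.cong) (auto simp: U_def)
    finally show ?thesis .
  qed
  ultimately show ?thesis using det_mult[OF frobenius_fps_matrix_carrier U, of r0 f] by simp
qed

context filtration begin

text \<open>Recombining columns is right multiplication by the matrix of the \<kappa>. Its entries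
  are natural numbers, hence in \<open>G 0\<close>, and so is its determinant: a bound found in a
  better basis of functions holds in the original one.\<close>

lemma det_change_of_basis_mem:
  fixes \<kappa> :: "'i \<Rightarrow> 'i \<Rightarrow> nat"
  assumes ps: "distinct ps" "length ps = Suc N"
    and r0: "\<And>p. p \<in> set ps \<Longrightarrow> r0 p = (\<Sum>p'\<in>set ps. of_nat (\<kappa> p' p) * r0' p')"
    and f: "\<And>p. p \<in> set ps \<Longrightarrow> f p = (\<Sum>p'\<in>set ps. of_nat (\<kappa> p' p) * f' p')"
    and mem: "det (frobenius_fps_matrix (\<lambda>c. r0' (ps ! c)) (\<lambda>c. f' (ps ! c)) N) \<in> G e"
  shows "det (frobenius_fps_matrix (\<lambda>c. r0 (ps ! c)) (\<lambda>c. f (ps ! c)) N) \<in> G e"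
proof -
  define U :: "'a mat" where
    "U = mat (Suc N) (Suc N) (\<lambda>(r, c). of_nat (\<kappa> (ps ! r) (ps ! c)))"
  have U: "U \<in> carrier_mat (Suc N) (Suc N)" by (simp add: U_def)
  have reindex: "(\<Sum>p\<in>set ps. h p) = (\<Sum>k<Suc N. h (ps ! k))" for h :: "'i \<Rightarrow> 'b::comm_monoid_add"
    using sum.reindex_bij_betw[OF bij_betw_nth[OF ps(1) refl refl], of h] ps(2) by simp
  have "frobenius_fps_matrix (\<lambda>c. r0 (ps ! c)) (\<lambda>c. f (ps ! c)) N =
      frobenius_fps_matrix (\<lambda>c. r0' (ps ! c)) (\<lambda>c. f' (ps ! c)) N * U" (is "?A = ?B * U")
  proof (rule eq_matI)
    fix r c assume "r < dim_row (?B * U)" "c < dim_col (?B * U)"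
    hence rc: "r < Suc N" "c < Suc N" using U by auto
    have mem: "ps ! c \<in> set ps" using rc ps by simp
    have "(?B * U) $$ (r, c) = (\<Sum>k<Suc N. ?B $$ (r, k) * of_nat (\<kappa> (ps ! k) (ps ! c)))"
      unfolding times_mat_index[OF frobenius_fps_matrix_carrier U rc]
      using rc by (intro sum.cong) (auto simp: U_def)
    also have "\<dots> = ?A $$ (r, c)"
    proof (cases r)
      case 0
      thus ?thesis using rc unfolding frobenius_fps_matrix_0[OF rc(2)[unfolded less_Suc_eq_le]]
        by (simp add: r0[OF mem] reindex mult.commute less_Suc_eq_le del: sum.lessThan_Suc)
    next
      case (Suc i)
      have "?A $$ (r, c) = f (ps ! c) $ i" using rc Suc by simp
      also have "\<dots> = (\<Sum>k<Suc N. of_nat (\<kappa> (ps ! k) (ps ! c)) * f' (ps ! k) $ i)"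
        unfolding f[OF mem] reindex fps_sum_nth by (simp flip: fps_of_nat del: sum.lessThan_Suc)
      finally show ?thesis using rc Suc
        by (simp add: mult.commute less_Suc_eq_le del: sum.lessThan_Suc)
    qed
    finally show "?A $$ (r, c) = (?B * U) $$ (r, c)" ..
  qed (use U in auto)
  moreover have "det U \<in> G 0"
    by (rule det_mem0[OF U]) (auto simp: U_def intro: of_nat_mem)
  ultimately show ?thesis
    using det_mult[OF frobenius_fps_matrix_carrier U] mult_mem0[OF _ mem] by (simp add: mult.commute)
qed

text \<open>A unipotent row operation subtracts \<open>z ^ i\<close> times row \<open>Suc i\<close>
  from row 0, that is, the Taylor polynomials at increment \<open>z\<close>. What is left of row 0
  then carries the order \<open>e\<close> alone.\<close>

lemma det_row_reduction_mem:
  assumes f: "\<And>c i. c \<le> N \<Longrightarrow> f c $ i \<in> G 0" and z: "z \<in> G 0"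
    and r0: "\<And>c. c \<le> N \<Longrightarrow> r0 c - (\<Sum>i<N. f c $ i * z ^ i) \<in> G e"
  shows "det (frobenius_fps_matrix r0 f N) \<in> G e"
proof -
  define P where "P = mat (Suc N) (Suc N) (\<lambda>(r, c). if r = c then 1 else
    if r = 0 then z ^ (c - 1) else 0)"
  have P: "P \<in> carrier_mat (Suc N) (Suc N)" by (simp add: P_def)
  define r1 where "r1 c = r0 c - (\<Sum>i<N. f c $ i * z ^ i)" for c
  have "frobenius_fps_matrix r0 f N = P * frobenius_fps_matrix r1 f N" (is "?A = P * ?B")
  proof (rule eq_matI)
    fix r c assume "r < dim_row (P * ?B)" "c < dim_col (P * ?B)"
    hence rc: "r < Suc N" "c < Suc N" using P by auto
    have *: "(P * ?B) $$ (r, c) = P $$ (r, 0) * r1 c + (\<Sum>j<N. P $$ (r, Suc j) * f c $ j)"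
      using rc by (simp add: times_mat_index[OF P] sum.lessThan_Suc_shift del: sum.lessThan_Suc)
    show "?A $$ (r, c) = (P * ?B) $$ (r, c)"
    proof (cases r)
      case 0
      thus ?thesis unfolding * using rc by (simp add: P_def r1_def mult.commute)
    next
      case (Suc i)
      have "(\<Sum>j<N. P $$ (r, Suc j) * f c $ j) = (\<Sum>j<N. if j = i then f c $ j else 0)"
        using Suc rc by (intro sum.cong) (auto simp: P_def)
      thus ?thesis unfolding * using rc Suc by (simp add: P_def)
    qed
  qed (use P in auto)
  moreover have "det P \<in> G 0"
    by (rule det_mem0[OF P]) (auto simp: P_def intro: power_mem0 z)
  moreover have "det (frobenius_fps_matrix r1 f N) \<in> G e"
    by (rule det_mem[where v = "\<lambda>_. e" and w = "\<lambda>_. 0" and N = N])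
      (use f r0 in \<open>auto simp: r1_def\<close>)
  ultimately show ?thesis
    using det_mult[OF P frobenius_fps_matrix_carrier] mult_mem0 by simp
qed

end

lemma solve_linear:
  fixes a :: "'a::field"
  assumes "a \<noteq> 0" "0 = a * g + S"
  shows "g = inverse a * - S"
proof -
  have "a * g = - S" using assms(2) by (simp add: eq_neg_iff_add_eq_0)
  hence "inverse a * (a * g) = inverse a * - S" by simp
  thus ?thesis using assms(1) by (simp flip: mult.assoc)
qed

section \<open>Power series with coefficients of bounded order\<close>

context filtration begin

definition coeffs_in :: "int \<Rightarrow> 'a fps \<Rightarrow> bool" where
  "coeffs_in e f \<longleftrightarrow> (\<forall>i. f $ i \<in> G e)"

lemma coeffs_in_add: "coeffs_in e f \<Longrightarrow> coeffs_in e g \<Longrightarrow> coeffs_in e (f + g)"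
  by (auto simp: coeffs_in_def intro: add_mem)

lemma coeffs_in_diff: "coeffs_in e f \<Longrightarrow> coeffs_in e g \<Longrightarrow> coeffs_in e (f - g)"
  by (auto simp: coeffs_in_def intro: diff_mem)

lemma coeffs_in_mult: "coeffs_in e f \<Longrightarrow> coeffs_in e' g \<Longrightarrow> coeffs_in (e + e') (f * g)"
  by (auto simp: coeffs_in_def fps_mult_nth intro!: sum_mem mult_mem)

lemma coeffs_in_mult0: "coeffs_in 0 f \<Longrightarrow> coeffs_in e g \<Longrightarrow> coeffs_in e (f * g)"
  using coeffs_in_mult[of 0 f e g] by simp

lemma coeffs_in_const: "u \<in> G e \<Longrightarrow> coeffs_in e (fps_const u)"
  by (auto simp: coeffs_in_def)

lemma coeffs_in_1: "coeffs_in 0 1"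
  by (auto simp: coeffs_in_def fps_one_def)

lemma coeffs_in_X: "coeffs_in 0 fps_X"
  by (auto simp: coeffs_in_def fps_X_def)

lemma coeffs_in_power: "coeffs_in e f \<Longrightarrow> coeffs_in (int k * e) (f ^ k)"
proof (induction k)
  case (Suc k)
  thus ?case using coeffs_in_mult[of e f "int k * e" "f ^ k"] by (simp add: algebra_simps)
qed (simp add: coeffs_in_1)

lemma coeffs_in_power0: "coeffs_in 0 f \<Longrightarrow> coeffs_in 0 (f ^ k)"
  using coeffs_in_power[of 0 f k] by simp

lemma coeffs_in_sum: "(\<And>i. i \<in> S \<Longrightarrow> coeffs_in e (h i)) \<Longrightarrow> coeffs_in e (sum h S)"
  by (auto simp: coeffs_in_def fps_sum_nth intro: sum_mem)

text \<open>The recursion for the coefficients of an inverse divides only by \<open>f $ 0\<close>,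
  whose inverse lies in \<open>G 0\<close>.\<close>

lemma coeffs_in_inverse:
  assumes f: "coeffs_in 0 f" and f0: "f $ 0 \<noteq> 0" "inverse (f $ 0) \<in> G 0"
  shows "coeffs_in 0 (inverse f)"
  unfolding coeffs_in_def
proof
  fix i show "inverse f $ i \<in> G 0"
  proof (induction i rule: less_induct)
    case (less i)
    show ?case
    proof (cases i)
      case (Suc k)
      define S where "S = (\<Sum>j=1..i. f $ j * inverse f $ (i - j))"
      have "0 = (f * inverse f) $ i"
        using f0(1) Suc by (simp add: inverse_mult_eq_1')
      also have "\<dots> = f $ 0 * inverse f $ i + S"
        unfolding fps_mult_nth S_def by (simp add: sum.atLeast_Suc_atMost)
      finally have "inverse f $ i = inverse (f $ 0) * - S"
        by (rule solve_linear[OF f0(1)])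
      moreover have "- S \<in> G 0"
        unfolding S_def
        by (intro uminus_mem sum_mem mult_mem0 less) (use f in \<open>auto simp: coeffs_in_def\<close>)
      ultimately show ?thesis using mult_mem0[OF f0(2), of "- S"] by (simp only:)
    qed (use f0 in simp)
  qed
qed

end

text \<open>\<open>E\<close> and its cutoff agree below degree \<open>r\<close>. As the constant
  term is 1, the first possible difference of their k-th powers is at \<open>r\<close>, where
  \<open>E $ r\<close> enters linearly with factor \<open>k\<close>. This isolates one unknown
  coefficient of a root.\<close>

lemma fps_power_nth_cutoff:
  fixes E :: "'a::field fps"
  assumes "E $ 0 = 1" "0 < r"
  shows "(\<forall>i<r. (E ^ k - fps_cutoff r E ^ k) $ i = 0) \<and>
    (E ^ k - fps_cutoff r E ^ k) $ r = of_nat k * E $ r"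
proof (induction k)
  case (Suc k)
  define C D H where "C = fps_cutoff r E" and "D = E - C" and "H = E ^ k - C ^ k"
  have D: "D $ i = 0" if "i < r" for i using that by (simp add: D_def C_def)
  have Dr: "D $ r = E $ r" by (simp add: D_def C_def)
  have H: "H $ i = 0" if "i < r" for i using Suc that by (simp add: H_def C_def)
  have Hr: "H $ r = of_nat k * E $ r" using Suc by (simp add: H_def C_def)
  have split: "E ^ Suc k - C ^ Suc k = H * E + D * C ^ k"
    by (simp add: H_def D_def algebra_simps)
  have zero: "(f * g) $ i = 0" if "\<And>i. i < r \<Longrightarrow> f $ i = 0" "i < r" for f g :: "'a fps" and i
    unfolding fps_mult_nth by (rule sum.neutral) (use that in auto)
  have top: "(f * g) $ r = f $ r * g $ 0" if "\<And>i. i < r \<Longrightarrow> f $ i = 0" for f g :: "'a fps"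
  proof -
    have "(f * g) $ r = (\<Sum>i=0..r. if i = r then f $ i * g $ 0 else 0)"
      unfolding fps_mult_nth
    proof (rule sum.cong)
      fix i assume "i \<in> {0..r}"
      thus "f $ i * g $ (r - i) = (if i = r then f $ i * g $ 0 else 0)"
        using that[of i] by (cases "i = r") auto
    qed simp
    thus ?thesis by simp
  qed
  have C0: "(C ^ k) $ 0 = 1"
    using assms by (simp add: C_def fps_power_zeroth)
  have "(H * E) $ r = of_nat k * E $ r" using top[of H E, OF H] assms(1) Hr by simp
  moreover have "(D * C ^ k) $ r = E $ r" using top[of D "C ^ k", OF D] Dr C0 by simp
  ultimately have E0: "(E ^ Suc k - C ^ Suc k) $ r = of_nat (Suc k) * E $ r"
    unfolding split fps_add_nth of_nat_Suc distrib_right by simp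
  have "(E ^ Suc k - C ^ Suc k) $ i = 0" if "i < r" for i
    using zero[of H i E] zero[of D i "C ^ k"] H D that unfolding split fps_add_nth by simp
  with E0 show ?case unfolding C_def by blast
qed auto

context filtration begin

text \<open>Induction on the degree: \<open>E $ r\<close> is recovered from \<open>E ^ n\<close> and
  the lower coefficients by a division by \<open>n\<close>. Applied inside k(X), this shows that
  taking the root does not leave k(X).\<close>

lemma coeffs_in_root:
  assumes E0: "E $ 0 = 1" and En: "coeffs_in 0 (E ^ n)"
    and n: "of_nat n \<noteq> (0::'a)" "inverse (of_nat n) \<in> G 0"
  shows "coeffs_in 0 E"
  unfolding coeffs_in_def
proof
  fix r show "E $ r \<in> G 0"
  proof (induction r rule: less_induct)
    case (less r)
    show ?case
    proof (cases "r = 0")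
      case False
      define C where "C = fps_cutoff r E"
      have "coeffs_in 0 C" using less by (auto simp: coeffs_in_def C_def)
      hence "coeffs_in 0 (E ^ n - C ^ n)" by (intro coeffs_in_diff coeffs_in_power0 En)
      hence "(E ^ n - C ^ n) $ r \<in> G 0" unfolding coeffs_in_def by blast
      moreover have "(E ^ n - C ^ n) $ r = of_nat n * E $ r"
        using fps_power_nth_cutoff[of E r n] E0 False unfolding C_def by simp
      ultimately have "of_nat n * E $ r \<in> G 0" by (simp only:)
      hence "inverse (of_nat n) * (of_nat n * E $ r) \<in> G 0" by (rule mult_mem0[OF n(2)])
      thus ?thesis using n(1) by (simp flip: mult.assoc)
    qed (simp add: E0 one_mem)
  qed
qed

text \<open>\<open>E ^ n - 1\<close> is \<open>E - 1\<close> times a sum of powers of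
  \<open>E\<close> whose constant term is \<open>n\<close>, hence times a unit.\<close>

lemma coeffs_in_root_minus_1:
  assumes E: "E $ 0 = 1" "coeffs_in 0 E" and En: "coeffs_in e (E ^ n - 1)"
    and n: "of_nat n \<noteq> (0::'a)" "inverse (of_nat n) \<in> G 0"
  shows "coeffs_in e (E - 1)"
proof -
  define S where "S = (\<Sum>i<n. E ^ i)"
  have S0: "S $ 0 = of_nat n" by (simp add: S_def fps_sum_nth fps_power_zeroth E)
  have "coeffs_in 0 S" unfolding S_def by (intro coeffs_in_sum coeffs_in_power0 E)
  hence "coeffs_in 0 (inverse S)" using n by (intro coeffs_in_inverse) (auto simp: S0)
  moreover have "E - 1 = inverse S * (E ^ n - 1)"
  proof -
    have "inverse S * S = 1" using n by (intro inverse_mult_eq_1) (simp add: S0)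
    moreover have "inverse S * ((E - 1) * S) = (inverse S * S) * (E - 1)" by (simp only: mult_ac)
    ultimately have "inverse S * ((E - 1) * S) = E - 1" by (simp only: mult_1)
    thus ?thesis using power_diff_1_eq[of E n] by (simp add: S_def)
  qed
  ultimately show ?thesis using coeffs_in_mult0 En by simp
qed

section \<open>Congruences and truncated Taylor evaluation\<close>

lemma cong_mult:
  assumes "u - u' \<in> G e" "v - v' \<in> G e" "u \<in> G 0" "v' \<in> G 0"
  shows "u * v - u' * v' \<in> G e"
proof -
  have "u * v - u' * v' = u * (v - v') + v' * (u - u')" by (simp add: algebra_simps)
  thus ?thesis using assms by (auto intro: add_mem mult_mem0)
qed

lemma cong_power:
  assumes "u - u' \<in> G e" "u \<in> G 0" "u' \<in> G 0"
  shows "u ^ k - u' ^ k \<in> G e"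
  by (induction k) (auto intro!: cong_mult assms power_mem0)

lemma cong_trans: "u - v \<in> G e \<Longrightarrow> v - w \<in> G e \<Longrightarrow> u - w \<in> G e"
  using add_mem[of "u - v" e "v - w"] by simp

text \<open>The Taylor polynomial at increment \<open>z\<close>, with as many terms as the
  determinant has derivative rows. It is a finite sum, so no convergence is involved.\<close>

definition trunc_eval :: "nat \<Rightarrow> 'a \<Rightarrow> 'a fps \<Rightarrow> 'a" where
  "trunc_eval N z f = (\<Sum>i<N. f $ i * z ^ i)"

lemma trunc_eval_add: "trunc_eval N z (f + g) = trunc_eval N z f + trunc_eval N z g"
  by (simp add: trunc_eval_def algebra_simps sum.distrib)

lemma trunc_eval_diff: "trunc_eval N z (f - g) = trunc_eval N z f - trunc_eval N z g"
  by (simp add: trunc_eval_def algebra_simps sum_subtractf)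

lemma trunc_eval_const_mult: "trunc_eval N z (fps_const u * f) = u * trunc_eval N z f"
  by (simp add: trunc_eval_def algebra_simps sum_distrib_left)

lemma trunc_eval_const: "0 < N \<Longrightarrow> trunc_eval N z (fps_const u) = u"
proof -
  assume "0 < N"
  moreover have "trunc_eval N z (fps_const u) = (\<Sum>i<N. if i = 0 then u else 0)"
    unfolding trunc_eval_def by (rule sum.cong) auto
  ultimately show ?thesis by simp
qed

lemma trunc_eval_X:
  assumes "2 \<le> N" shows "trunc_eval N z fps_X = z"
proof -
  have "trunc_eval N z fps_X = (\<Sum>i<N. if i = 1 then z else 0)"
    unfolding trunc_eval_def by (rule sum.cong) (auto simp: fps_X_def)
  thus ?thesis using assms by simp
qed

lemma trunc_eval_mem: "coeffs_in 0 f \<Longrightarrow> z \<in> G 0 \<Longrightarrow> trunc_eval N z f \<in> G 0"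
  by (auto simp: trunc_eval_def coeffs_in_def intro!: sum_mem mult_mem0 power_mem0)

text \<open>The products of terms lost by truncation have index sum at least \<open>N\<close>, hence
  contain \<open>z ^ N\<close>. So truncated evaluation behaves like a ring homomorphism modulo
  order \<open>N\<close>.\<close>

lemma trunc_eval_mult:
  assumes f: "coeffs_in 0 f" and g: "coeffs_in 0 g" and z: "z \<in> G 1"
  shows "trunc_eval N z (f * g) - trunc_eval N z f * trunc_eval N z g \<in> G (int N)"
proof -
  define h where "h = (\<lambda>(i, j). f $ i * g $ j * z ^ (i + j))"
  have "trunc_eval N z f * trunc_eval N z g = (\<Sum>p\<in>{..<N} \<times> {..<N}. h p)"
    by (simp add: trunc_eval_def sum_product sum.cartesian_product h_def power_add mult_ac)
  also have "{..<N} \<times> {..<N} = {p \<in> {..<N} \<times> {..<N}. fst p + snd p < N} \<union>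
      {p \<in> {..<N} \<times> {..<N}. N \<le> fst p + snd p}" by auto
  also have "sum h \<dots> = sum h {p \<in> {..<N} \<times> {..<N}. fst p + snd p < N} +
      sum h {p \<in> {..<N} \<times> {..<N}. N \<le> fst p + snd p}"
    by (rule sum.union_disjoint) auto
  \<comment> \<open>Pairs with sum below \<open>N\<close>, sorted by their sum, make up the Cauchy
    product.\<close>
  also have "sum h {p \<in> {..<N} \<times> {..<N}. fst p + snd p < N} =
      (\<Sum>(k, i)\<in>Sigma {..<N} (\<lambda>k. {0..k}). h (i, k - i))"
    by (rule sum.reindex_bij_witness[of _ "\<lambda>(k, i). (i, k - i)" "\<lambda>(i, j). (i + j, i)"]) auto
  also have "\<dots> = trunc_eval N z (f * g)"
    unfolding trunc_eval_def fps_mult_nth sum_distrib_right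
    by (subst sum.Sigma) (auto simp: h_def intro!: sum.cong)
  finally have "trunc_eval N z (f * g) - trunc_eval N z f * trunc_eval N z g =
      - sum h {p \<in> {..<N} \<times> {..<N}. N \<le> fst p + snd p}" by simp
  moreover have "h p \<in> G (int N)" if "N \<le> fst p + snd p" for p
  proof -
    have "z ^ (fst p + snd p) \<in> G (int N)"
      using power_mem[OF z, of "fst p + snd p"] that by (auto intro: antimono)
    thus ?thesis using f g
      by (auto simp: h_def coeffs_in_def split_beta intro!: mult_mem0)
  qed
  ultimately show ?thesis by (auto intro!: uminus_mem sum_mem)
qed

lemma trunc_eval_power:
  assumes f: "coeffs_in 0 f" and z: "z \<in> G 1" and N: "0 < N"
  shows "trunc_eval N z (f ^ k) - trunc_eval N z f ^ k \<in> G (int N)"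
proof (induction k)
  case 0
  show ?case using trunc_eval_const[OF N, of z 1] by simp
next
  case (Suc k)
  have z0: "z \<in> G 0" by (rule antimono[OF z]) simp
  have "trunc_eval N z f * trunc_eval N z (f ^ k) - trunc_eval N z f * trunc_eval N z f ^ k
      \<in> G (int N)"
    by (intro cong_mult Suc) (auto intro!: trunc_eval_mem power_mem0 f z0)
  thus ?case
    using cong_trans[OF trunc_eval_mult[OF f coeffs_in_power0[OF f] z, of N k]] by simp
qed

end

section \<open>Determinants of monomials\<close>

definition exponents :: "nat \<Rightarrow> (nat \<times> nat) set" where
  "exponents s = {(i, j). i < s \<and> j < s \<and> i + j \<le> s}"

lemma finite_exponents [simp]: "finite (exponents s)"
  by (rule finite_subset[of _ "{..<s} \<times> {..<s}"]) (auto simp: exponents_def)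

text \<open>The order that the determinant gains when column (i, j) is divisible by the j-th power
  of a local parameter. The exponent set is symmetric, so the same number serves for i.\<close>

definition weight :: "nat \<Rightarrow> int" where
  "weight s = (\<Sum>(i, j)\<in>exponents s. int j)"

text \<open>The Frobenius matrix with x ^ i y ^ j removed from column (i, j). In the application
  \<open>u\<close> and \<open>v\<close> are \<open>X ^ m\<close> and \<open>Y ^ m\<close>, that is,
  x ^ (q - 1) and y ^ (q - 1), so that row 0 represents the q-th powers.\<close>

definition monomial_matrix ::
    "(nat \<times> nat) list \<Rightarrow> 'a::field \<Rightarrow> 'a \<Rightarrow> 'a fps \<Rightarrow> 'a fps \<Rightarrow> 'a mat" where
  "monomial_matrix ps u v A B = frobenius_fps_matrix
     (\<lambda>c. case ps ! c of (i, j) \<Rightarrow> u ^ i * v ^ j) (\<lambda>c. case ps ! c of (i, j) \<Rightarrow> A ^ i * B ^ j)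
     (length ps - 1)"

lemma power_expand_minus_1:
  fixes v :: "'a::comm_ring_1"
  assumes ij: "(i, j) \<in> exponents s"
  shows "u ^ i * v ^ j = (\<Sum>(i', j')\<in>exponents s.
    of_nat (if i' = i then j choose j' else 0) * (u ^ i' * (v - 1) ^ j'))"
proof -
  have "v ^ j = (\<Sum>k\<le>j. of_nat (j choose k) * (v - 1) ^ k)"
    using binomial_ring[of "v - 1" 1 j] by simp
  hence "u ^ i * v ^ j = (\<Sum>k\<le>j. of_nat (j choose k) * (u ^ i * (v - 1) ^ k))"
    by (simp add: sum_distrib_left mult_ac)
  also have "\<dots> = (\<Sum>(i', j')\<in>(\<lambda>k. (i, k)) ` {..j}.
    of_nat (if i' = i then j choose j' else 0) * (u ^ i' * (v - 1) ^ j'))"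
    by (subst sum.reindex) (auto simp: inj_on_def)
  \<comment> \<open>The exponent set is closed under lowering \<open>j\<close>, so every binomial
    term is again a column of the matrix.\<close>
  also have "\<dots> = (\<Sum>(i', j')\<in>exponents s.
    of_nat (if i' = i then j choose j' else 0) * (u ^ i' * (v - 1) ^ j'))"
    using ij by (intro sum.mono_neutral_left finite_exponents) (auto simp: exponents_def image_iff not_le binomial_eq_0)
  finally show ?thesis .
qed

context filtration begin

text \<open>Once \<open>B\<close> is replaced by \<open>B - 1\<close>, the derivative rows of column
  (i, j) lie in \<open>G j\<close>. The column used for row 0 trades this \<open>j\<close> for
  \<open>\<tau> i j\<close>, which gives the condition on \<open>e\<close>.\<close>

lemma det_monomial_matrix_mem:
  assumes ps: "distinct ps" "set ps = exponents s" "ps \<noteq> []"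
    and A: "coeffs_in 0 A" and B: "coeffs_in 1 (B - 1)"
    and row0: "\<And>i j. (i, j) \<in> exponents s \<Longrightarrow> u ^ i * (v - 1) ^ j \<in> G (\<tau> i j)"
    and e: "\<And>i j. (i, j) \<in> exponents s \<Longrightarrow> e \<le> \<tau> i j - int j + weight s"
  shows "det (monomial_matrix ps u v A B) \<in> G e"
proof -
  define N where "N = length ps - 1"
  have N: "length ps = Suc N" using ps(3) by (simp add: N_def)
  define \<kappa> :: "nat \<times> nat \<Rightarrow> nat \<times> nat \<Rightarrow> nat"
    where "\<kappa> = (\<lambda>(i', j') (i, j). if i' = i then j choose j' else 0)"
  show ?thesis unfolding monomial_matrix_def N_def[symmetric]
  proof (rule det_change_of_basis_mem[where \<kappa> = \<kappa> and
        r0' = "\<lambda>(i :: nat, j :: nat). u ^ i * (v - 1) ^ j" and f' = "\<lambda>(i :: nat, j :: nat). A ^ i * (B - 1) ^ j"])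
    show "(case p of (i, j) \<Rightarrow> u ^ i * v ^ j) =
      (\<Sum>p'\<in>set ps. of_nat (\<kappa> p' p) * (case p' of (i, j) \<Rightarrow> u ^ i * (v - 1) ^ j))"
      if "p \<in> set ps" for p
      using that unfolding ps(2)
      by (cases p) (simp add: power_expand_minus_1[of _ _ s u v] split_beta \<kappa>_def)
    show "(case p of (i, j) \<Rightarrow> A ^ i * B ^ j) =
      (\<Sum>p'\<in>set ps. of_nat (\<kappa> p' p) * (case p' of (i, j) \<Rightarrow> A ^ i * (B - 1) ^ j))"
      if "p \<in> set ps" for p
      using that unfolding ps(2)
      by (cases p) (simp add: power_expand_minus_1[of _ _ s A B] split_beta \<kappa>_def)
    have mem: "ps ! c \<in> exponents s" if "c \<le> N" for c
      using that N ps(2) nth_mem[of c ps] by simp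
    have weight: "(\<Sum>c\<le>N. int (snd (ps ! c))) = weight s"
      using sum.reindex_bij_betw[OF bij_betw_nth[OF ps(1) refl refl], of "\<lambda>p. int (snd p)"] N
      by (simp add: weight_def ps(2) split_beta lessThan_Suc_atMost)
    show "det (frobenius_fps_matrix (\<lambda>c. case ps ! c of (i, j) \<Rightarrow> u ^ i * (v - 1) ^ j)
        (\<lambda>c. case ps ! c of (i, j) \<Rightarrow> A ^ i * (B - 1) ^ j) N) \<in> G e"
    proof (rule det_mem[OF frobenius_fps_matrix_carrier])
      fix c assume c: "c \<le> N"
      show "frobenius_fps_matrix (\<lambda>c. case ps ! c of (i, j) \<Rightarrow> u ^ i * (v - 1) ^ j)
          (\<lambda>c. case ps ! c of (i, j) \<Rightarrow> A ^ i * (B - 1) ^ j) N $$ (0, c)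
        \<in> G (case ps ! c of (i, j) \<Rightarrow> \<tau> i j)"
        using mem[OF c] row0 c by (auto split: prod.split)
      show "e \<le> (case ps ! c of (i, j) \<Rightarrow> \<tau> i j) - int (snd (ps ! c)) + (\<Sum>c\<le>N. int (snd (ps ! c)))"
        unfolding weight using mem[OF c] e by (auto split: prod.split)
      fix i assume i: "i < N"
      have "coeffs_in (int j) (A ^ k * (B - 1) ^ j)" for k j
        using coeffs_in_mult0[OF coeffs_in_power0[OF A] coeffs_in_power[OF B, of j]] by simp
      thus "frobenius_fps_matrix (\<lambda>c. case ps ! c of (i, j) \<Rightarrow> u ^ i * (v - 1) ^ j)
          (\<lambda>c. case ps ! c of (i, j) \<Rightarrow> A ^ i * (B - 1) ^ j) N $$ (Suc i, c)
        \<in> G (int (snd (ps ! c)))"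
        using i c by (auto simp: coeffs_in_def split: prod.split)
    qed
  qed (use ps N in auto)
qed

end

section \<open>Power series solutions and local orders\<close>

text \<open>
  \<open>A\<close> and \<open>B\<close> stand for the Taylor expansions of \<open>x\<close> and \<open>y\<close> divided by their constant terms.
\<close>

definition series_relation ::
    "'a::field \<Rightarrow> 'a \<Rightarrow> nat \<Rightarrow> 'a \<Rightarrow> 'a \<Rightarrow> 'a fps \<Rightarrow> 'a fps \<Rightarrow> bool" where
  "series_relation \<alpha> \<beta> n X Y A B \<longleftrightarrow> A $ 0 = 1 \<and> B $ 0 = 1 \<and>
     fps_const (\<alpha> * X * Y) * A ^ n * B ^ n - fps_const X * A ^ n - fps_const Y * B ^ n
       + fps_const \<beta> = 0"

lemma series_relation_const:
  assumes "series_relation \<alpha> \<beta> n X Y A B"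
  shows "\<alpha> * X * Y - X - Y + \<beta> = 0"
proof -
  have "(fps_const (\<alpha> * X * Y) * A ^ n * B ^ n - fps_const X * A ^ n - fps_const Y * B ^ n
       + fps_const \<beta>) $ 0 = 0"
    using assms by (simp add: series_relation_def)
  thus ?thesis using assms by (simp add: series_relation_def fps_power_zeroth)
qed

lemma eq_inverse_mult_fps:
  fixes d :: "'a::field fps"
  assumes "d $ 0 \<noteq> 0" "d * f = g"
  shows "f = inverse d * g"
proof -
  have "inverse d * g = (inverse d * d) * f" by (simp only: mult.assoc assms(2))
  thus ?thesis using inverse_mult_eq_1[OF assms(1)] by simp
qed

lemma solve_relation:
  fixes c :: "'a::comm_ring_1"
  assumes "c * w * z - x * w - y * z + f = 0"
  shows "(c * w - y) * z = x * w - f"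
proof -
  have "(c * w - y) * z - (x * w - f) = c * w * z - x * w - y * z + f"
    by (simp add: algebra_simps)
  thus ?thesis using assms by simp
qed

context filtration begin

lemma coeffs_in_binomial: "coeffs_in 0 ((1 + fps_X) ^ n)"
  by (intro coeffs_in_power0 coeffs_in_add coeffs_in_1 coeffs_in_X)

text \<open>With \<open>A = 1 + fps_X\<close> the relation is linear in \<open>B ^ n\<close>, so
  \<open>B ^ n = g / d\<close>. The curve equation makes the constant term of \<open>d\<close> equal
  to \<open>X - \<beta>\<close>, and this and \<open>n\<close> are all that is inverted. Moreover
  \<open>g - d\<close> has the factor \<open>X\<close>, so \<open>B\<close> is congruent to 1 where
  \<open>X\<close> vanishes.\<close>

lemma coeffs_in_solution:
  assumes rel: "series_relation \<alpha> \<beta> n X Y (1 + fps_X) B"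
    and mem: "\<alpha> \<in> G 0" "\<beta> \<in> G 0" "X \<in> G 0" "Y \<in> G 0"
    and inv: "X \<noteq> \<beta>" "inverse (X - \<beta>) \<in> G 0"
    and n: "of_nat n \<noteq> (0::'a)" "inverse (of_nat n) \<in> G 0"
  shows "coeffs_in 0 B" "X \<in> G 1 \<Longrightarrow> coeffs_in 1 (B - 1)"
proof -
  define W :: "'a fps" where "W = (1 + fps_X) ^ n"
  define d where "d = fps_const (\<alpha> * X * Y) * W - fps_const Y"
  define g where "g = fps_const X * W - fps_const \<beta>"
  have W: "coeffs_in 0 W" unfolding W_def by (rule coeffs_in_binomial)
  have W0: "W $ 0 = 1" by (simp add: W_def fps_power_zeroth)
  note const = series_relation_const[OF rel]
  have B0: "B $ 0 = 1" using rel by (simp add: series_relation_def)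
  have d0: "d $ 0 = X - \<beta>" using const by (simp add: d_def W0 algebra_simps)
  have d: "coeffs_in 0 d" unfolding d_def
    by (intro coeffs_in_diff coeffs_in_mult0 coeffs_in_const W mult_mem0 mem)
  have id: "coeffs_in 0 (inverse d)"
    using inv by (intro coeffs_in_inverse d) (auto simp: d0)
  have "fps_const (\<alpha> * X * Y) * W * B ^ n - fps_const X * W - fps_const Y * B ^ n
      + fps_const \<beta> = 0"
    using rel by (simp add: series_relation_def W_def)
  hence dB: "d * B ^ n = g" unfolding d_def g_def by (rule solve_relation)
  have Bn: "B ^ n = inverse d * g"
  proof (rule eq_inverse_mult_fps)
    show "d $ 0 \<noteq> 0" using d0 inv(1) by simp
  qed (rule dB)
  have "coeffs_in 0 g" unfolding g_def
    by (intro coeffs_in_diff coeffs_in_mult0 coeffs_in_const W mem)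
  hence "coeffs_in 0 (B ^ n)" unfolding Bn by (intro coeffs_in_mult0 id)
  from coeffs_in_root[OF B0 this n] show B: "coeffs_in 0 B" .
  have gd: "g - d = (1 - fps_const \<alpha> * fps_const Y) * (W - 1) * fps_const X"
  proof -
    have "x * w - f - (e * x * y * w - y) = (1 - e * y) * (w - 1) * x - (e * x * y - x - y + f)"
      for x y e f w :: "'a fps" by (simp add: algebra_simps)
    moreover have "fps_const \<alpha> * fps_const X * fps_const Y - fps_const X - fps_const Y + fps_const \<beta> = 0"
      by (simp only: fps_const_mult fps_const_sub fps_const_add const fps_const_0_eq_0)
    ultimately show ?thesis
      unfolding g_def d_def fps_const_mult[symmetric] by (simp only: diff_zero)
  qed
  assume X: "X \<in> G 1"
  have "coeffs_in 1 (g - d)" unfolding gd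
    by (intro coeffs_in_mult0 coeffs_in_const diff_mem mult_mem0 one_mem mem X coeffs_in_diff W coeffs_in_1)
  moreover have "B ^ n - 1 = inverse d * (g - d)"
  proof (rule eq_inverse_mult_fps)
    show "d $ 0 \<noteq> 0" using d0 inv(1) by simp
    show "d * (B ^ n - 1) = g - d" unfolding right_diff_distrib dB by simp
  qed
  ultimately have "coeffs_in 1 (B ^ n - 1)"
    using coeffs_in_mult0[OF id, of 1 "g - d"] by (simp only:)
  from coeffs_in_root_minus_1[OF B0 B this n] show "coeffs_in 1 (B - 1)" .
qed

text \<open>The argument for finite \<open>X\<close> with the relation divided by \<open>X\<close>,
  so that all coefficients are integral at a pole of \<open>X\<close>. Now \<open>d\<close> has
  constant term \<open>1 - \<beta> * inverse X\<close>, and \<open>g - d\<close> has the factor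
  \<open>inverse X\<close>.\<close>

lemma coeffs_in_solution_infinity:
  assumes rel: "series_relation \<alpha> \<beta> n X Y (1 + fps_X) B"
    and mem: "\<alpha> \<in> G 0" "\<beta> \<in> G 0" "inverse X \<in> G 1" "Y \<in> G 0" "X \<noteq> 0"
    and inv: "1 - \<beta> * inverse X \<noteq> 0" "inverse (1 - \<beta> * inverse X) \<in> G 0"
    and n: "of_nat n \<noteq> (0::'a)" "inverse (of_nat n) \<in> G 0"
  shows "coeffs_in 0 B" "coeffs_in 1 (B - 1)"
proof -
  define W :: "'a fps" where "W = (1 + fps_X) ^ n"
  define x where "x = inverse X"
  define d where "d = fps_const (\<alpha> * Y) * W - fps_const (x * Y)"
  define g where "g = W - fps_const (\<beta> * x)"
  have W: "coeffs_in 0 W" unfolding W_def by (rule coeffs_in_binomial)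
  have W0: "W $ 0 = 1" by (simp add: W_def fps_power_zeroth)
  have x1: "x * X = 1" "X * x = 1" using mem by (auto simp: x_def)
  have x: "x \<in> G 1" "x \<in> G 0" using mem antimono[of x 1 0] by (auto simp: x_def)
  have "x * (\<alpha> * X * Y - X - Y + \<beta>) = 0" using series_relation_const[OF rel] by simp
  also have "x * (\<alpha> * X * Y - X - Y + \<beta>) = (x * X) * (\<alpha> * Y) - x * X - x * Y + \<beta> * x"
    by (simp add: algebra_simps)
  finally have const: "\<alpha> * Y - 1 - x * Y + \<beta> * x = 0" unfolding x1 by simp
  have B0: "B $ 0 = 1" using rel by (simp add: series_relation_def)
  have d0: "d $ 0 = 1 - \<beta> * inverse X" using const by (simp add: d_def W0 algebra_simps x_def)
  have d: "coeffs_in 0 d" unfolding d_def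
    by (intro coeffs_in_diff coeffs_in_mult0 coeffs_in_const W mult_mem0 mem x)
  have id: "coeffs_in 0 (inverse d)"
    using inv by (intro coeffs_in_inverse d) (auto simp: d0)
  have "fps_const x * (fps_const (\<alpha> * X * Y) * W * B ^ n - fps_const X * W - fps_const Y * B ^ n
      + fps_const \<beta>) = 0"
    using rel by (simp add: series_relation_def W_def)
  also have "fps_const x * (fps_const (\<alpha> * X * Y) * W * B ^ n - fps_const X * W - fps_const Y * B ^ n
      + fps_const \<beta>) = fps_const (x * X) * fps_const (\<alpha> * Y) * W * B ^ n - fps_const (x * X) * W
      - fps_const (x * Y) * B ^ n + fps_const (\<beta> * x)"
    (is "_ * (?c * W * ?z - ?X * W - ?Y * ?z + ?b) = _")
  proof -
    have key: "t * (c * w * z - p * w - r * z + f) = (t * c) * w * z - (t * p) * w - (t * r) * z + t * f"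
      for t c w z p r f :: "'a fps" by (simp add: algebra_simps)
    have e: "x * (\<alpha> * X * Y) = x * X * (\<alpha> * Y)" "\<beta> * x = x * \<beta>"
      by (simp_all add: mult_ac)
    show ?thesis unfolding key fps_const_mult e by (rule refl)
  qed
  also have "\<dots> = fps_const (\<alpha> * Y) * W * B ^ n - 1 * W - fps_const (x * Y) * B ^ n + fps_const (\<beta> * x)"
    by (simp only: x1 fps_const_1_eq_1 mult_1)
  finally have dB: "d * B ^ n = g" unfolding d_def g_def using solve_relation[of _ W "B ^ n" 1] by simp
  have Bn: "B ^ n = inverse d * g"
  proof (rule eq_inverse_mult_fps)
    show "d $ 0 \<noteq> 0" using d0 inv(1) by simp
  qed (rule dB)
  have "coeffs_in 0 g" unfolding g_def
    by (intro coeffs_in_diff coeffs_in_const W mem mult_mem0 x)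
  hence "coeffs_in 0 (B ^ n)" unfolding Bn by (intro coeffs_in_mult0 id)
  from coeffs_in_root[OF B0 this n] show B: "coeffs_in 0 B" .
  have gd: "g - d = (W - 1) * ((fps_const \<beta> - fps_const Y) * fps_const x)"
  proof -
    have "w - f * x - (e * y * w - x * y) = (w - 1) * ((f - y) * x) - w * (e * y - 1 - x * y + f * x)"
      for x y e f w :: "'a fps" by (simp add: algebra_simps)
    moreover have "fps_const \<alpha> * fps_const Y - 1 - fps_const x * fps_const Y + fps_const \<beta> * fps_const x = 0"
      by (simp only: fps_const_mult fps_const_sub fps_const_add const fps_const_0_eq_0
          fps_const_1_eq_1[symmetric])
    ultimately show ?thesis
      unfolding g_def d_def fps_const_mult[symmetric] by (simp only: mult_zero_right diff_zero)
  qed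
  have "coeffs_in 1 (g - d)" unfolding gd
    by (intro coeffs_in_mult0 coeffs_in_const diff_mem mult_mem0 mem x coeffs_in_diff W coeffs_in_1)
  moreover have "B ^ n - 1 = inverse d * (g - d)"
  proof (rule eq_inverse_mult_fps)
    show "d $ 0 \<noteq> 0" using d0 inv(1) by simp
    show "d * (B ^ n - 1) = g - d" unfolding right_diff_distrib dB by simp
  qed
  ultimately have "coeffs_in 1 (B ^ n - 1)"
    using coeffs_in_mult0[OF id, of 1 "g - d"] by (simp only:)
  from coeffs_in_root_minus_1[OF B0 B this n] show "coeffs_in 1 (B - 1)" .
qed

end

text \<open>Models a place with residue field k: \<open>u - \<iota> c \<in> G 1\<close> says that
  \<open>u\<close> has residue \<open>c\<close> and stands in for a residue map, and
  \<open>unit\<close> inverts the elements of nonzero residue.\<close>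

locale local_filtration = filtration G + field_hom \<iota>
  for G :: "int \<Rightarrow> 'a::field set" and \<iota> :: "'k::field \<Rightarrow> 'a" +
  assumes const_mem: "\<iota> c \<in> G 0"
    and unit: "u - \<iota> c \<in> G 1 \<Longrightarrow> c \<noteq> 0 \<Longrightarrow> u \<noteq> 0 \<and> inverse u \<in> G 0"
begin

lemma residue_mem: "u - \<iota> c \<in> G 1 \<Longrightarrow> u \<in> G 0"
  using add_mem[OF antimono[of "u - \<iota> c" 1 0] const_mem[of c]] by simp

lemma inverse_of_nat_mem:
  assumes "of_nat n \<noteq> (0::'k)"
  shows "of_nat n \<noteq> (0::'a)" "inverse (of_nat n :: 'a) \<in> G 0"
proof -
  have *: "(of_nat n :: 'a) = \<iota> (of_nat n)" by (simp add: hom_of_nat)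
  show "of_nat n \<noteq> (0::'a)" unfolding * using assms by simp
  show "inverse (of_nat n :: 'a) \<in> G 0" unfolding * hom_inverse[symmetric] by (rule const_mem)
qed

lemma residue_diff: "u - \<iota> c \<in> G 1 \<Longrightarrow> v - \<iota> d \<in> G 1 \<Longrightarrow> (u - v) - \<iota> (c - d) \<in> G 1"
  using diff_mem[of "u - \<iota> c" 1 "v - \<iota> d"] by (simp add: hom_minus algebra_simps)

lemma residue_mult: "u - \<iota> c \<in> G 1 \<Longrightarrow> v - \<iota> d \<in> G 1 \<Longrightarrow> u * v - \<iota> (c * d) \<in> G 1"
  unfolding hom_mult by (rule cong_mult) (auto intro: residue_mem const_mem)

lemma residue_power: "u - \<iota> c \<in> G 1 \<Longrightarrow> u ^ k - \<iota> (c ^ k) \<in> G 1"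
  unfolding hom_power by (rule cong_power) (auto intro: residue_mem const_mem)

lemma residue_const: "\<iota> c - \<iota> c \<in> G 1"
  by simp

text \<open>Where \<open>X\<close> vanishes, \<open>Y\<close> has residue \<open>b\<close>. If
  \<open>b ^ m = 1\<close>, then \<open>Y ^ m - 1\<close> vanishes too and row 0 is as divisible as
  the derivative rows. Otherwise row 0 may fall short in column (i, j) by \<open>j\<close>, which is
  at most \<open>s - 1\<close>. With \<open>X\<close> and \<open>Y\<close> exchanged this applies at
  the zero of \<open>Y\<close>.\<close>

lemma det_order_at_zero:
  assumes rel: "series_relation (\<iota> a) (\<iota> b) n X Y (1 + fps_X) B"
    and ps: "distinct ps" "set ps = exponents s" "ps \<noteq> []"
    and n: "of_nat n \<noteq> (0::'k)" and b: "b \<noteq> 0"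
    and X: "X \<in> G 1" and Y: "Y - \<iota> b \<in> G 1"
  shows "det (monomial_matrix ps (X ^ m) (Y ^ m) (1 + fps_X) B)
    \<in> G (weight s - (if b ^ m = 1 then 0 else int s - 1))"
proof -
  have X0: "X \<in> G 0" by (rule antimono[OF X]) simp
  have Y0: "Y \<in> G 0" by (rule residue_mem[OF Y])
  have "(X - \<iota> b) - \<iota> (0 - b) \<in> G 1" using X by (intro residue_diff residue_const) simp
  from unit[OF this] b have inv: "X \<noteq> \<iota> b" "inverse (X - \<iota> b) \<in> G 0" by auto
  note B = coeffs_in_solution[OF rel const_mem const_mem X0 Y0 inv inverse_of_nat_mem[OF n]]
  define \<kappa> where "\<kappa> = (if b ^ m = 1 then 1 else 0 :: int)"
  have Ym: "Y ^ m - 1 \<in> G \<kappa>"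
  proof (cases "b ^ m = 1")
    case True
    thus ?thesis using residue_power[OF Y, of m] by (simp add: \<kappa>_def power_inverse)
  next
    case False
    thus ?thesis by (auto simp: \<kappa>_def intro!: diff_mem power_mem0 Y0)
  qed
  show ?thesis
  proof (rule det_monomial_matrix_mem[OF ps _ B(2)[OF X]])
    show "coeffs_in 0 (1 + fps_X)" by (intro coeffs_in_add coeffs_in_1 coeffs_in_X)
    show "(X ^ m) ^ i * (Y ^ m - 1) ^ j \<in> G (int j * \<kappa>)" for i j
      by (intro mult_mem0 power_mem0 X0 power_mem Ym)
    show "weight s - (if b ^ m = 1 then 0 else int s - 1) \<le> int j * \<kappa> - int j + weight s"
      if "(i, j) \<in> exponents s" for i j
      using that by (auto simp: exponents_def \<kappa>_def)
  qed
qed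

text \<open>Row 0 has poles: the i-th power of \<open>X ^ m\<close> costs at most
  \<open>(s - 1) * m\<close>. If \<open>a ^ m\<close> is not 1, the factor
  \<open>(Y ^ m - 1) ^ j\<close> does not compensate the weight \<open>j\<close>, but
  \<open>i + j \<le> s\<close> limits the additional loss to 1.\<close>

lemma det_order_at_infinity:
  assumes rel: "series_relation (\<iota> a) (\<iota> b) n X Y (1 + fps_X) B"
    and ps: "distinct ps" "set ps = exponents s" "ps \<noteq> []"
    and n: "of_nat n \<noteq> (0::'k)" and m: "0 < m"
    and X: "X \<noteq> 0" "inverse X \<in> G 1" "X \<in> G (- 1)" and Y: "Y - \<iota> (inverse a) \<in> G 1"
  shows "det (monomial_matrix ps (X ^ m) (Y ^ m) (1 + fps_X) B)
    \<in> G (weight s - (int s - 1) * int m - (if a ^ m = 1 then 0 else 1))"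
proof -
  have Y0: "Y \<in> G 0" by (rule residue_mem[OF Y])
  have "(\<iota> 1 - \<iota> b * inverse X) - \<iota> (1 - b * 0) \<in> G 1"
    using X by (intro residue_diff residue_mult residue_const) simp
  from unit[OF this] have inv: "1 - \<iota> b * inverse X \<noteq> 0" "inverse (1 - \<iota> b * inverse X) \<in> G 0"
    by auto
  note B = coeffs_in_solution_infinity[OF rel const_mem const_mem X(2) Y0 X(1) inv
      inverse_of_nat_mem[OF n]]
  define \<kappa> where "\<kappa> = (if a ^ m = 1 then 1 else 0 :: int)"
  have Ym: "Y ^ m - 1 \<in> G \<kappa>"
  proof (cases "a ^ m = 1")
    case True
    thus ?thesis using residue_power[OF Y, of m] by (simp add: \<kappa>_def power_inverse)
  next
    case False
    thus ?thesis by (auto simp: \<kappa>_def intro!: diff_mem power_mem0 Y0)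
  qed
  show ?thesis
  proof (rule det_monomial_matrix_mem[OF ps _ B(2)])
    show "coeffs_in 0 (1 + fps_X)" by (intro coeffs_in_add coeffs_in_1 coeffs_in_X)
    show "(X ^ m) ^ i * (Y ^ m - 1) ^ j \<in> G (- int i * int m + int j * \<kappa>)" for i j
      using mult_mem[OF power_mem[OF power_mem[OF X(3), of m], of i] power_mem[OF Ym, of j]] by simp
    show "weight s - (int s - 1) * int m - (if a ^ m = 1 then 0 else 1)
        \<le> - int i * int m + int j * \<kappa> - int j + weight s"
      if ij: "(i, j) \<in> exponents s" for i j
    proof -
      have "int i \<le> int s - 1" "int i + int j \<le> int s" using ij by (auto simp: exponents_def)
      moreover from this(1) have "int i * int m \<le> (int s - 1) * int m"
        by (intro mult_right_mono) auto
      \<comment> \<open>\<open>i * m + j\<close> is split as \<open>i * (m - 1) + (i + j)\<close>,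
        which is at most \<open>(s - 1) * (m - 1) + s\<close>.\<close>
      moreover from calculation(1) have "int i * (int m - 1) \<le> (int s - 1) * (int m - 1)"
        using m by (intro mult_right_mono) auto
      ultimately show ?thesis by (auto simp: \<kappa>_def algebra_simps)
    qed
  qed
qed

text \<open>Frobenius fixes a rational point, so the Taylor polynomial of a function at the
  increment from x to x ^ q gives its q-th power modulo order \<open>N\<close>. In the scaled series
  x ^ q / x = \<open>X ^ m\<close> is the value of \<open>1 + fps_X\<close> at
  \<open>X ^ m - 1\<close>. The equation \<open>q\<close> is the q-th power of the curve
  equation.\<close>

lemma det_order_at_rational_point:
  assumes rel: "series_relation (\<iota> a) (\<iota> b) n X Y (1 + fps_X) B"
    and ps: "set ps = exponents s" "length ps = Suc N" "2 \<le> N"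
    and n: "of_nat n \<noteq> (0::'k)"
    and q: "\<iota> a * X ^ (n * m + 1) * Y ^ (n * m + 1) - X ^ (n * m + 1) - Y ^ (n * m + 1) + \<iota> b = 0"
    and X: "X - \<iota> c \<in> G 1" "c ^ m = 1" "c \<noteq> b" "a * c \<noteq> 1"
    and Y: "Y - \<iota> d \<in> G 1" "d ^ m = 1" "d \<noteq> 0"
  shows "det (monomial_matrix ps (X ^ m) (Y ^ m) (1 + fps_X) B) \<in> G (int N)"
proof -
  have X0: "X \<in> G 0" and Y0: "Y \<in> G 0" using X(1) Y(1) by (auto intro: residue_mem)
  have "(X - \<iota> b) - \<iota> (c - b) \<in> G 1" by (intro residue_diff X residue_const)
  from unit[OF this] X have inv: "X \<noteq> \<iota> b" "inverse (X - \<iota> b) \<in> G 0" by auto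
  have B: "coeffs_in 0 B"
    by (rule coeffs_in_solution(1)[OF rel const_mem const_mem X0 Y0 inv inverse_of_nat_mem[OF n]])
  have A: "coeffs_in 0 (1 + fps_X)" by (intro coeffs_in_add coeffs_in_1 coeffs_in_X)
  define z where "z = X ^ m - 1"
  have z: "z \<in> G 1" using residue_power[OF X(1), of m] X(2) by (simp add: z_def)
  have z0: "z \<in> G 0" by (rule antimono[OF z]) simp
  define v where "v = trunc_eval N z B"
  have v0: "v \<in> G 0" unfolding v_def by (intro trunc_eval_mem B z0)
  have N: "0 < N" using ps by simp
  have evA: "trunc_eval N z (1 + fps_X) = X ^ m"
    using trunc_eval_const[OF N, of z 1] trunc_eval_X[OF ps(3), of z]
    by (simp add: trunc_eval_add z_def)
  have Xm0: "X ^ m \<in> G 0" by (intro power_mem0 X0)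
  have Ym0: "Y ^ m \<in> G 0" by (intro power_mem0 Y0)
  have ev: "trunc_eval N z ((1 + fps_X) ^ i * B ^ j) - (X ^ m) ^ i * v ^ j \<in> G (int N)" for i j
  proof -
    have "trunc_eval N z ((1 + fps_X) ^ i) * trunc_eval N z (B ^ j) - (X ^ m) ^ i * v ^ j \<in> G (int N)"
      using trunc_eval_power[OF A z N, of i] trunc_eval_power[OF B z N, of j] unfolding evA v_def[symmetric]
      by (rule cong_mult) (auto intro!: trunc_eval_mem coeffs_in_power0 A B z0 power_mem0 v0 Xm0)
    thus ?thesis using trunc_eval_mult[OF coeffs_in_power0[OF A] coeffs_in_power0[OF B] z]
      by (blast intro: cong_trans)
  qed
  \<comment> \<open>\<open>v\<close> approximates the value of \<open>B\<close> at \<open>z\<close>.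
    With \<open>1 + fps_X\<close> evaluated to \<open>X ^ m\<close>, the relation holds for
    \<open>v\<close> modulo order \<open>N\<close> and for \<open>Y ^ m\<close> exactly; solving it
    for the n-th power shows that the n-th powers of \<open>v\<close> and \<open>Y ^ m\<close> agree
    modulo order \<open>N\<close>.\<close>
  have v_cong: "v - Y ^ m \<in> G (int N)"
  proof -
    define F where "F = (1 + fps_X :: 'a fps) ^ n * B ^ n"
    define r1 r2 r3 where "r1 = trunc_eval N z F - (X ^ m) ^ n * v ^ n"
      and "r2 = trunc_eval N z ((1 + fps_X) ^ n) - (X ^ m) ^ n"
      and "r3 = trunc_eval N z (B ^ n) - v ^ n"
    have r: "r1 \<in> G (int N)" "r2 \<in> G (int N)" "r3 \<in> G (int N)"
      using ev[of n n] ev[of n 0] ev[of 0 n] by (simp_all add: r1_def r2_def r3_def F_def)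
    have "trunc_eval N z (fps_const (\<iota> a * X * Y) * F - fps_const X * (1 + fps_X) ^ n
        - fps_const Y * B ^ n + fps_const (\<iota> b)) = trunc_eval N z (fps_const 0)"
      using rel by (simp add: series_relation_def F_def mult.assoc)
    hence "\<iota> a * X * Y * trunc_eval N z F - X * trunc_eval N z ((1 + fps_X) ^ n)
        - Y * trunc_eval N z (B ^ n) + \<iota> b = 0"
      unfolding trunc_eval_add trunc_eval_diff trunc_eval_const_mult trunc_eval_const[OF N] .
    hence "\<iota> a * X * Y * (r1 + (X ^ m) ^ n * v ^ n) - X * (r2 + (X ^ m) ^ n)
        - Y * (r3 + v ^ n) + \<iota> b = 0"
      by (simp add: r1_def r2_def r3_def)
    note E1 = this
    have E2: "\<iota> a * X * Y * ((X ^ m) ^ n * (Y ^ m) ^ n) - X * (X ^ m) ^ n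
        - Y * (Y ^ m) ^ n + \<iota> b = 0"
      using q by (simp add: power_mult mult_ac flip: power_mult)
    have "(e * (X * p) - 1) * Y * (w - t) = X * r2 + Y * r3 - e * X * Y * r1"
      if E: "e * X * Y * (r1 + p * w) - X * (r2 + p) - Y * (r3 + w) + f = 0"
        "e * X * Y * (p * t) - X * p - Y * t + f = 0" for e f p w t
    proof -
      have "(e * (X * p) - 1) * Y * (w - t) - (X * r2 + Y * r3 - e * X * Y * r1) =
          (e * X * Y * (r1 + p * w) - X * (r2 + p) - Y * (r3 + w) + f)
          - (e * X * Y * (p * t) - X * p - Y * t + f)"
        by (simp add: algebra_simps)
      thus ?thesis unfolding E by simp
    qed
    from this[OF E1 E2] have "(\<iota> a * (X * (X ^ m) ^ n) - 1) * Y * (v ^ n - (Y ^ m) ^ n) =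
        X * r2 + Y * r3 - \<iota> a * X * Y * r1" .
    also have "\<dots> \<in> G (int N)"
      by (intro diff_mem add_mem mult_mem0 r X0 Y0 const_mem)
    finally have main: "(\<iota> a * (X * (X ^ m) ^ n) - 1) * Y * (v ^ n - (Y ^ m) ^ n) \<in> G (int N)" .
    have "(\<iota> a * (X * (X ^ m) ^ n) - \<iota> 1) - \<iota> (a * (c * (c ^ m) ^ n) - 1) \<in> G 1"
      by (intro residue_diff residue_mult residue_power residue_const X)
    from unit[OF this] X have u1: "\<iota> a * (X * (X ^ m) ^ n) - 1 \<noteq> 0"
      "inverse (\<iota> a * (X * (X ^ m) ^ n) - 1) \<in> G 0" by auto
    from unit[OF Y(1,3)] have u2: "Y \<noteq> 0" "inverse Y \<in> G 0" by auto
    \<comment> \<open>\<open>v\<close> and \<open>Y ^ m\<close> both have residue 1, so this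
      cofactor of \<open>v - Y ^ m\<close> has residue \<open>n\<close> and is a unit: only one n-th
      root is near 1.\<close>
    define S where "S = (\<Sum>i<n. (Y ^ m) ^ (n - Suc i) * v ^ i)"
    have "B $ 0 - trunc_eval N z B \<in> G 1"
    proof -
      have "trunc_eval N z B = B $ 0 + (\<Sum>i=1..<N. B $ i * z ^ i)"
        using N unfolding trunc_eval_def by (simp add: lessThan_atLeast0 sum.atLeast_Suc_lessThan)
      moreover have "B $ i * z ^ i \<in> G 1" if "i \<in> {1..<N}" for i
        using B that power_mem[OF z, of i]
        by (auto simp: coeffs_in_def intro!: mult_mem0 intro: antimono)
      ultimately show ?thesis by (auto intro!: uminus_mem sum_mem)
    qed
    moreover have "B $ 0 = 1" using rel by (simp add: series_relation_def)
    ultimately have v1: "v - \<iota> 1 \<in> G 1" using uminus_mem[of "1 - v" 1] by (simp add: v_def)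
    have Ym1: "Y ^ m - \<iota> 1 \<in> G 1" using residue_power[OF Y(1), of m] Y(2) by simp
    have "S - of_nat n = (\<Sum>i<n. (Y ^ m) ^ (n - Suc i) * v ^ i - \<iota> (1 ^ (n - Suc i) * 1 ^ i))"
      by (simp add: S_def sum_subtractf)
    also have "\<dots> \<in> G 1"
      by (intro sum_mem residue_mult residue_power v1 Ym1)
    finally have "S - \<iota> (of_nat n) \<in> G 1" by (simp add: hom_of_nat)
    from unit[OF this n] have u3: "S \<noteq> 0" "inverse S \<in> G 0" by auto
    have split: "v ^ n - (Y ^ m) ^ n = (v - Y ^ m) * S"
      unfolding S_def by (rule power_diff_sumr2)
    have "w = inverse p * (inverse r * (inverse t * (p * r * (w * t))))"
      if "p \<noteq> 0" "r \<noteq> 0" "t \<noteq> 0" for p r t w :: 'a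
      using that by (simp add: field_simps)
    from this[OF u1(1) u2(1) u3(1), of "v - Y ^ m"]
    have "v - Y ^ m = inverse (\<iota> a * (X * (X ^ m) ^ n) - 1) * (inverse Y * (inverse S *
        ((\<iota> a * (X * (X ^ m) ^ n) - 1) * Y * (v ^ n - (Y ^ m) ^ n))))"
      unfolding split .
    also have "\<dots> \<in> G (int N)" by (intro mult_mem0 u1 u2 u3 main)
    finally show ?thesis .
  qed
  have mem: "ps ! c \<in> exponents s" if "c \<le> N" for c
    using that ps nth_mem[of c ps] by simp
  have "det (frobenius_fps_matrix (\<lambda>c. case ps ! c of (i, j) \<Rightarrow> (X ^ m) ^ i * (Y ^ m) ^ j)
      (\<lambda>c. case ps ! c of (i, j) \<Rightarrow> (1 + fps_X) ^ i * B ^ j) N) \<in> G (int N)"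
  proof (rule det_row_reduction_mem[OF _ z0])
    fix c assume "c \<le> N"
    obtain i j where c: "ps ! c = (i, j)" by fastforce
    have "(X ^ m) ^ i * v ^ j - (X ^ m) ^ i * (Y ^ m) ^ j \<in> G (int N)"
      by (intro cong_mult cong_power v_cong) (auto intro!: power_mem0 v0 Y0 X0)
    hence "trunc_eval N z ((1 + fps_X) ^ i * B ^ j) - (X ^ m) ^ i * (Y ^ m) ^ j \<in> G (int N)"
      using ev by (blast intro: cong_trans)
    from uminus_mem[OF this]
    show "(case ps ! c of (i, j) \<Rightarrow> (X ^ m) ^ i * (Y ^ m) ^ j) -
        (\<Sum>k<N. (case ps ! c of (i, j) \<Rightarrow> (1 + fps_X) ^ i * B ^ j) $ k * z ^ k) \<in> G (int N)"
      by (simp add: c trunc_eval_def)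
    have "coeffs_in 0 ((1 + fps_X) ^ i * B ^ j)"
      by (intro coeffs_in_mult0 coeffs_in_power0 A B)
    thus "(case ps ! c of (i, j) \<Rightarrow> (1 + fps_X) ^ i * B ^ j) $ k \<in> G 0" for k
      by (simp add: c coeffs_in_def)
  qed
  thus ?thesis using ps by (simp add: monomial_matrix_def)
qed

end

section \<open>Orders of rational functions\<close>

context field_hom begin

lemma eval1_0 [simp]: "eval1 hom 0 u = 0"
  by (simp add: eval1_def)

lemma eval1_pCons [simp]: "eval1 hom (pCons c P) u = hom c + u * eval1 hom P u"
  by (simp add: eval1_def map_poly_pCons)

lemma eval1_1 [simp]: "eval1 hom 1 u = 1"
  by (simp add: one_pCons)

lemma eval1_add: "eval1 hom (P + Q) u = eval1 hom P u + eval1 hom Q u"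
  by (induction P Q rule: poly_induct2) (simp_all add: hom_add algebra_simps)

lemma eval1_smult: "eval1 hom (smult c P) u = hom c * eval1 hom P u"
  by (induction P) (simp_all add: hom_mult algebra_simps)

lemma eval1_uminus: "eval1 hom (- P) u = - eval1 hom P u"
  using eval1_smult[of "- 1" P u] by (simp add: hom_uminus)

lemma eval1_diff: "eval1 hom (P - Q) u = eval1 hom P u - eval1 hom Q u"
  using eval1_add[of P "- Q" u] by (simp add: eval1_uminus)

lemma eval1_mult: "eval1 hom (P * Q) u = eval1 hom P u * eval1 hom Q u"
  by (induction P) (simp_all add: eval1_add eval1_smult algebra_simps)

lemma eval1_power: "eval1 hom (P ^ k) u = eval1 hom P u ^ k"
  by (induction k) (simp_all add: eval1_mult)

lemma eval1_monom: "eval1 hom (monom c i) u = hom c * u ^ i"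
  using eval1_power[of "[:0, 1:]" i u] eval1_smult[of c "[:0, 1:] ^ i" u] by (simp add: monom_altdef)

lemma eval1_const [simp]: "eval1 hom [:c:] u = hom c"
  by simp

end

locale transcendental_element = field_hom \<iota> for \<iota> :: "'k::field \<Rightarrow> 'a::field" +
  fixes X :: 'a
  assumes transcendental: "eval1 \<iota> P X = 0 \<Longrightarrow> P = 0"
begin

abbreviation ev :: "'k poly \<Rightarrow> 'a" where "ev P \<equiv> eval1 \<iota> P X"

lemma ev_eq_0_iff: "ev P = 0 \<longleftrightarrow> P = 0"
  using transcendental by auto

lemma ev_inject: "ev P = ev Q \<Longrightarrow> P = Q"
  using transcendental[of "P - Q"] by (simp add: eval1_diff)

lemma ev_linear [simp]: "ev [:- c, 1:] = X - \<iota> c"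
  by (simp add: hom_uminus)

lemma X_minus_const_nonzero: "X - \<iota> c \<noteq> 0"
  using ev_eq_0_iff[of "[:- c, 1:]"] by (simp add: hom_uminus)

text \<open>The elements of order at least \<open>e\<close> at \<open>X = c\<close>, and similarly at infinity.\<close>

definition order_at :: "'k \<Rightarrow> int \<Rightarrow> 'a set" where
  "order_at c e = {f. \<exists>P Q. poly Q c \<noteq> 0 \<and> f * ev Q = ev P * (X - \<iota> c) powi e}"

definition order_at_infinity :: "int \<Rightarrow> 'a set" where
  "order_at_infinity e =
     {f. \<exists>P Q. Q \<noteq> 0 \<and> f * ev Q = ev P \<and> (P = 0 \<or> int (degree P) + e \<le> int (degree Q))}"

definition regular_away :: "'k poly \<Rightarrow> 'a set" where
  "regular_away R = {f. \<exists>P k. f * ev (R ^ k) = ev P}"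

lemma order_atI: "poly Q c \<noteq> 0 \<Longrightarrow> f * ev Q = ev P * (X - \<iota> c) powi e \<Longrightarrow> f \<in> order_at c e"
  by (auto simp: order_at_def)

lemma X_minus_const_order_at: "X - \<iota> c \<in> order_at c 1"
  by (rule order_atI[of 1 _ _ 1]) simp_all

lemma local_filtration_order_at: "local_filtration (order_at c) \<iota>"
proof unfold_locales
  fix e
  show "0 \<in> order_at c e" by (rule order_atI[of 1 _ _ 0]) simp_all
next
  fix u v e assume "u \<in> order_at c e" "v \<in> order_at c e"
  then obtain P Q P' Q' where
    1: "poly Q c \<noteq> 0" "u * ev Q = ev P * (X - \<iota> c) powi e" and
    2: "poly Q' c \<noteq> 0" "v * ev Q' = ev P' * (X - \<iota> c) powi e"
    by (auto simp: order_at_def)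
  have "(u + v) * ev (Q * Q') = (u * ev Q) * ev Q' + (v * ev Q') * ev Q"
    by (simp add: eval1_mult algebra_simps)
  also have "\<dots> = ev (P * Q' + P' * Q) * (X - \<iota> c) powi e"
    unfolding 1 2 by (simp add: eval1_mult eval1_add algebra_simps)
  finally show "u + v \<in> order_at c e" using 1 2 by (intro order_atI) auto
next
  fix u e assume "u \<in> order_at c e"
  then obtain P Q where 1: "poly Q c \<noteq> 0" "u * ev Q = ev P * (X - \<iota> c) powi e"
    by (auto simp: order_at_def)
  thus "- u \<in> order_at c e" by (intro order_atI[of Q c _ "- P"]) (auto simp: eval1_uminus)
next
  fix u v e f assume "u \<in> order_at c e" "v \<in> order_at c f"
  then obtain P Q P' Q' where
    1: "poly Q c \<noteq> 0" "u * ev Q = ev P * (X - \<iota> c) powi e" and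
    2: "poly Q' c \<noteq> 0" "v * ev Q' = ev P' * (X - \<iota> c) powi f"
    by (auto simp: order_at_def)
  have "(u * v) * ev (Q * Q') = (u * ev Q) * (v * ev Q')"
    by (simp add: eval1_mult algebra_simps)
  also have "\<dots> = ev (P * P') * (X - \<iota> c) powi (e + f)"
    unfolding 1 2 eval1_mult power_int_add[OF disjI1[OF X_minus_const_nonzero]] by (simp only: mult_ac)
  finally show "u * v \<in> order_at c (e + f)" using 1 2 by (intro order_atI) auto
next
  show "1 \<in> order_at c 0" by (rule order_atI[of 1 _ _ 1]) simp_all
next
  fix u e f assume "u \<in> order_at c f" and le: "e \<le> f"
  then obtain P Q where 1: "poly Q c \<noteq> 0" "u * ev Q = ev P * (X - \<iota> c) powi f"
    by (auto simp: order_at_def)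
  have "(X - \<iota> c) powi f = (X - \<iota> c) powi (int (nat (f - e)) + e)" using le by simp
  also have "\<dots> = (X - \<iota> c) powi int (nat (f - e)) * (X - \<iota> c) powi e"
    by (rule power_int_add[OF disjI1[OF X_minus_const_nonzero]])
  also have "(X - \<iota> c) powi int (nat (f - e)) = (X - \<iota> c) ^ nat (f - e)"
    by (rule power_int_of_nat)
  finally have "u * ev Q = ev (P * [:- c, 1:] ^ nat (f - e)) * (X - \<iota> c) powi e"
    using 1(2) by (simp add: eval1_mult eval1_power hom_uminus mult.assoc)
  thus "u \<in> order_at c e" using 1(1) by (intro order_atI)
next
  fix d show "\<iota> d \<in> order_at c 0" by (rule order_atI[of 1 _ _ "[:d:]"]) simp_all
next
  fix u d assume "u - \<iota> d \<in> order_at c 1" and d: "d \<noteq> 0"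
  then obtain P Q where 1: "poly Q c \<noteq> 0" "(u - \<iota> d) * ev Q = ev P * (X - \<iota> c)"
    by (auto simp: order_at_def)
  \<comment> \<open>A numerator of \<open>u\<close>; its value at \<open>c\<close> is
    \<open>d\<close> times that of \<open>Q\<close>, hence nonzero.\<close>
  define R where "R = P * [:- c, 1:] + smult d Q"
  have R: "u * ev Q = ev R"
    unfolding R_def eval1_add eval1_mult eval1_smult ev_linear 1(2)[symmetric]
    by (simp add: algebra_simps)
  have Rc: "poly R c \<noteq> 0" using 1(1) d by (simp add: R_def)
  hence "ev R \<noteq> 0" by (auto simp: ev_eq_0_iff)
  hence "u \<noteq> 0" using R by auto
  moreover have "inverse u * ev R = ev Q * (X - \<iota> c) powi 0"
    unfolding R[symmetric] using \<open>u \<noteq> 0\<close> by simp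
  ultimately show "u \<noteq> 0 \<and> inverse u \<in> order_at c 0" using Rc by (auto intro: order_atI)
qed

lemma order_at_infinityI:
  "Q \<noteq> 0 \<Longrightarrow> f * ev Q = ev P \<Longrightarrow> P = 0 \<or> int (degree P) + e \<le> int (degree Q) \<Longrightarrow>
    f \<in> order_at_infinity e"
  by (auto simp: order_at_infinity_def)

lemma local_filtration_order_at_infinity: "local_filtration order_at_infinity \<iota>"
proof unfold_locales
  fix e
  show "0 \<in> order_at_infinity e" by (rule order_at_infinityI[of 1 _ 0]) simp_all
next
  fix u v e assume "u \<in> order_at_infinity e" "v \<in> order_at_infinity e"
  then obtain P Q P' Q' where
    1: "Q \<noteq> 0" "u * ev Q = ev P" "P = 0 \<or> int (degree P) + e \<le> int (degree Q)" and
    2: "Q' \<noteq> 0" "v * ev Q' = ev P'" "P' = 0 \<or> int (degree P') + e \<le> int (degree Q')"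
    by (auto simp: order_at_infinity_def)
  have "(u + v) * ev (Q * Q') = (u * ev Q) * ev Q' + (v * ev Q') * ev Q"
    by (simp add: eval1_mult algebra_simps)
  also have "\<dots> = ev (P * Q' + P' * Q)"
    unfolding 1 2 by (simp add: eval1_mult eval1_add algebra_simps)
  finally have eq: "(u + v) * ev (Q * Q') = ev (P * Q' + P' * Q)" .
  have "P * Q' + P' * Q = 0 \<or> int (degree (P * Q' + P' * Q)) + e \<le> int (degree (Q * Q'))"
  proof -
    have deg: "A = 0 \<or> int (degree A) + e \<le> d \<Longrightarrow> B = 0 \<or> int (degree B) + e \<le> d \<Longrightarrow>
        A + B = 0 \<or> int (degree (A + B)) + e \<le> d" for A B :: "'k poly" and d
      using degree_add_le_max[of A B] by auto
    have "P * Q' = 0 \<or> int (degree (P * Q')) + e \<le> int (degree (Q * Q'))"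
      by (cases "P = 0") (use 1 2 in \<open>auto simp: degree_mult_eq\<close>)
    moreover have "P' * Q = 0 \<or> int (degree (P' * Q)) + e \<le> int (degree (Q * Q'))"
      by (cases "P' = 0") (use 1 2 in \<open>auto simp: degree_mult_eq\<close>)
    ultimately show ?thesis by (rule deg)
  qed
  thus "u + v \<in> order_at_infinity e" using 1 2 eq by (intro order_at_infinityI) auto
next
  fix u e assume "u \<in> order_at_infinity e"
  then obtain P Q where
    1: "Q \<noteq> 0" "u * ev Q = ev P" "P = 0 \<or> int (degree P) + e \<le> int (degree Q)"
    by (auto simp: order_at_infinity_def)
  thus "- u \<in> order_at_infinity e"
    by (intro order_at_infinityI[of Q _ "- P"]) (auto simp: eval1_uminus)
next
  fix u v e f assume "u \<in> order_at_infinity e" "v \<in> order_at_infinity f"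
  then obtain P Q P' Q' where
    1: "Q \<noteq> 0" "u * ev Q = ev P" "P = 0 \<or> int (degree P) + e \<le> int (degree Q)" and
    2: "Q' \<noteq> 0" "v * ev Q' = ev P'" "P' = 0 \<or> int (degree P') + f \<le> int (degree Q')"
    by (auto simp: order_at_infinity_def)
  have "(u * v) * ev (Q * Q') = (u * ev Q) * (v * ev Q')"
    by (simp add: eval1_mult algebra_simps)
  also have "\<dots> = ev (P * P')" unfolding 1 2 by (simp add: eval1_mult)
  finally have eq: "(u * v) * ev (Q * Q') = ev (P * P')" .
  have "P * P' = 0 \<or> int (degree (P * P')) + (e + f) \<le> int (degree (Q * Q'))"
    by (cases "P = 0 \<or> P' = 0") (use 1 2 in \<open>auto simp: degree_mult_eq\<close>)
  thus "u * v \<in> order_at_infinity (e + f)" using 1 2 eq by (intro order_at_infinityI) auto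
next
  show "1 \<in> order_at_infinity 0" by (rule order_at_infinityI[of 1 _ 1]) simp_all
next
  fix u e f assume "u \<in> order_at_infinity f" and le: "e \<le> f"
  thus "u \<in> order_at_infinity e" by (force simp: order_at_infinity_def)
next
  fix d show "\<iota> d \<in> order_at_infinity 0" by (rule order_at_infinityI[of 1 _ "[:d:]"]) simp_all
next
  fix u d assume "u - \<iota> d \<in> order_at_infinity 1" and d: "d \<noteq> 0"
  then obtain P Q where
    1: "Q \<noteq> 0" "(u - \<iota> d) * ev Q = ev P" "P = 0 \<or> int (degree P) + 1 \<le> int (degree Q)"
    by (auto simp: order_at_infinity_def)
  define R where "R = P + smult d Q"
  have R: "u * ev Q = ev R"
    using 1(2) by (simp add: R_def eval1_add eval1_smult algebra_simps)
  have "degree R = degree Q \<and> R \<noteq> 0"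
  proof (cases "P = 0")
    case False
    hence "degree P < degree (smult d Q)" using 1 d by simp
    hence "degree R = degree Q" using d by (simp add: R_def degree_add_eq_right)
    thus ?thesis using False 1(3) by auto
  qed (use d 1 in \<open>auto simp: R_def\<close>)
  hence deg: "degree R = degree Q" "R \<noteq> 0" by auto
  hence "ev R \<noteq> 0" by (auto simp: ev_eq_0_iff)
  hence "u \<noteq> 0" using R by auto
  moreover have "inverse u * ev R = ev Q"
    unfolding R[symmetric] using \<open>u \<noteq> 0\<close> by simp
  ultimately show "u \<noteq> 0 \<and> inverse u \<in> order_at_infinity 0"
    using deg by (auto intro!: order_at_infinityI)
qed

lemma X_order_at_infinity: "X \<in> order_at_infinity (- 1)" "inverse X \<in> order_at_infinity 1"
proof -
  show "X \<in> order_at_infinity (- 1)" by (rule order_at_infinityI[of 1 _ "[:0, 1:]"]) simp_all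
  show "inverse X \<in> order_at_infinity 1"
    using X_minus_const_nonzero[of 0]
    by (intro order_at_infinityI[of "[:0, 1:]" _ 1]) simp_all
qed

lemma regular_awayI: "f * ev (R ^ k) = ev P \<Longrightarrow> f \<in> regular_away R"
  by (auto simp: regular_away_def)

text \<open>A family constant in its index forgets orders and records a subring only. With it the
  coefficient and determinant lemmas prove that poles occur at most at the roots of
  \<open>R\<close>.\<close>

lemma filtration_regular_away: "filtration (\<lambda>_. regular_away R)"
proof
  show "0 \<in> regular_away R" by (rule regular_awayI[where k = 0 and P = 0]) simp
  show "1 \<in> regular_away R" by (rule regular_awayI[where k = 0 and P = 1]) simp
next
  fix u v assume "u \<in> regular_away R" "v \<in> regular_away R"
  then obtain P k P' k' where
    1: "u * ev (R ^ k) = ev P" and 2: "v * ev (R ^ k') = ev P'"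
    by (auto simp: regular_away_def)
  have "(u + v) * ev (R ^ (k + k')) = (u * ev (R ^ k)) * ev (R ^ k') + (v * ev (R ^ k')) * ev (R ^ k)"
    by (simp add: eval1_mult eval1_power power_add algebra_simps)
  also have "\<dots> = ev (P * R ^ k' + P' * R ^ k)"
    unfolding 1 2 by (simp add: eval1_mult eval1_add)
  finally show "u + v \<in> regular_away R" unfolding regular_away_def by blast
  have "(u * v) * ev (R ^ (k + k')) = (u * ev (R ^ k)) * (v * ev (R ^ k'))"
    by (simp add: eval1_mult eval1_power power_add algebra_simps)
  also have "\<dots> = ev (P * P')" unfolding 1 2 by (simp add: eval1_mult)
  finally show "u * v \<in> regular_away R" unfolding regular_away_def by blast
next
  fix u assume "u \<in> regular_away R"
  then obtain P k where 1: "u * ev (R ^ k) = ev P" by (auto simp: regular_away_def)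
  hence "- u * ev (R ^ k) = ev (- P)" by (simp add: eval1_uminus)
  thus "- u \<in> regular_away R" unfolding regular_away_def by blast
qed

text \<open>Clearing denominators between two fractions for \<open>f\<close> gives an identity of
  polynomials, where \<open>order c\<close> is additive. A negative \<open>e\<close> puts the power
  of the linear factor on the other side.\<close>

lemma order_at_le:
  assumes "f \<in> order_at c e" and f: "f * ev Q = ev P" and nz: "P \<noteq> 0" "Q \<noteq> 0"
  shows "e \<le> int (order c P) - int (order c Q)"
proof -
  obtain P' Q' where 1: "poly Q' c \<noteq> 0" "f * ev Q' = ev P' * (X - \<iota> c) powi e"
    using assms(1) by (auto simp: order_at_def)
  have Q': "Q' \<noteq> 0" "order c Q' = 0" using 1(1) by (auto simp: order_root)
  have "ev P * ev Q' = ev Q * (f * ev Q')" unfolding f[symmetric] by (simp add: mult_ac)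
  also have "\<dots> = ev (Q * P') * (X - \<iota> c) powi e" unfolding 1 by (simp add: eval1_mult)
  finally have eq: "ev (P * Q') = ev (Q * P') * (X - \<iota> c) powi e" by (simp add: eval1_mult)
  have P': "P' \<noteq> 0" using eq nz Q'(1) ev_eq_0_iff[of "P * Q'"] by auto
  define l where "l = [:- c, 1:]"
  have l: "l \<noteq> 0" "\<And>k. order c (l ^ k) = k" by (simp_all add: l_def order_power_n_n)
  have evl: "ev (l ^ k) = (X - \<iota> c) ^ k" for k by (simp add: l_def eval1_power hom_uminus)
  show ?thesis
  proof (cases "0 \<le> e")
    case True
    hence "(X - \<iota> c) powi e = (X - \<iota> c) ^ nat e" by (simp add: power_int_def)
    hence "P * Q' = Q * P' * l ^ nat e"
      using eq by (intro ev_inject) (simp add: eval1_mult evl)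
    hence "order c (P * Q') = order c (Q * P' * l ^ nat e)" by simp
    thus ?thesis using nz Q' P' l True by (simp add: order_mult)
  next
    case False
    hence "(X - \<iota> c) powi e = inverse ((X - \<iota> c) ^ nat (- e))"
      by (simp add: power_int_def power_inverse)
    with eq have "ev (P * Q') = ev (Q * P') * inverse ((X - \<iota> c) ^ nat (- e))" by simp
    moreover have "w * y = z" if "w = z * inverse y" "y \<noteq> 0" for w y z :: 'a
      using that by simp
    ultimately have "ev (P * Q') * (X - \<iota> c) ^ nat (- e) = ev (Q * P')"
      using power_not_zero[OF X_minus_const_nonzero[of c]] by blast
    hence "P * Q' * l ^ nat (- e) = Q * P'"
      by (intro ev_inject) (simp add: eval1_mult evl mult.assoc)
    hence "order c (P * Q' * l ^ nat (- e)) = order c (Q * P')" by simp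
    thus ?thesis using nz Q' P' l False by (simp add: order_mult)
  qed
qed

lemma order_at_infinity_le:
  assumes "f \<in> order_at_infinity e" and f: "f * ev Q = ev P" and nz: "P \<noteq> 0" "Q \<noteq> 0"
  shows "e \<le> int (degree Q) - int (degree P)"
proof -
  obtain P' Q' where 1: "Q' \<noteq> 0" "f * ev Q' = ev P'"
      "P' = 0 \<or> int (degree P') + e \<le> int (degree Q')"
    using assms(1) by (auto simp: order_at_infinity_def)
  have "ev P * ev Q' = ev Q * (f * ev Q')" unfolding f[symmetric] by (simp add: mult_ac)
  also have "\<dots> = ev (Q * P')" unfolding 1 by (simp add: eval1_mult)
  finally have eq: "P * Q' = Q * P'" by (intro ev_inject) (simp add: eval1_mult)
  hence P': "P' \<noteq> 0" using nz 1(1) by auto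
  have "degree (P * Q') = degree (Q * P')" unfolding eq ..
  thus ?thesis using nz 1 P' by (simp add: degree_mult_eq)
qed

text \<open>All finite poles lie at \<open>b\<close> and \<open>c\<close>, which belong to
  \<open>S\<close>, so the whole degree of the denominator is counted over \<open>S\<close>, whereas
  the zeros of the numerator in \<open>S\<close> number at most its degree. The difference of the
  degrees is the contribution of infinity.\<close>

lemma sum_orders_le_0:
  assumes f: "f \<noteq> 0" and reg: "f \<in> regular_away ([:- b, 1:] * [:- c, 1:])"
    and S: "finite S" "b \<in> S" "c \<in> S" "b \<noteq> c"
    and ord: "\<And>x. x \<in> S \<Longrightarrow> f \<in> order_at x (e x)" and inf: "f \<in> order_at_infinity e'"
  shows "(\<Sum>x\<in>S. e x) + e' \<le> 0"
proof -
  obtain P k where P: "f * ev (([:- b, 1:] * [:- c, 1:]) ^ k) = ev P"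
    using reg by (auto simp: regular_away_def)
  define Q where "Q = ([:- b, 1:] * [:- c, 1:]) ^ k"
  have Q: "Q \<noteq> 0" by (simp add: Q_def)
  note P' = P[folded Q_def]
  have nz: "P \<noteq> 0" using P' f Q ev_eq_0_iff[of Q] by auto
  have degQ: "degree Q = 2 * k"
    by (simp add: Q_def power_mult_distrib degree_mult_eq degree_power_eq)
  have "[:- b, 1:] ^ k dvd Q" "[:- c, 1:] ^ k dvd Q"
    unfolding Q_def power_mult_distrib by (rule dvd_triv_left dvd_triv_right)+
  hence "k \<le> order b Q" "k \<le> order c Q"
    using Q order_divides[of b k Q] order_divides[of c k Q] by auto
  moreover have "(\<Sum>x\<in>{b, c}. order x Q) \<le> (\<Sum>x\<in>S. order x Q)"
    by (rule sum_mono2) (use S in auto)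
  ultimately have ordQ: "degree Q \<le> (\<Sum>x\<in>S. order x Q)"
    using S(4) by (simp add: degQ)
  have "(\<Sum>x\<in>S. order x P) = (\<Sum>x\<in>{x\<in>S. poly P x = 0}. order x P)"
    by (rule sum.mono_neutral_right) (use S in \<open>auto simp: order_root\<close>)
  also have "\<dots> \<le> (\<Sum>x | poly P x = 0. order x P)"
    by (rule sum_mono2) (use nz poly_roots_finite in auto)
  also have "\<dots> \<le> degree P" by (rule sum_order_le_degree[OF nz])
  finally have ordP: "(\<Sum>x\<in>S. order x P) \<le> degree P" .
  have "(\<Sum>x\<in>S. e x) \<le> (\<Sum>x\<in>S. int (order x P) - int (order x Q))"
    by (intro sum_mono order_at_le[OF ord P'] nz Q)
  also have "\<dots> = int (\<Sum>x\<in>S. order x P) - int (\<Sum>x\<in>S. order x Q)"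
    by (simp add: sum_subtractf)
  also have "\<dots> \<le> int (degree P) - int (degree Q)" using ordP ordQ by linarith
  finally show ?thesis using order_at_infinity_le[OF inf P' nz Q] by linarith
qed

end

section \<open>Change of parameter and exchange of the coordinates\<close>

lemma series_relation_swap:
  "series_relation \<alpha> \<beta> n X Y A B \<Longrightarrow> series_relation \<alpha> \<beta> n Y X B A"
  by (simp add: series_relation_def mult_ac) (simp add: algebra_simps)

text \<open>The curve equation is differentiated: the coefficient of \<open>fps_X\<close> in the
  relation is divided by \<open>n\<close>, and the constant relation turns the cofactors into
  \<open>X - \<beta>\<close> and \<open>Y - \<beta>\<close>.\<close>

lemma series_relation_nth_1:
  assumes "series_relation \<alpha> \<beta> n X Y A B" and n: "of_nat n \<noteq> (0::'a::field)"
  shows "(X - \<beta>) * B $ 1 = - (Y - \<beta>) * (A $ 1 :: 'a)"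
proof -
  have const: "\<alpha> * X * Y - X - Y + \<beta> = 0" by (rule series_relation_const[OF assms(1)])
  have AB: "A $ 0 = 1" "B $ 0 = 1" using assms by (auto simp: series_relation_def)
  have pow: "(F ^ k) $ 1 = of_nat k * F $ 1" if "F $ 0 = 1" for F :: "'a fps" and k
  proof (induction k)
    case (Suc k)
    have "(F ^ k) $ 0 = 1" using that by (simp add: fps_power_zeroth)
    thus ?case using Suc that by (simp add: fps_mult_nth algebra_simps)
  qed simp
  have AB0: "(A ^ n) $ 0 = 1" "(B ^ n) $ 0 = 1" using AB by (simp_all add: fps_power_zeroth)
  have "(fps_const (\<alpha> * X * Y) * (A ^ n * B ^ n) - fps_const X * A ^ n - fps_const Y * B ^ n
       + fps_const \<beta>) $ 1 = 0"
    using assms by (simp add: series_relation_def mult.assoc)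
  moreover have "(A ^ n * B ^ n) $ 1 = of_nat n * A $ 1 + of_nat n * B $ 1"
    using pow[OF AB(1), of n] pow[OF AB(2), of n] AB0 by (simp add: fps_mult_nth)
  ultimately have "\<alpha> * X * Y * (of_nat n * A $ 1 + of_nat n * B $ 1)
      - X * (of_nat n * A $ 1) - Y * (of_nat n * B $ 1) = 0"
    using pow[OF AB(1), of n] pow[OF AB(2), of n] by simp
  hence "of_nat n * ((\<alpha> * X * Y - Y) * B $ 1 + (\<alpha> * X * Y - X) * A $ 1) = 0"
    by (simp add: algebra_simps)
  moreover have "\<alpha> * X * Y - Y = X - \<beta>" "\<alpha> * X * Y - X = Y - \<beta>"
    using const by (simp_all add: algebra_simps)
  ultimately have "(X - \<beta>) * B $ 1 + (Y - \<beta>) * A $ 1 = 0" using n by simp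
  thus ?thesis unfolding minus_mult_left[symmetric] eq_neg_iff_add_eq_0 .
qed

lemma monomial_matrix_swap:
  "monomial_matrix (map prod.swap ps) u v A B = monomial_matrix ps v u B A" if "ps \<noteq> []"
  unfolding monomial_matrix_def length_map
proof (rule frobenius_fps_matrix_cong)
  fix c assume "c \<le> length ps - 1"
  hence "c < length ps" using that by (cases ps) auto
  thus "(case map prod.swap ps ! c of (i, j) \<Rightarrow> u ^ i * v ^ j) = (case ps ! c of (i, j) \<Rightarrow> v ^ i * u ^ j)"
    "(case map prod.swap ps ! c of (i, j) \<Rightarrow> A ^ i * B ^ j) = (case ps ! c of (i, j) \<Rightarrow> B ^ i * A ^ j)"
    by (simp_all add: split_beta mult.commute)
qed

text \<open>Composition with the inverse series of \<open>A - 1\<close> replaces an arbitrary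
  parameter by one in which \<open>A\<close> becomes \<open>1 + fps_X\<close>. The determinant
  changes by a power of \<open>A $ 1\<close>, to whose exponent the i-th derivative row contributes
  i.\<close>

lemma reparametrize:
  fixes A B :: "'a::field fps"
  assumes rel: "series_relation \<alpha> \<beta> n X Y A B" and A1: "A $ 1 \<noteq> 0"
  obtains E where "series_relation \<alpha> \<beta> n X Y (1 + fps_X) E"
    "\<And>ps u v. det (monomial_matrix ps u v (1 + fps_X) E) =
      inverse (A $ 1) ^ (\<Sum>i<length ps - 1. i) * det (monomial_matrix ps u v A B)"
proof
  define g where "g = A - 1"
  define \<phi> where "\<phi> = fps_inv g"
  have A0: "A $ 0 = 1" and B0: "B $ 0 = 1" using rel by (auto simp: series_relation_def)
  have g: "g $ 0 = 0" "g $ 1 \<noteq> 0" using A0 A1 by (simp_all add: g_def)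
  have \<phi>0: "\<phi> $ 0 = 0" by (simp add: \<phi>_def fps_inv_def)
  have g\<phi>: "g oo \<phi> = fps_X" unfolding \<phi>_def by (rule fps_inv_right[OF g])
  have "(g oo \<phi>) $ 1 = g $ 1 * \<phi> $ 1"
    using \<phi>0 g by (simp add: fps_compose_nth)
  hence "A $ 1 * \<phi> $ 1 = 1" using g\<phi> by (simp add: g_def)
  hence \<phi>1: "\<phi> $ 1 = inverse (A $ 1)" by (metis inverse_unique)
  have "A oo \<phi> = (g + 1) oo \<phi>" by (simp add: g_def)
  also have "\<dots> = 1 + fps_X" by (simp add: fps_compose_add_distrib g\<phi> add.commute)
  finally have A: "A oo \<phi> = 1 + fps_X" .
  note dist = fps_compose_add_distrib fps_compose_sub_distrib fps_compose_mult_distrib[OF \<phi>0]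
    fps_compose_power[OF \<phi>0, symmetric] A
  show "series_relation \<alpha> \<beta> n X Y (1 + fps_X) (B oo \<phi>)"
  proof -
    have "(fps_const (\<alpha> * X * Y) * A ^ n * B ^ n - fps_const X * A ^ n - fps_const Y * B ^ n
       + fps_const \<beta>) oo \<phi> = 0"
      using rel by (simp add: series_relation_def)
    thus ?thesis using B0 by (simp add: series_relation_def dist)
  qed
  fix ps u v
  have "monomial_matrix ps u v (1 + fps_X) (B oo \<phi>) = frobenius_fps_matrix
     (\<lambda>c. case ps ! c of (i, j) \<Rightarrow> u ^ i * v ^ j)
     (\<lambda>c. (case ps ! c of (i, j) \<Rightarrow> A ^ i * B ^ j) oo \<phi>) (length ps - 1)"
    unfolding monomial_matrix_def
    by (rule frobenius_fps_matrix_cong) (auto simp: dist split: prod.split)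
  hence "det (monomial_matrix ps u v (1 + fps_X) (B oo \<phi>)) =
      (\<phi> $ 1) ^ (\<Sum>i<length ps - 1. i) * det (monomial_matrix ps u v A B)"
    by (simp only: det_frobenius_fps_matrix_compose[OF \<phi>0] monomial_matrix_def[of ps u v A B])
  thus "det (monomial_matrix ps u v (1 + fps_X) (B oo \<phi>)) =
      inverse (A $ 1) ^ (\<Sum>i<length ps - 1. i) * det (monomial_matrix ps u v A B)"
    unfolding \<phi>1 .
qed

lemma exponents_swap: "prod.swap ` exponents s = exponents s"
  by (force simp: exponents_def image_iff)

section \<open>The quotient curve, where Y is a Moebius function of X\<close>

locale kummer = transcendental_element \<iota> X for \<iota> :: "'k::field \<Rightarrow> 'a::field" and X +
  fixes Y :: 'a and a b :: 'k
  assumes relation: "\<iota> a * X * Y - X - Y + \<iota> b = 0" and ab: "a \<noteq> 0" "b \<noteq> 0" "a * b \<noteq> 1"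
begin

text \<open>For \<open>q = n * m + 1\<close> every nonzero n-th power satisfies
  \<open>c ^ m = 1\<close>. The last equation imposes this on the value of \<open>Y\<close> over
  \<open>X = c\<close>, so the set contains all values of \<open>X\<close> under affine rational
  points with nonzero coordinates.\<close>

definition good_values :: "nat \<Rightarrow> 'k set" where
  "good_values m = {c. c \<noteq> 0 \<and> c \<noteq> b \<and> a * c \<noteq> 1 \<and> c ^ m = 1 \<and> ((c - b) / (a * c - 1)) ^ m = 1}"

lemma Y_eq: "Y * (\<iota> a * X - 1) = X - \<iota> b"
  using relation by (simp add: algebra_simps)

lemma aX_minus_1: "\<iota> a * X - 1 = \<iota> a * (X - \<iota> (inverse a))" "\<iota> a * X - 1 \<noteq> 0"
proof -
  show "\<iota> a * X - 1 = \<iota> a * (X - \<iota> (inverse a))"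
    using ab by (simp add: algebra_simps flip: hom_mult)
  thus "\<iota> a * X - 1 \<noteq> 0" using X_minus_const_nonzero ab by simp
qed

lemma Y_nonzero: "Y \<noteq> 0"
  using Y_eq X_minus_const_nonzero[of b] by auto

text \<open>The difference of two values of a Moebius map of determinant \<open>a * b - 1\<close>;
  the explicit factor \<open>X - \<iota> c\<close> is what makes \<open>Y - \<iota> d\<close> vanish
  at \<open>c\<close>.\<close>

lemma Y_minus_const:
  assumes "a * c \<noteq> 1" "d = (c - b) / (a * c - 1)"
  shows "(Y - \<iota> d) * ev [:- 1, a:] = ev [:(a * b - 1) / (a * c - 1):] * (X - \<iota> c)"
proof -
  define f where "f = a * c - 1"
  have f: "f \<noteq> 0" using assms by (simp add: f_def)
  have d: "\<iota> d * \<iota> f = \<iota> c - \<iota> b" using f by (simp add: assms(2) f_def flip: hom_mult hom_minus)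
  have "\<iota> ((a * b - 1) / f) * \<iota> f = \<iota> (a * b - 1)"
    using f by (simp flip: hom_mult)
  hence e: "\<iota> ((a * b - 1) / f) * \<iota> f = \<iota> a * \<iota> b - 1"
    by (simp add: hom_minus hom_mult)
  have "\<iota> f * ((Y - \<iota> d) * (\<iota> a * X - 1)) = \<iota> f * (X - \<iota> b) - (\<iota> c - \<iota> b) * (\<iota> a * X - 1)"
    unfolding d[symmetric] Y_eq[symmetric] by (simp add: algebra_simps)
  also have "\<dots> = (\<iota> a * \<iota> b - 1) * (X - \<iota> c)"
    by (simp add: f_def hom_mult hom_minus algebra_simps)
  also have "\<dots> = \<iota> f * (\<iota> ((a * b - 1) / f) * (X - \<iota> c))" unfolding e[symmetric] by (simp add: mult_ac)
  finally have "(Y - \<iota> d) * (\<iota> a * X - 1) = \<iota> ((a * b - 1) / f) * (X - \<iota> c)"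
    using f by simp
  thus ?thesis by (simp add: f_def[symmetric] hom_uminus mult.commute)
qed

lemma Y_minus_const_order_at:
  assumes "a * c \<noteq> 1"
  shows "Y - \<iota> ((c - b) / (a * c - 1)) \<in> order_at c 1"
  using Y_minus_const[OF assms refl] assms
  by (intro order_atI[of "[:- 1, a:]" _ _ "[:(a * b - 1) / (a * c - 1):]"]) (auto simp: mult.commute)

lemma Y_order_at_infinity: "Y - \<iota> (inverse a) \<in> order_at_infinity 1"
proof (rule order_at_infinityI[of "[:- 1, a:]" _ "[:inverse a - b:]"])
  have "\<iota> (inverse a) * (\<iota> a * X - 1) = X - \<iota> (inverse a)"
    using ab by (simp add: right_diff_distrib mult.assoc[symmetric] flip: hom_mult)
  thus "(Y - \<iota> (inverse a)) * ev [:- 1, a:] = ev [:inverse a - b:]"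
    using Y_eq by (simp add: hom_uminus hom_minus algebra_simps)
qed (use ab in auto)

lemma Y_order_at_pole: "Y \<in> order_at (inverse a) (- 1)" "inverse Y \<in> order_at (inverse a) 1"
proof -
  have ne: "inverse a - b \<noteq> 0" using ab by (auto simp: field_simps)
  have eq: "Y * \<iota> a * (X - \<iota> (inverse a)) = X - \<iota> b"
    using Y_eq unfolding aX_minus_1(1) by (simp add: mult_ac)
  show "Y \<in> order_at (inverse a) (- 1)"
    using eq ab X_minus_const_nonzero[of "inverse a"]
    by (intro order_atI[of "[:a:]" _ _ "[:- b, 1:]"]) (auto simp: power_int_minus field_simps hom_uminus)
  show "inverse Y \<in> order_at (inverse a) 1"
    using eq ne Y_nonzero
    by (intro order_atI[of "[:- b, 1:]" _ _ "[:a:]"]) (auto simp: hom_uminus field_simps)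
qed

lemma regular_away_mem:
  "X \<in> regular_away ([:- b, 1:] * [:- inverse a, 1:])"
  "Y \<in> regular_away ([:- b, 1:] * [:- inverse a, 1:])"
  "inverse (X - \<iota> b) \<in> regular_away ([:- b, 1:] * [:- inverse a, 1:])"
  "\<iota> c \<in> regular_away ([:- b, 1:] * [:- inverse a, 1:])"
proof -
  show "X \<in> regular_away ([:- b, 1:] * [:- inverse a, 1:])"
    by (rule regular_awayI[where k = 0 and P = "[:0, 1:]"]) simp
  show "\<iota> c \<in> regular_away ([:- b, 1:] * [:- inverse a, 1:])"
    by (rule regular_awayI[where k = 0 and P = "[:c:]"]) simp
  show "inverse (X - \<iota> b) \<in> regular_away ([:- b, 1:] * [:- inverse a, 1:])"
    using X_minus_const_nonzero[of b]
    by (intro regular_awayI[where k = 1 and P = "[:- inverse a, 1:]"])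
      (simp only: power_one_right eval1_mult ev_linear, simp)
  have "Y * (X - \<iota> (inverse a)) = \<iota> (inverse a) * (X - \<iota> b)"
    unfolding Y_eq[symmetric] aX_minus_1(1) using ab
    by (simp add: mult_ac) (simp add: mult.assoc[symmetric] flip: hom_mult)
  hence "Y * ((X - \<iota> b) * (X - \<iota> (inverse a))) = \<iota> (inverse a) * (X - \<iota> b) * (X - \<iota> b)"
    by (simp add: mult_ac)
  thus "Y \<in> regular_away ([:- b, 1:] * [:- inverse a, 1:])"
    by (intro regular_awayI[where k = 1 and P = "[:inverse a:] * [:- b, 1:] * [:- b, 1:]"])
      (simp only: power_one_right eval1_mult ev_linear eval1_const)
qed

text \<open>The quotient is the ratio of the logarithmic derivatives of y and x. Differentiating the
  curve equation gives it the value (a b - 1) X / ((X - b) (a X - 1)), whatever the parameter, with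
  simple poles where \<open>Y\<close> has its zero and its pole.\<close>

lemma log_derivative_ratio:
  assumes rel: "series_relation (\<iota> a) (\<iota> b) n X Y A B" and n: "of_nat n \<noteq> (0::'k)"
    and A1: "A $ 1 \<noteq> 0"
  shows "B $ 1 \<noteq> 0"
    "B $ 1 * inverse (A $ 1) \<in> order_at b (- 1)"
    "B $ 1 * inverse (A $ 1) \<in> order_at (inverse a) (- 1)"
proof -
  define \<kappa> where "\<kappa> = B $ 1 * inverse (A $ 1)"
  have n': "of_nat n \<noteq> (0::'a)" using n by (metis hom_of_nat hom_0_iff)
  have "(X - \<iota> b) * B $ 1 = - (Y - \<iota> b) * A $ 1" by (rule series_relation_nth_1[OF rel n'])
  hence eq: "(X - \<iota> b) * \<kappa> = - (Y - \<iota> b)" using A1 by (simp add: \<kappa>_def mult.assoc[symmetric])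
  have Yb: "(Y - \<iota> b) * (\<iota> a * X - 1) = \<iota> (1 - a * b) * X"
    using Y_minus_const[of 0 b] by (simp add: hom_uminus hom_minus hom_mult algebra_simps)
  have key: "\<kappa> * ((X - \<iota> b) * (\<iota> a * X - 1)) = \<iota> (a * b - 1) * X"
  proof -
    have "\<kappa> * ((X - \<iota> b) * (\<iota> a * X - 1)) = ((X - \<iota> b) * \<kappa>) * (\<iota> a * X - 1)" by (simp add: mult_ac)
    also have "\<dots> = - (\<iota> (1 - a * b) * X)" unfolding eq Yb[symmetric] by (rule minus_mult_left[symmetric])
    finally show ?thesis by (simp add: hom_minus algebra_simps)
  qed
  have "\<iota> (a * b - 1) * X \<noteq> 0" using ab X_minus_const_nonzero[of 0] by simp
  hence "\<kappa> \<noteq> 0" using key by auto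
  thus "B $ 1 \<noteq> 0" by (auto simp: \<kappa>_def)
  have eqI: "u * w = z * (v powi - 1)" if "u * (v * w) = z" "v \<noteq> 0" for u v w z :: 'a
    using that by (simp add: power_int_minus field_simps)
  have "\<kappa> * (\<iota> a * X - 1) = (\<iota> (a * b - 1) * X) * (X - \<iota> b) powi - 1"
    by (rule eqI[OF key X_minus_const_nonzero])
  thus "\<kappa> \<in> order_at b (- 1)" using ab
    by (intro order_atI[of "[:- 1, a:]" _ _ "[:0, a * b - 1:]"]) (auto simp: hom_uminus algebra_simps)
  have "\<kappa> * (\<iota> a * (X - \<iota> b)) = (\<iota> (a * b - 1) * X) * (X - \<iota> (inverse a)) powi - 1"
    by (rule eqI[OF _ X_minus_const_nonzero]) (use key[unfolded aX_minus_1(1)] in \<open>simp add: mult_ac\<close>)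
  thus "\<kappa> \<in> order_at (inverse a) (- 1)" using ab
    by (intro order_atI[of "[:a:] * [:- b, 1:]" _ _ "[:0, a * b - 1:]"])
      (simp add: field_simps, simp only: eval1_mult ev_linear eval1_const, simp add: mult_ac)
qed

text \<open>The orders of the single function \<Delta> are added up. The values 0 and infinity are
  treated directly, \<open>b\<close> and \<open>1 / a\<close> through the exchanged determinant
  \<open>\<Delta>'\<close> at a cost of \<open>T\<close> each, and every good value gives
  \<open>N\<close>. Each defect occurs once for \<open>X\<close> and once for \<open>Y\<close>,
  whence the factors 2.\<close>

theorem card_good_values_bound:
  assumes rel: "series_relation (\<iota> a) (\<iota> b) n X Y A B"
    and n: "of_nat n \<noteq> (0::'k)" and m: "0 < m"
    and q: "\<iota> a * X ^ (n * m + 1) * Y ^ (n * m + 1) - X ^ (n * m + 1) - Y ^ (n * m + 1) + \<iota> b = 0"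
    and A1: "A $ 1 \<noteq> 0"
    and ps: "distinct ps" "set ps = exponents s" "length ps = Suc N" "2 \<le> N"
    and fin: "finite (good_values m)"
    and det: "det (monomial_matrix ps (X ^ m) (Y ^ m) A B) \<noteq> 0"
  shows "int N * int (card (good_values m)) + 4 * weight s \<le> 2 * int (\<Sum>i<N. i)
    + 2 * (if b ^ m = 1 then 0 else int s - 1) + 2 * (int s - 1) * int m
    + 2 * (if a ^ m = 1 then 0 else 1)"
proof -
  define T where "T = (\<Sum>i<N. i)"
  define \<epsilon> where "\<epsilon> = (if b ^ m = 1 then 0 else int s - 1)"
  define \<eta> :: int where "\<eta> = (if a ^ m = 1 then 0 else 1)"
  note B1 = log_derivative_ratio[OF rel n A1]
  obtain E where E: "series_relation (\<iota> a) (\<iota> b) n X Y (1 + fps_X) E"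
    "\<And>ps u v. det (monomial_matrix ps u v (1 + fps_X) E) =
      inverse (A $ 1) ^ (\<Sum>i<length ps - 1. i) * det (monomial_matrix ps u v A B)"
    using reparametrize[OF rel A1] by metis
  obtain F where F: "series_relation (\<iota> a) (\<iota> b) n Y X (1 + fps_X) F"
    "\<And>ps u v. det (monomial_matrix ps u v (1 + fps_X) F) =
      inverse (B $ 1) ^ (\<Sum>i<length ps - 1. i) * det (monomial_matrix ps u v B A)"
    using reparametrize[OF series_relation_swap[OF rel] B1(1)] by metis
  define \<Delta> where "\<Delta> = det (monomial_matrix ps (X ^ m) (Y ^ m) (1 + fps_X) E)"
  define ps' where "ps' = map prod.swap ps"
  define \<Delta>' where "\<Delta>' = det (monomial_matrix ps' (Y ^ m) (X ^ m) (1 + fps_X) F)"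
  have ne: "ps \<noteq> []" using ps by auto
  have ps': "distinct ps'" "set ps' = exponents s" "ps' \<noteq> []"
    using ps ne by (auto simp: ps'_def distinct_map exponents_swap)
  have \<Delta>_eq: "\<Delta> = inverse (A $ 1) ^ T * det (monomial_matrix ps (X ^ m) (Y ^ m) A B)"
    using ps by (simp add: \<Delta>_def E T_def)
  have \<Delta>'_eq: "\<Delta>' = inverse (B $ 1) ^ T * det (monomial_matrix ps (X ^ m) (Y ^ m) A B)"
    unfolding \<Delta>'_def F(2) unfolding ps'_def length_map monomial_matrix_swap[OF ne] using ps by (simp add: T_def)
  have \<Delta>0: "\<Delta> \<noteq> 0" using det A1 by (simp add: \<Delta>_eq)
  \<comment> \<open>Both determinants come from the same one in the original parameter, so their
    ratio is a power of the ratio of logarithmic derivatives.\<close>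
  have \<Delta>\<Delta>': "\<Delta> = (B $ 1 * inverse (A $ 1)) ^ T * \<Delta>'"
    using B1(1) by (simp add: \<Delta>_eq \<Delta>'_eq power_mult_distrib power_inverse)
  have at0: "\<Delta> \<in> order_at 0 (weight s - \<epsilon>)"
  proof -
    interpret G: local_filtration "order_at 0" \<iota> by (rule local_filtration_order_at)
    have "X \<in> order_at 0 1" using X_minus_const_order_at[of 0] by simp
    moreover have "Y - \<iota> b \<in> order_at 0 1" using Y_minus_const_order_at[of 0] by simp
    ultimately show ?thesis unfolding \<Delta>_def \<epsilon>_def
      by (intro G.det_order_at_zero[OF E(1) ps(1,2) ne n]) (use ab in auto)
  qed
  have atb: "\<Delta> \<in> order_at b (weight s - \<epsilon> - int T)"
  proof -
    interpret G: local_filtration "order_at b" \<iota> by (rule local_filtration_order_at)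
    have "Y \<in> order_at b 1" using Y_minus_const_order_at[of b] ab by simp
    hence "\<Delta>' \<in> order_at b (weight s - \<epsilon>)" unfolding \<Delta>'_def \<epsilon>_def
      by (intro G.det_order_at_zero[OF F(1) ps' n]) (use ab X_minus_const_order_at in auto)
    from G.mult_mem[OF G.power_mem[OF B1(2), of T] this] show ?thesis
      unfolding \<Delta>\<Delta>' by (simp add: algebra_simps)
  qed
  have ata: "\<Delta> \<in> order_at (inverse a) (weight s - (int s - 1) * int m - \<eta> - int T)"
  proof -
    interpret G: local_filtration "order_at (inverse a)" \<iota> by (rule local_filtration_order_at)
    have "\<Delta>' \<in> order_at (inverse a) (weight s - (int s - 1) * int m - \<eta>)" unfolding \<Delta>'_def \<eta>_def
      by (intro G.det_order_at_infinity[OF F(1) ps' n m Y_nonzero]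
          Y_order_at_pole X_minus_const_order_at)
    from G.mult_mem[OF G.power_mem[OF B1(3), of T] this] show ?thesis
      unfolding \<Delta>\<Delta>' by (simp add: algebra_simps)
  qed
  have atinf: "\<Delta> \<in> order_at_infinity (weight s - (int s - 1) * int m - \<eta>)"
  proof -
    interpret G: local_filtration order_at_infinity \<iota> by (rule local_filtration_order_at_infinity)
    have "X \<noteq> 0" using X_minus_const_nonzero[of 0] by simp
    thus ?thesis unfolding \<Delta>_def \<eta>_def
      by (intro G.det_order_at_infinity[OF E(1) ps(1,2) ne n m]
          X_order_at_infinity Y_order_at_infinity)
  qed
  have atz: "\<Delta> \<in> order_at c (int N)" if c: "c \<in> good_values m" for c
  proof -
    interpret G: local_filtration "order_at c" \<iota> by (rule local_filtration_order_at)
    show ?thesis unfolding \<Delta>_def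
      by (rule G.det_order_at_rational_point[OF E(1) ps(2,3,4) n q X_minus_const_order_at _ _ _
          Y_minus_const_order_at]) (use c in \<open>auto simp: good_values_def\<close>)
  qed
  define R where "R = [:- b, 1:] * [:- inverse a, 1:]"
  note R_mem = regular_away_mem[folded R_def]
  \<comment> \<open>The only finite pole of \<open>Y\<close> is at \<open>1 / a\<close>, and the
    recursion for the coefficients of \<open>E\<close> divides by \<open>X - b\<close> and
    \<open>n\<close> alone.\<close>
  have reg: "\<Delta> \<in> regular_away R"
  proof -
    interpret G: filtration "\<lambda>_. regular_away R" by (rule filtration_regular_away)
    have n': "of_nat n \<noteq> (0::'a)" using n by (metis hom_of_nat hom_0_iff)
    have "inverse (of_nat n) = \<iota> (inverse (of_nat n))" by (simp add: hom_inverse hom_of_nat)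
    hence n'': "inverse (of_nat n) \<in> regular_away R" using R_mem(4) by simp
    have ce: "G.coeffs_in 0 E"
      by (rule G.coeffs_in_solution(1)[OF E(1)])
        (use R_mem n' n'' X_minus_const_nonzero[of b] in auto)
    have "G.coeffs_in 0 ((1 + fps_X) ^ i * E ^ j)" for i j
      by (intro G.coeffs_in_mult0 G.coeffs_in_binomial G.coeffs_in_power0 ce)
    hence rows: "((1 + fps_X) ^ i * E ^ j) $ k \<in> regular_away R" for i j k
      by (simp add: G.coeffs_in_def)
    have row0: "(X ^ m) ^ i * (Y ^ m) ^ j \<in> regular_away R" for i j
      by (intro G.mult_mem0 G.power_mem0 R_mem)
    show ?thesis unfolding \<Delta>_def monomial_matrix_def
      by (intro G.det_mem[OF frobenius_fps_matrix_carrier, where v = "\<lambda>_. 0" and w = "\<lambda>_. 0" and e = 0])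
        (use row0 rows in \<open>auto split: prod.split\<close>)
  qed
  define Z where "Z = good_values m"
  define S where "S = insert 0 (insert b (insert (inverse a) Z))"
  define e where "e c = (if c \<in> Z then int N else if c = 0 then weight s - \<epsilon>
    else if c = b then weight s - \<epsilon> - int T
    else weight s - (int s - 1) * int m - \<eta> - int T)" for c
  have dist: "0 \<notin> Z" "b \<notin> Z" "inverse a \<notin> Z" "b \<noteq> inverse a" "inverse a \<noteq> 0"
    using ab by (auto simp: Z_def good_values_def)
  have finZ: "finite Z" using fin by (simp add: Z_def)
  have "(\<Sum>c\<in>S. e c) + (weight s - (int s - 1) * int m - \<eta>) \<le> 0"
  proof (rule sum_orders_le_0[OF \<Delta>0 reg[unfolded R_def] _ _ _ _ _ atinf])
    show "\<Delta> \<in> order_at c (e c)" if "c \<in> S" for c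
      using that at0 atb ata atz ab unfolding S_def e_def Z_def by auto
  qed (use finZ dist in \<open>auto simp: S_def\<close>)
  moreover have "(\<Sum>c\<in>S. e c) = (weight s - \<epsilon>) + (weight s - \<epsilon> - int T)
      + (weight s - (int s - 1) * int m - \<eta> - int T) + (\<Sum>c\<in>Z. e c)"
    using dist finZ ab by (simp add: S_def) (simp add: e_def)
  moreover have "(\<Sum>c\<in>Z. e c) = int N * int (card Z)" by (simp add: e_def)
  ultimately show ?thesis
    by (simp add: T_def[symmetric] \<epsilon>_def[symmetric] \<eta>_def[symmetric] Z_def[symmetric] algebra_simps)
qed

end

section \<open>Places of the function field\<close>

context field_hom begin

lemma eval2_0 [simp]: "eval2 hom 0 u v = 0"
  by (simp add: eval2_def)

lemma eval2_pCons [simp]: "eval2 hom (pCons p P) u v = eval1 hom p u + v * eval2 hom P u v"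
  by (simp add: eval2_def map_poly_pCons)

lemma eval2_1 [simp]: "eval2 hom 1 u v = 1"
  by (simp add: one_pCons)

lemma eval2_add: "eval2 hom (P + Q) u v = eval2 hom P u v + eval2 hom Q u v"
  by (induction P Q rule: poly_induct2) (simp_all add: eval1_add algebra_simps)

lemma eval2_sum: "eval2 hom (\<Sum>i\<in>S. h i) u v = (\<Sum>i\<in>S. eval2 hom (h i) u v)"
  by (induction S rule: infinite_finite_induct) (simp_all add: eval2_add)

lemma eval2_smult: "eval2 hom (smult p P) u v = eval1 hom p u * eval2 hom P u v"
  by (induction P) (simp_all add: eval1_mult algebra_simps)

lemma eval2_uminus: "eval2 hom (- P) u v = - eval2 hom P u v"
  using eval2_smult[of "- 1" P u v] by (simp add: eval1_uminus)

lemma eval2_mult: "eval2 hom (P * Q) u v = eval2 hom P u v * eval2 hom Q u v"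
  by (induction P) (simp_all add: eval2_add eval2_smult algebra_simps)

lemma eval2_power: "eval2 hom (P ^ k) u v = eval2 hom P u v ^ k"
  by (induction k) (simp_all add: eval2_mult)

lemma eval2_monom: "eval2 hom (monom p i) u v = eval1 hom p u * v ^ i"
  using eval2_power[of "[:0, 1:]" i u v] eval2_smult[of p "[:0, 1:] ^ i" u v] by (simp add: monom_altdef)

lemma eval1_mem:
  assumes add: "\<And>z w. z \<in> S \<Longrightarrow> w \<in> S \<Longrightarrow> z + w \<in> S"
    and mult: "\<And>z w. z \<in> S \<Longrightarrow> w \<in> S \<Longrightarrow> z * w \<in> S"
    and const: "\<And>c. hom c \<in> S" and u: "u \<in> S"
  shows "eval1 hom P u \<in> S"
  by (induction P) (use const[of 0] in \<open>auto intro: add mult const u\<close>)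

lemma eval2_mem:
  assumes add: "\<And>z w. z \<in> S \<Longrightarrow> w \<in> S \<Longrightarrow> z + w \<in> S"
    and mult: "\<And>z w. z \<in> S \<Longrightarrow> w \<in> S \<Longrightarrow> z * w \<in> S"
    and const: "\<And>c. hom c \<in> S" and u: "u \<in> S" and v: "v \<in> S"
  shows "eval2 hom P u v \<in> S"
  by (induction P) (use const[of 0] in \<open>auto intro: add mult eval1_mem const u v\<close>)

definition adjoin_ring :: "'b \<Rightarrow> 'b \<Rightarrow> 'b set" where
  "adjoin_ring u v = range (\<lambda>P. eval2 hom P u v)"

lemma eval2_adjoin_ring [simp, intro]: "eval2 hom P u v \<in> adjoin_ring u v"
  by (simp add: adjoin_ring_def)

lemma adjoin_ring_add: "z \<in> adjoin_ring u v \<Longrightarrow> w \<in> adjoin_ring u v \<Longrightarrow> z + w \<in> adjoin_ring u v"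
  unfolding adjoin_ring_def by (auto simp flip: eval2_add)

lemma adjoin_ring_mult: "z \<in> adjoin_ring u v \<Longrightarrow> w \<in> adjoin_ring u v \<Longrightarrow> z * w \<in> adjoin_ring u v"
  unfolding adjoin_ring_def by (auto simp flip: eval2_mult)

lemma adjoin_ring_gens: "hom c \<in> adjoin_ring u v" "u \<in> adjoin_ring u v" "v \<in> adjoin_ring u v"
  using eval2_adjoin_ring[of "[:[:c:]:]" u v] eval2_adjoin_ring[of "[:[:0, 1:]:]" u v]
    eval2_adjoin_ring[of "[:0, 1:]" u v] by simp_all

lemma adjoin_ring_induct [consumes 1, case_names const fst snd add mult]:
  assumes "z \<in> adjoin_ring u v" and "\<And>c. Q (hom c)" "Q u" "Q v"
    "\<And>z w. Q z \<Longrightarrow> Q w \<Longrightarrow> Q (z + w)" "\<And>z w. Q z \<Longrightarrow> Q w \<Longrightarrow> Q (z * w)"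
  shows "Q z"
  using assms eval2_mem[of "{z. Q z}" u v] by (auto simp: adjoin_ring_def)

lemma adjoin_ring_swap: "adjoin_ring u v = adjoin_ring v u"
proof -
  have "adjoin_ring u v \<subseteq> adjoin_ring v u" for u v
  proof
    fix z assume "z \<in> adjoin_ring u v"
    thus "z \<in> adjoin_ring v u"
      by (induction rule: adjoin_ring_induct) (auto intro: adjoin_ring_gens adjoin_ring_add adjoin_ring_mult)
  qed
  thus ?thesis by blast
qed

lemma adjoin2_eq: "adjoin2 hom u v = {z / w | z w. z \<in> adjoin_ring u v \<and> w \<in> adjoin_ring u v \<and> w \<noteq> 0}"
  unfolding adjoin2_def adjoin_ring_def by blast

lemma adjoin2_swap: "adjoin2 hom u v = adjoin2 hom v u"
  unfolding adjoin2_eq adjoin_ring_swap[of u v] ..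

lemma adjoin_ring_subset: "z \<in> adjoin_ring u v \<Longrightarrow> z \<in> adjoin2 hom u v"
  unfolding adjoin2_eq using adjoin_ring_gens(1)[of 1 u v]
  by (intro CollectI exI[of _ z] exI[of _ 1]) simp

lemma adjoin2_mult:
  assumes "z \<in> adjoin2 hom u v" "w \<in> adjoin2 hom u v"
  shows "z * w \<in> adjoin2 hom u v"
proof -
  obtain p q r s where "z = p / q" "w = r / s" "p \<in> adjoin_ring u v" "q \<in> adjoin_ring u v"
    "r \<in> adjoin_ring u v" "s \<in> adjoin_ring u v" "q \<noteq> 0" "s \<noteq> 0"
    using assms unfolding adjoin2_eq by blast
  moreover from this have "z * w = (p * r) / (q * s)" by simp
  ultimately show ?thesis unfolding adjoin2_eq using adjoin_ring_mult no_zero_divisors by blast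
qed

lemma adjoin2_inverse:
  assumes "z \<in> adjoin2 hom u v" shows "inverse z \<in> adjoin2 hom u v"
proof (cases "z = 0")
  case True thus ?thesis using assms by simp
next
  case False
  obtain p q where "z = p / q" "p \<in> adjoin_ring u v" "q \<in> adjoin_ring u v" "q \<noteq> 0"
    using assms unfolding adjoin2_eq by blast
  moreover from this have "inverse z = q / p" "p \<noteq> 0" using False by auto
  ultimately show ?thesis unfolding adjoin2_eq by blast
qed

text \<open>Produces a nonzero multiple of \<open>f\<close> in k[x], as a norm or a resultant would.
  Among the polynomials whose value at (x, y) is a nonzero multiple of \<open>f\<close>, one of
  least degree in the second variable is taken; pseudo-division by \<open>F\<close>, and of
  \<open>F\<close> by it, forces that degree to be 0.\<close>

lemma elimination:
  assumes F: "degree F = n" "0 < n" "eval2 hom F x y = 0"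
    and indep: "\<And>P. degree P < n \<Longrightarrow> eval2 hom P x y = 0 \<Longrightarrow> P = 0"
    and f: "f \<in> adjoin_ring x y" "f \<noteq> 0"
  obtains g h where "g \<in> adjoin_ring x y" "h \<noteq> 0" "f * g = eval1 hom h x"
proof -
  have transc: "eval1 hom p x \<noteq> 0" if "p \<noteq> 0" for p
    using indep[of "[:p:]"] F(2) that by auto
  have F0: "F \<noteq> 0" using F by auto
  define S where "S = {P. eval2 hom P x y \<noteq> 0 \<and> (\<exists>g\<in>adjoin_ring x y. eval2 hom P x y = f * g)}"
  obtain P1 where "f = eval2 hom P1 x y" using f by (auto simp: adjoin_ring_def)
  hence "P1 \<in> S" using f adjoin_ring_gens(1)[of 1 x y] by (auto simp: S_def intro!: bexI[of _ 1])
  then obtain P where P: "P \<in> S" and min: "\<And>Q. Q \<in> S \<Longrightarrow> degree P \<le> degree Q"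
    using ex_has_least_nat[of "\<lambda>P. P \<in> S" P1 degree] by blast
  have Pxy: "eval2 hom P x y \<noteq> 0" using P by (simp add: S_def)
  hence P0: "P \<noteq> 0" by auto
  have SI: "Q \<in> S" if "eval2 hom Q x y \<noteq> 0" "eval2 hom Q x y = eval2 hom P x y * r" "r \<in> adjoin_ring x y" for Q r
  proof -
    obtain g where "g \<in> adjoin_ring x y" "eval2 hom P x y = f * g" using P by (auto simp: S_def)
    thus ?thesis using that by (auto simp: S_def mult.assoc intro: adjoin_ring_mult)
  qed
  have degP: "degree P < n"
  proof (rule ccontr)
    assume "\<not> degree P < n"
    obtain q r where qr: "pseudo_divmod P F = (q, r)" by fastforce
    define c where "c = coeff F (degree F) ^ (Suc (degree P) - degree F)"
    have "smult c P = F * q + r" and r: "r = 0 \<or> degree r < n"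
      using pseudo_divmod[OF F0 qr] F by (auto simp: c_def)
    from arg_cong[OF this(1), of "\<lambda>P. eval2 hom P x y"]
    have eq: "eval2 hom r x y = eval2 hom P x y * eval1 hom c x"
      using F by (simp add: eval2_smult eval2_add eval2_mult mult.commute)
    have "c \<noteq> 0" using F0 by (simp add: c_def)
    hence nz: "eval2 hom r x y \<noteq> 0" using eq Pxy transc by simp
    have "eval1 hom c x \<in> adjoin_ring x y" using eval2_adjoin_ring[of "[:c:]" x y] by simp
    from min[OF SI[OF nz eq this]] r nz \<open>\<not> degree P < n\<close> show False by auto
  qed
  \<comment> \<open>The remainder of \<open>F\<close> by \<open>P\<close> has a multiple of
    \<open>f\<close> as its value but smaller degree, so its value is 0 and independence makes it
    vanish. Then \<open>P * q\<close> is a multiple of \<open>F\<close>, so \<open>q\<close> has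
    value 0 although its degree is below \<open>n\<close>, which independence excludes.\<close>
  have "degree P = 0"
  proof (rule ccontr)
    assume pos: "degree P \<noteq> 0"
    obtain q r where qr: "pseudo_divmod F P = (q, r)" by fastforce
    define c where "c = coeff P (degree P) ^ (Suc (degree F) - degree P)"
    have FPq: "smult c F = P * q + r" and r: "r = 0 \<or> degree r < degree P"
      using pseudo_divmod[OF P0 qr] by (auto simp: c_def)
    from arg_cong[OF FPq, of "\<lambda>P. eval2 hom P x y"]
    have eq: "eval2 hom r x y = eval2 hom P x y * eval2 hom (- q) x y"
      using F by (simp add: eval2_smult eval2_add eval2_mult eval2_uminus eq_neg_iff_add_eq_0 add.commute)
    have "eval2 hom r x y = 0"
    proof (rule ccontr)
      assume nz: "eval2 hom r x y \<noteq> 0"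
      from min[OF SI[OF this eq eval2_adjoin_ring]] r nz show False by auto
    qed
    moreover have "degree r < n" using r degP F by auto
    ultimately have r0: "r = 0" using indep by blast
    have c: "c \<noteq> 0" using P0 by (simp add: c_def)
    have q0: "q \<noteq> 0" using FPq r0 c F0 by auto
    have "degree (smult c F) = degree P + degree q" unfolding FPq r0 using P0 q0 by (simp add: degree_mult_eq)
    hence "degree q < n" using c F pos by simp
    moreover have "eval2 hom q x y = 0"
      using arg_cong[OF FPq, of "\<lambda>P. eval2 hom P x y"] F Pxy by (simp add: r0 eval2_smult eval2_mult)
    ultimately show False using indep q0 by blast
  qed
  then obtain h where h: "P = [:h:]" by (metis degree_eq_zeroE)
  obtain g where "g \<in> adjoin_ring x y" "eval2 hom P x y = f * g" using P by (auto simp: S_def)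
  thus ?thesis using that[of g h] h P0 by simp
qed

end

section \<open>Local rings and uniqueness of valuation rings\<close>

context field_hom begin

text \<open>
  \<open>local_ring u c v d z r\<close> means that \<open>z\<close> lies in the local ring at \<open>(u, v) = (c, d)\<close> and has residue
  \<open>r\<close> there. As a relation it needs no proof that the residue is well defined.
\<close>

inductive local_ring :: "'b \<Rightarrow> 'a \<Rightarrow> 'b \<Rightarrow> 'a \<Rightarrow> 'b \<Rightarrow> 'a \<Rightarrow> bool" for u c v d where
  const: "local_ring u c v d (hom r) r"
| fst: "local_ring u c v d u c"
| snd: "local_ring u c v d v d"
| add: "local_ring u c v d z r \<Longrightarrow> local_ring u c v d w t \<Longrightarrow> local_ring u c v d (z + w) (r + t)"
| mult: "local_ring u c v d z r \<Longrightarrow> local_ring u c v d w t \<Longrightarrow> local_ring u c v d (z * w) (r * t)"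
| inverse: "local_ring u c v d z r \<Longrightarrow> r \<noteq> 0 \<Longrightarrow> z \<noteq> 0 \<Longrightarrow> local_ring u c v d (inverse z) (inverse r)"

lemma local_ring_power: "local_ring u c v d z r \<Longrightarrow> local_ring u c v d (z ^ k) (r ^ k)"
  using local_ring.const[of u c v d 1] by (induction k) (auto intro: local_ring.mult)

lemma local_ring_diff:
  assumes "local_ring u c v d z r" "local_ring u c v d w t"
  shows "local_ring u c v d (z - w) (r - t)"
  using local_ring.add[OF assms(1) local_ring.mult[OF local_ring.const[of u c v d "- 1"] assms(2)]]
  by (simp add: hom_uminus)

lemma local_ring_sum:
  assumes "\<And>i. i \<in> S \<Longrightarrow> local_ring u c v d (h i) (k i)"
  shows "local_ring u c v d (sum h S) (sum k S)"
  using assms local_ring.const[of u c v d 0]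
  by (induction S rule: infinite_finite_induct) (auto intro: local_ring.add)

text \<open>Induction over the generation of the local ring: divisibility by \<pi> passes from the
  two generators minus their residues to every element minus its residue. This is the relational
  form of \<pi> generating the maximal ideal.\<close>

lemma local_ring_uniformizer:
  assumes z: "local_ring u c v d z r"
    and u: "u - hom c = \<pi> * u'" "local_ring u c v d u' c'"
    and v: "v - hom d = \<pi> * v'" "local_ring u c v d v' d'"
  shows "\<exists>z' r'. local_ring u c v d z' r' \<and> z - hom r = \<pi> * z'"
  using z
proof induction
  case (const r)
  show ?case using local_ring.const[of u c v d 0] by (intro exI[of _ 0] exI) auto
next
  case fst
  show ?case using u by blast
next
  case snd
  show ?case using v by blast
next
  case (add z r w t)
  then obtain z' r' w' t' where "local_ring u c v d z' r'" "z - hom r = \<pi> * z'"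
    "local_ring u c v d w' t'" "w - hom t = \<pi> * w'" by blast
  moreover from this have "z + w - hom (r + t) = \<pi> * (z' + w')"
    by (simp add: hom_add algebra_simps)
  ultimately show ?case by (blast intro: local_ring.add)
next
  case (mult z r w t)
  then obtain z' r' w' t' where 1: "local_ring u c v d z' r'" "z - hom r = \<pi> * z'"
    "local_ring u c v d w' t'" "w - hom t = \<pi> * w'" by blast
  have "z * w - hom (r * t) = (z - hom r) * w + hom r * (w - hom t)"
    by (simp add: hom_mult algebra_simps)
  also have "\<dots> = \<pi> * (z' * w + hom r * w')" unfolding 1 by (simp add: algebra_simps)
  finally show ?case using 1 mult
    by (intro exI[of _ "z' * w + hom r * w'"] exI[of _ "r' * t + r * t'"])
      (auto intro!: local_ring.add local_ring.mult local_ring.const)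
next
  case (inverse z r)
  then obtain z' r' where 1: "local_ring u c v d z' r'" "z - hom r = \<pi> * z'" by blast
  have "inverse z - hom (inverse r) = (z - hom r) * (hom (- inverse r) * inverse z)"
  proof -
    have "inverse z - inverse e = (z - e) * (- inverse e * inverse z)" if "e \<noteq> 0" for e
      using that inverse by (simp add: field_simps)
    thus ?thesis using inverse by (simp only: hom_uminus hom_inverse) simp
  qed
  also have "\<dots> = \<pi> * (z' * (hom (- inverse r) * inverse z))" unfolding 1 by simp
  finally have "inverse z - hom (inverse r) = \<pi> * (z' * (hom (- inverse r) * inverse z))" .
  moreover have "local_ring u c v d (z' * (hom (- inverse r) * inverse z)) (r' * (- inverse r * inverse r))"
    by (intro local_ring.mult local_ring.const local_ring.inverse 1 inverse)
  ultimately show ?case by blast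
qed

end

locale place = field_hom \<iota> for \<iota> :: "'k::field \<Rightarrow> 'a::field" +
  fixes K V :: "'a set"
  assumes valuation: "valuation_ring_of \<iota> K V"
    and K_mult: "z \<in> K \<Longrightarrow> w \<in> K \<Longrightarrow> z * w \<in> K"
    and K_inverse: "z \<in> K \<Longrightarrow> inverse z \<in> K"
begin

abbreviation "M \<equiv> maximal_ideal_of V"

lemma const_mem: "\<iota> c \<in> V"
  using valuation by (auto simp: valuation_ring_of_def)

lemma zero_mem: "0 \<in> V" and one_mem: "1 \<in> V"
  using const_mem[of 0] const_mem[of 1] by simp_all

lemma V_subset: "z \<in> V \<Longrightarrow> z \<in> K"
  using valuation by (auto simp: valuation_ring_of_def)

lemma diff_mem: "z \<in> V \<Longrightarrow> w \<in> V \<Longrightarrow> z - w \<in> V"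
  and mult_mem: "z \<in> V \<Longrightarrow> w \<in> V \<Longrightarrow> z * w \<in> V"
  using valuation by (auto simp: valuation_ring_of_def)

lemma uminus_mem: "z \<in> V \<Longrightarrow> - z \<in> V"
  using diff_mem[OF zero_mem, of z] by simp

lemma add_mem: "z \<in> V \<Longrightarrow> w \<in> V \<Longrightarrow> z + w \<in> V"
  using diff_mem[OF _ uminus_mem, of z w] by simp

lemma mem_or_inverse: "z \<in> K \<Longrightarrow> z \<noteq> 0 \<Longrightarrow> z \<in> V \<or> inverse z \<in> V"
  using valuation by (auto simp: valuation_ring_of_def)

lemma M_subset: "z \<in> M \<Longrightarrow> z \<in> V"
  by (simp add: maximal_ideal_of_def)

lemma M_mult:
  assumes "z \<in> V" "w \<in> M" shows "z * w \<in> M"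
proof -
  have "w = 0" if "inverse (z * w) \<in> V" "z \<noteq> 0"
  proof -
    have "inverse w = z * inverse (z * w)" using that by (simp add: field_simps)
    with mult_mem[OF assms(1) that(1)] have "inverse w \<in> V" by (simp only:)
    thus ?thesis using assms(2) by (auto simp: maximal_ideal_of_def)
  qed
  thus ?thesis using assms mult_mem by (auto simp: maximal_ideal_of_def)
qed

lemma M_uminus: "z \<in> M \<Longrightarrow> - z \<in> M"
  using M_mult[OF uminus_mem[OF one_mem], of z] by simp

text \<open>In a valuation ring one of \<open>z / w\<close> and \<open>w / z\<close> is integral, so
  the sum is a ring element times one of the summands.\<close>

lemma M_add:
  assumes z: "z \<in> M" and w: "w \<in> M" shows "z + w \<in> M"
proof -
  have key: "z + w \<in> M" if z: "z \<in> M" and w: "w \<in> M" and q: "z / w \<in> V" and w0: "w \<noteq> 0" for z w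
  proof -
    have "z + w = (z / w + 1) * w" using w0 by (simp add: field_simps)
    thus ?thesis using M_mult[OF add_mem[OF q one_mem] w] by simp
  qed
  show ?thesis
  proof (cases "z = 0 \<or> w = 0")
    case False
    hence "z / w \<in> K" "z / w \<noteq> 0"
      using z w M_subset V_subset K_mult K_inverse by (auto simp: divide_inverse)
    hence "z / w \<in> V \<or> w / z \<in> V" using mem_or_inverse by fastforce
    thus ?thesis using key[OF z w] key[OF w z] False by (auto simp: add.commute)
  qed (use z w in auto)
qed

lemma const_M: "\<iota> c \<in> M \<longleftrightarrow> c = 0"
  using const_mem by (auto simp: maximal_ideal_of_def simp flip: hom_inverse)

lemma unit: "z \<in> V \<Longrightarrow> z \<notin> M \<Longrightarrow> z \<noteq> 0 \<and> inverse z \<in> V"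
  by (auto simp: maximal_ideal_of_def)

lemma inverse_M: "z \<in> K \<Longrightarrow> z \<notin> V \<Longrightarrow> inverse z \<in> M"
  using mem_or_inverse[of z] zero_mem by (auto simp: maximal_ideal_of_def)

lemma residue_unique: "z - \<iota> c \<in> M \<Longrightarrow> z - \<iota> d \<in> M \<Longrightarrow> c = d"
  using M_add[OF _ M_uminus, of "z - \<iota> c" "z - \<iota> d"] const_M[of "d - c"]
  by (simp add: hom_minus)

lemma residue_add: "z - \<iota> c \<in> M \<Longrightarrow> w - \<iota> d \<in> M \<Longrightarrow> z + w - \<iota> (c + d) \<in> M"
  using M_add[of "z - \<iota> c" "w - \<iota> d"] by (simp add: hom_add algebra_simps)

lemma residue_mem: "z - \<iota> c \<in> M \<Longrightarrow> z \<in> V"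
  using add_mem[OF M_subset const_mem, of "z - \<iota> c" c] by simp

lemma residue_mult:
  assumes "z - \<iota> c \<in> M" "w - \<iota> d \<in> M" shows "z * w - \<iota> (c * d) \<in> M"
proof -
  have "z * w - \<iota> (c * d) = z * (w - \<iota> d) + \<iota> d * (z - \<iota> c)"
    by (simp add: hom_mult algebra_simps)
  thus ?thesis using assms by (auto intro: M_add M_mult residue_mem const_mem)
qed

lemma residue_const: "\<iota> c - \<iota> c \<in> M"
  using const_M[of 0] by simp

lemma residue_inverse:
  assumes z: "z - \<iota> c \<in> M" and c: "c \<noteq> 0" shows "z \<noteq> 0" "inverse z - \<iota> (inverse c) \<in> M"
proof -
  have "z \<notin> M" using residue_unique[OF z, of 0] c by auto
  with unit residue_mem[OF z] show z0: "z \<noteq> 0" by blast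
  have "inverse z \<in> V" using unit residue_mem[OF z] \<open>z \<notin> M\<close> by blast
  moreover have "inverse z - \<iota> (inverse c) = (\<iota> (- inverse c) * inverse z) * (z - \<iota> c)"
  proof -
    have "inverse z - inverse e = - inverse e * inverse z * (z - e)" if "e \<noteq> 0" for e
      using that z0 by (simp add: field_simps)
    thus ?thesis using c by (simp only: hom_uminus hom_inverse) simp
  qed
  ultimately show "inverse z - \<iota> (inverse c) \<in> M"
    using M_mult[OF mult_mem[OF const_mem] z] by simp
qed

lemma local_ring_residue:
  assumes "local_ring u c v d z r" "u - \<iota> c \<in> M" "v - \<iota> d \<in> M"
  shows "z - \<iota> r \<in> M"
  using assms
  by induction (auto intro: residue_add residue_mult residue_inverse simp: const_M[of 0, simplified])

end

lemma eq_mult_inverse: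
  fixes p :: "'a::field"
  assumes "p * q = r" "q \<noteq> 0" shows "p = r * inverse q"
  using assms by auto

context place begin

text \<open>Factors \<pi> are split off \<open>f\<close> as long as its residue is 0. The equation
  \<open>f * g = \<pi> ^ l * w\<close> with \<open>w\<close> of nonzero residue bounds the number of
  steps by \<open>l\<close>, which takes the place of discreteness of the valuation.\<close>

lemma uniformizer_factorization:
  assumes res: "u - \<iota> c \<in> M" "v - \<iota> d \<in> M"
    and unif: "\<pi> \<noteq> 0" "\<And>z r. local_ring u c v d z r \<Longrightarrow>
      \<exists>z' r'. local_ring u c v d z' r' \<and> z - \<iota> r = \<pi> * z'"
    and w: "local_ring u c v d w t" "t \<noteq> 0"
    and f: "local_ring u c v d f r" and g: "local_ring u c v d g r'" and eq: "f * g = \<pi> ^ l * w"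
  shows "\<exists>e w' t'. local_ring u c v d w' t' \<and> t' \<noteq> 0 \<and> f = \<pi> ^ e * w'"
  using f eq
proof (induction l arbitrary: f r)
  case (0 f r)
  have "f * g - \<iota> (r * r') \<in> M"
    by (rule residue_mult[OF local_ring_residue[OF 0(1) res] local_ring_residue[OF g res]])
  moreover have "w - \<iota> t \<in> M" by (rule local_ring_residue[OF w(1) res])
  ultimately have "r * r' = t" using 0(2) residue_unique by simp
  hence "r \<noteq> 0" using w by auto
  thus ?case using 0 by (intro exI[of _ 0] exI[of _ f] exI[of _ r]) simp
next
  case (Suc l f r)
  show ?case
  proof (cases "r = 0")
    case False
    thus ?thesis using Suc by (intro exI[of _ 0] exI[of _ f] exI[of _ r]) simp
  next
    case True
    obtain z s where z: "local_ring u c v d z s" "f - \<iota> r = \<pi> * z"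
      using unif(2)[OF Suc(2)] by blast
    hence f: "f = \<pi> * z" using True by simp
    hence "\<pi> * (z * g) = \<pi> * (\<pi> ^ l * w)" using Suc(3) by (simp add: mult_ac)
    hence "z * g = \<pi> ^ l * w" using unif(1) by simp
    from Suc(1)[OF z(1) this] obtain e w' t' where
      "local_ring u c v d w' t'" "t' \<noteq> 0" "z = \<pi> ^ e * w'" by blast
    thus ?thesis using f by (intro exI[of _ "Suc e"] exI[of _ w'] exI[of _ t']) simp
  qed
qed

end

context field_hom begin

text \<open>The two natural exponents encode the integral power \<open>e' - e\<close> of \<pi>,
  which may be negative.\<close>

definition unit_times_power :: "'b \<Rightarrow> 'a \<Rightarrow> 'b \<Rightarrow> 'a \<Rightarrow> 'b \<Rightarrow> 'b \<Rightarrow> bool" where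
  "unit_times_power u c v d \<pi> z \<longleftrightarrow>
     (\<exists>e e' w t. local_ring u c v d w t \<and> t \<noteq> 0 \<and> w \<noteq> 0 \<and> z * \<pi> ^ e = \<pi> ^ e' * w)"

lemma unit_times_power_divide:
  assumes "unit_times_power u c v d \<pi> z" "unit_times_power u c v d \<pi> z'" "\<pi> \<noteq> 0"
  shows "unit_times_power u c v d \<pi> (z / z')"
proof -
  obtain e e' w t f f' w' t' where
    1: "local_ring u c v d w t" "t \<noteq> 0" "w \<noteq> 0" "z * \<pi> ^ e = \<pi> ^ e' * w" and
    2: "local_ring u c v d w' t'" "t' \<noteq> 0" "w' \<noteq> 0" "z' * \<pi> ^ f = \<pi> ^ f' * w'"
    using assms unfolding unit_times_power_def by metis
  have "z' \<noteq> 0" using 2 assms(3) by auto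
  have "(z / z') * \<pi> ^ (e + f') = (z * \<pi> ^ e) * (\<pi> ^ f' * w') / (z' * w')"
    using 2 \<open>z' \<noteq> 0\<close> by (simp add: power_add)
  also have "\<dots> = (\<pi> ^ e' * w) * (z' * \<pi> ^ f) / (z' * w')" unfolding 1 2 ..
  also have "\<dots> = \<pi> ^ (e' + f) * (w * inverse w')"
    using 2 \<open>z' \<noteq> 0\<close> by (simp add: power_add field_simps)
  finally show ?thesis unfolding unit_times_power_def using 1 2
    by (intro exI[of _ "e + f'"] exI[of _ "e' + f"] exI[of _ "w * inverse w'"] exI[of _ "t * inverse t'"])
      (auto intro!: local_ring.mult local_ring.inverse)
qed

end

lemma (in place) mem_unit_times_power:
  assumes res: "u - \<iota> c \<in> M" "v - \<iota> d \<in> M"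
    and \<pi>: "\<pi> \<noteq> 0" "\<pi> \<in> M" and w: "local_ring u c v d w t" "t \<noteq> 0" and eq: "z * \<pi> ^ e = \<pi> ^ e' * w"
  shows "z \<in> V \<longleftrightarrow> e \<le> e'"
proof
  have wr: "w - \<iota> t \<in> M" by (rule local_ring_residue[OF w(1) res])
  have pow: "\<pi> ^ k \<in> V" for k
    by (induction k) (auto intro: one_mem mult_mem M_subset \<pi>)
  {
    assume "e \<le> e'"
    hence "z * \<pi> ^ e = (\<pi> ^ (e' - e) * w) * \<pi> ^ e" using eq by (simp add: mult_ac flip: power_add)
    hence "z = \<pi> ^ (e' - e) * w" using \<pi> by simp
    thus "z \<in> V" using pow residue_mem[OF wr] mult_mem by simp
  }
  assume z: "z \<in> V"
  show "e \<le> e'"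
  proof (rule ccontr)
    assume "\<not> e \<le> e'"
    then obtain k where "e = e' + Suc k" by (metis not_le less_iff_Suc_add add_Suc_right)
    hence "\<pi> ^ e = \<pi> ^ e' * (\<pi> ^ k * \<pi>)" by (simp add: power_add)
    hence "\<pi> ^ e' * (z * \<pi> ^ k * \<pi>) = \<pi> ^ e' * w" using eq by (simp add: mult_ac)
    hence "w = (z * \<pi> ^ k) * \<pi>" using \<pi> by simp
    hence "w \<in> M" using M_mult[OF mult_mem[OF z pow] \<pi>(2)] by simp
    hence "w - \<iota> 0 \<in> M" by simp
    with wr w residue_unique show False by blast
  qed
qed

text \<open>Membership of \<open>z\<close> is decided by comparing the two exponents of \<pi> in its
  factorization, and the factorization does not refer to the valuation ring.\<close>

lemma valuation_ring_unique:
  assumes "place \<iota> K V" "place \<iota> K V'"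
    and "u - \<iota> c \<in> maximal_ideal_of V" "v - \<iota> d \<in> maximal_ideal_of V"
    and "u - \<iota> c \<in> maximal_ideal_of V'" "v - \<iota> d \<in> maximal_ideal_of V'"
    and "\<pi> \<noteq> 0" "\<pi> \<in> maximal_ideal_of V" "\<pi> \<in> maximal_ideal_of V'"
    and K: "\<And>z. z \<in> K \<Longrightarrow> z \<noteq> 0 \<Longrightarrow> field_hom.unit_times_power \<iota> u c v d \<pi> z"
  shows "V = V'"
proof -
  interpret A: place \<iota> K V by fact
  interpret B: place \<iota> K V' by fact
  have "z \<in> V \<longleftrightarrow> z \<in> V'" if z: "z \<in> K" "z \<noteq> 0" for z
  proof -
    obtain e e' w t where "A.local_ring u c v d w t" "t \<noteq> 0" "z * \<pi> ^ e = \<pi> ^ e' * w"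
      using K[OF z] unfolding A.unit_times_power_def by blast
    thus ?thesis using A.mem_unit_times_power B.mem_unit_times_power assms by metis
  qed
  thus ?thesis using A.V_subset B.V_subset A.zero_mem B.zero_mem by blast
qed

section \<open>The Kummer curve and its places\<close>

locale kummer_curve = field_hom \<iota> for \<iota> :: "'k::field \<Rightarrow> 'a::field" +
  fixes x y :: 'a and a b :: 'k and n :: nat
  assumes n: "0 < n" "of_nat n \<noteq> (0::'k)" and ab: "a \<noteq> 0" "b \<noteq> 0" "a * b \<noteq> 1"
    and relation: "\<iota> a * x ^ n * y ^ n - x ^ n - y ^ n + \<iota> b = 0"
    and indep_fst: "degree P < n \<Longrightarrow> eval2 \<iota> P x y = 0 \<Longrightarrow> P = 0"
    and indep_snd: "degree P < n \<Longrightarrow> eval2 \<iota> P y x = 0 \<Longrightarrow> P = 0"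
begin

text \<open>The locale contains independence in both orders of the variables for the sake of this
  symmetry. It carries results about poles of \<open>x\<close> and about points with nonzero
  \<open>y\<close> over to the other coordinate.\<close>

lemma swap: "kummer_curve \<iota> y x a b n"
proof unfold_locales
  show "\<iota> a * y ^ n * x ^ n - y ^ n - x ^ n + \<iota> b = 0"
    using relation by (simp add: algebra_simps)
qed (use n ab indep_fst indep_snd in auto)

sublocale x: transcendental_element \<iota> x
proof
  fix P assume "eval1 \<iota> P x = 0"
  thus "P = 0" using indep_fst[of "[:P:]"] n by simp
qed

lemma eval1_pcompose_monom: "eval1 \<iota> (pcompose P (monom 1 n)) x = eval1 \<iota> P (x ^ n)"
proof (induction P)
  case (pCons c P)
  thus ?case by (simp add: pcompose_pCons eval1_add eval1_mult eval1_monom)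
qed simp

sublocale kummer \<iota> "x ^ n" "y ^ n" a b
proof
  fix P assume "eval1 \<iota> P (x ^ n) = 0"
  hence "pcompose P (monom 1 n) = 0"
    using x.transcendental eval1_pcompose_monom by metis
  thus "P = 0" using n by (simp add: pcompose_eq_0_iff degree_monom_eq)
qed (use relation ab in auto)

abbreviation "K \<equiv> adjoin2 \<iota> x y"

lemma xy_nonzero: "x \<noteq> 0" "y \<noteq> 0"
  using X_minus_const_nonzero[of 0] Y_nonzero n by auto

lemma eliminate:
  assumes "f \<in> adjoin_ring x y" "f \<noteq> 0"
  obtains g h where "g \<in> adjoin_ring x y" "h \<noteq> 0" "f * g = eval1 \<iota> h x"
proof -
  define F where "F = monom (monom a n - 1) n + [:[:b:] - monom 1 n:]"
  have "eval2 \<iota> F x y = \<iota> a * x ^ n * y ^ n - x ^ n - y ^ n + \<iota> b"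
    by (simp add: F_def eval2_add eval2_monom eval1_diff eval1_monom algebra_simps)
  hence F0: "eval2 \<iota> F x y = 0" using relation by simp
  have "coeff (monom a n - 1) n \<noteq> 0" using ab n by simp
  hence "monom a n - 1 \<noteq> 0" by (metis coeff_0)
  hence "degree F = n" unfolding F_def using n
    by (subst degree_add_eq_left) (auto simp: degree_monom_eq)
  thus ?thesis using elimination[OF _ n(1) F0 indep_fst assms] that by blast
qed

lemma residue_relation:
  assumes "place \<iota> K V" "x - \<iota> c \<in> maximal_ideal_of V" "y - \<iota> d \<in> maximal_ideal_of V"
  shows "a * c ^ n * d ^ n - c ^ n - d ^ n + b = 0"
proof -
  interpret V: place \<iota> K V by fact
  have pow: "z ^ k - \<iota> (r ^ k) \<in> V.M" if "z - \<iota> r \<in> V.M" for z r k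
    using V.local_ring_residue[OF local_ring_power[OF local_ring.fst] that that] by simp
  have "\<iota> a * x ^ n * y ^ n + \<iota> b - \<iota> (a * c ^ n * d ^ n + b) \<in> V.M"
    by (intro V.residue_add V.residue_mult V.residue_const pow assms)
  moreover have "x ^ n + y ^ n - \<iota> (c ^ n + d ^ n) \<in> V.M"
    by (intro V.residue_add pow assms)
  moreover have "\<iota> a * x ^ n * y ^ n + \<iota> b = x ^ n + y ^ n"
    using relation by (simp add: algebra_simps)
  ultimately have "a * c ^ n * d ^ n + b = c ^ n + d ^ n" using V.residue_unique by simp
  thus ?thesis by (simp add: algebra_simps)
qed

text \<open>The cofactor of \<open>y - \<iota> d\<close> in the difference of n-th powers has
  residue \<open>n * d ^ (n - 1)\<close>, which is nonzero.\<close>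

lemma power_diff_unit:
  assumes d: "d \<noteq> 0" and V: "place \<iota> K V" "u - \<iota> c \<in> maximal_ideal_of V" "y - \<iota> d \<in> maximal_ideal_of V"
  obtains S r where "local_ring u c y d S r" "r \<noteq> 0" "S \<noteq> 0" "y ^ n - \<iota> (d ^ n) = (y - \<iota> d) * S"
proof
  interpret V: place \<iota> K V by fact
  define S where "S = (\<Sum>i<n. \<iota> d ^ (n - Suc i) * y ^ i)"
  define r where "r = (\<Sum>i<n. d ^ (n - Suc i) * d ^ i)"
  show S: "local_ring u c y d S r"
    unfolding S_def r_def hom_power[symmetric]
    by (intro local_ring_sum local_ring.mult local_ring_power local_ring.snd local_ring.const)
  have "r = (\<Sum>i<n. d ^ (n - 1))" unfolding r_def
    by (rule sum.cong) (auto simp flip: power_add)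
  thus r: "r \<noteq> 0" using d n by simp
  show "S \<noteq> 0" using V.residue_inverse(1)[OF V.local_ring_residue[OF S V(2,3)] r] .
  show "y ^ n - \<iota> (d ^ n) = (y - \<iota> d) * S"
    unfolding S_def hom_power by (rule power_diff_sumr2)
qed

text \<open>Where \<open>d\<close> is nonzero, \<open>x - \<iota> c\<close> is a local parameter:
  the Moebius relation between the n-th powers and the unit cofactor on the side of \<open>y\<close>
  make \<open>y - \<iota> d\<close> a multiple of it. Every nonzero function is then a power of it
  times a unit.\<close>

lemma affine_place_unique:
  assumes d: "d \<noteq> 0" and V: "place \<iota> K V" "place \<iota> K V'"
    and res: "x - \<iota> c \<in> maximal_ideal_of V" "y - \<iota> d \<in> maximal_ideal_of V"
    and res': "x - \<iota> c \<in> maximal_ideal_of V'" "y - \<iota> d \<in> maximal_ideal_of V'"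
  shows "V = V'"
proof (rule valuation_ring_unique[OF V res res' _ res(1) res'(1)])
  interpret V: place \<iota> K V by fact
  let ?L = "local_ring x c y d"
  show \<pi>0: "x - \<iota> c \<noteq> 0" by (rule x.X_minus_const_nonzero)
  have cd: "a * c ^ n * d ^ n - c ^ n - d ^ n + b = 0" by (rule residue_relation[OF V(1) res])
  have ac: "a * c ^ n \<noteq> 1"
  proof
    assume ac: "a * c ^ n = 1"
    hence "c ^ n = b" using cd by (simp add: algebra_simps)
    thus False using ac ab by simp
  qed
  have dn: "d ^ n = (c ^ n - b) / (a * c ^ n - 1)"
    using cd ac by (simp add: field_simps)
  obtain S r where S: "?L S r" "r \<noteq> 0" "S \<noteq> 0" "y ^ n - \<iota> (d ^ n) = (y - \<iota> d) * S"
    using power_diff_unit[OF d V(1) res] .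
  define A where "A = \<iota> a * x ^ n - 1"
  have A: "?L A (a * c ^ n - 1)"
    using local_ring_diff[OF local_ring.mult[OF local_ring.const local_ring_power[OF local_ring.fst]]
        local_ring.const[of x c y d 1], of a n] by (simp add: A_def)
  have A0: "A \<noteq> 0" unfolding A_def by (rule aX_minus_1(2))
  define T where "T = (\<Sum>i<n. \<iota> c ^ (n - Suc i) * x ^ i)"
  define T' where "T' = (\<Sum>i<n. c ^ (n - Suc i) * c ^ i)"
  have T: "?L T T'"
    unfolding T_def T'_def hom_power[symmetric]
    by (intro local_ring_sum local_ring.mult local_ring_power local_ring.fst local_ring.const)
  have T_eq: "x ^ n - \<iota> (c ^ n) = (x - \<iota> c) * T"
    unfolding T_def hom_power by (rule power_diff_sumr2)
  define k where "k = (a * b - 1) / (a * c ^ n - 1)"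
  have "(y ^ n - \<iota> (d ^ n)) * A = \<iota> k * (x ^ n - \<iota> (c ^ n))"
    using Y_minus_const[OF ac dn] by (simp add: A_def k_def hom_uminus mult.commute)
  hence "(y - \<iota> d) * (S * A) = (x - \<iota> c) * (T * \<iota> k)"
    unfolding S T_eq by (simp add: mult_ac)
  hence "y - \<iota> d = (x - \<iota> c) * (T * \<iota> k) * inverse (S * A)"
    by (rule eq_mult_inverse) (use S(3) A0 in simp)
  hence v: "y - \<iota> d = (x - \<iota> c) * (T * \<iota> k * inverse S * inverse A)"
    by (simp add: mult_ac)
  have v': "?L (T * \<iota> k * inverse S * inverse A) (T' * k * inverse r * inverse (a * c ^ n - 1))"
    using S A A0 ac T by (intro local_ring.mult local_ring.inverse local_ring.const) auto
  have u: "x - \<iota> c = (x - \<iota> c) * 1" "?L 1 1" using local_ring.const[of x c y d 1] by simp_all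
  note unif = local_ring_uniformizer[OF _ u v v']
  have adj: "\<exists>r. ?L f r" if "f \<in> adjoin_ring x y" for f
    using that by (induction rule: adjoin_ring_induct) (blast intro: local_ring.intros)+
  have ring: "unit_times_power x c y d (x - \<iota> c) f" if f: "f \<in> adjoin_ring x y" "f \<noteq> 0" for f
  proof -
    \<comment> \<open>In a multiple of \<open>f\<close> from k[x] the power of
      \<open>x - \<iota> c\<close> is explicit; it bounds how often this factor can be split off
      \<open>f\<close>.\<close>
    obtain g h where g: "g \<in> adjoin_ring x y" "h \<noteq> 0" "f * g = eval1 \<iota> h x"
      using eliminate[OF f] .
    obtain h1 where h1: "h = [:- c, 1:] ^ order c h * h1" "\<not> [:- c, 1:] dvd h1"
      using order_decomp[OF g(2)] by blast
    have ev: "?L (eval1 \<iota> p x) (poly p c)" for p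
      by (induction p) (use local_ring.const[of x c y d 0] in
          \<open>auto intro!: local_ring.add local_ring.mult local_ring.const local_ring.fst\<close>)
    have h1c: "poly h1 c \<noteq> 0" using h1(2) by (simp add: poly_eq_0_iff_dvd)
    obtain r r' where r: "?L f r" "?L g r'" using adj f(1) g(1) by metis
    have "f * g = (x - \<iota> c) ^ order c h * eval1 \<iota> h1 x"
      unfolding g(3) by (subst h1(1)) (simp add: eval1_mult eval1_power hom_uminus)
    from V.uniformizer_factorization[OF res \<pi>0 unif ev h1c r this]
    obtain e w t where w: "?L w t" "t \<noteq> 0" "f = (x - \<iota> c) ^ e * w" by blast
    moreover have "w \<noteq> 0" using w(3) f(2) by auto
    ultimately show ?thesis unfolding unit_times_power_def
      by (intro exI[of _ 0] exI[of _ e] exI[of _ w] exI[of _ t]) simp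
  qed
  show "unit_times_power x c y d (x - \<iota> c) z" if z: "z \<in> K" "z \<noteq> 0" for z
  proof -
    obtain f g where "z = f / g" "f \<in> adjoin_ring x y" "g \<in> adjoin_ring x y" "g \<noteq> 0"
      using z(1) unfolding adjoin2_eq by blast
    thus ?thesis using z(2) unit_times_power_divide[OF ring ring \<pi>0] by auto
  qed
qed

text \<open>At a pole of \<open>x\<close> the local parameter is \<open>u = inverse x\<close>: the
  relation divided by \<open>x ^ n\<close> shows that \<open>y - \<iota> d\<close> is a multiple of
  \<open>u ^ n\<close>. Polynomials in x and y become local after multiplication by a power of
  \<open>u\<close>.\<close>

lemma infinite_place_unique:
  assumes d: "a * d ^ n = 1" and V: "place \<iota> K V" "place \<iota> K V'"
    and res: "inverse x \<in> maximal_ideal_of V" "y - \<iota> d \<in> maximal_ideal_of V"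
    and res': "inverse x \<in> maximal_ideal_of V'" "y - \<iota> d \<in> maximal_ideal_of V'"
  shows "V = V'"
proof -
  interpret V: place \<iota> K V by fact
  define u where "u = inverse x"
  have u0: "u \<noteq> 0" "x = inverse u" using xy_nonzero by (auto simp: u_def)
  have xu: "x ^ k * u ^ k = 1" for k using xy_nonzero by (simp add: u_def flip: power_mult_distrib)
  let ?L = "local_ring u 0 y d"
  have resu: "u - \<iota> 0 \<in> V.M" using res by (simp add: u_def)
  have d0: "d \<noteq> 0" using d n by (auto simp: power_0_left)
  obtain S r where S: "?L S r" "r \<noteq> 0" "S \<noteq> 0" "y ^ n - \<iota> (d ^ n) = (y - \<iota> d) * S"
    using power_diff_unit[OF d0 V(1) resu res(2)] .
  define A where "A = \<iota> a - u ^ n"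
  have A: "?L A a"
    using local_ring_diff[OF local_ring.const local_ring_power[OF local_ring.fst], of u 0 y d a n] n
    by (simp add: A_def power_0_left)
  have A_eq: "\<iota> a * x ^ n - 1 = A * x ^ n" using xu[of n] by (simp add: A_def algebra_simps)
  have A0: "A \<noteq> 0" using aX_minus_1(2) unfolding A_eq by simp
  have dn: "d ^ n = inverse a" using d by (metis inverse_unique)
  define k where "k = inverse a - b"
  have "\<iota> (d ^ n) * (\<iota> a * x ^ n - 1) = x ^ n - \<iota> (d ^ n)"
    using ab by (simp add: dn right_diff_distrib mult.assoc[symmetric] flip: hom_mult)
  hence "(y ^ n - \<iota> (d ^ n)) * (\<iota> a * x ^ n - 1) = \<iota> k"
    using Y_eq by (simp add: k_def dn hom_minus algebra_simps)
  hence "(y - \<iota> d) * S * (A * x ^ n) = \<iota> k" unfolding S(4) A_eq .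
  hence "(y - \<iota> d) * (S * A) * (x ^ n * u ^ n) = \<iota> k * u ^ n" by (simp add: mult_ac)
  hence "(y - \<iota> d) * (S * A) = \<iota> k * u ^ n" unfolding xu by simp
  hence "y - \<iota> d = \<iota> k * u ^ n * inverse (S * A)"
    by (rule eq_mult_inverse) (use S(3) A0 in simp)
  also have "u ^ n = u * u ^ (n - 1)" using n by (cases n) auto
  finally have v: "y - \<iota> d = u * (\<iota> k * u ^ (n - 1) * inverse S * inverse A)"
    by (simp add: mult_ac)
  have v': "?L (\<iota> k * u ^ (n - 1) * inverse S * inverse A) (k * 0 ^ (n - 1) * inverse r * inverse a)"
    using S A A0 ab
    by (intro local_ring.mult local_ring.inverse local_ring.const local_ring_power local_ring.fst) auto
  have u: "u - \<iota> 0 = u * 1" "?L 1 1" using local_ring.const[of u 0 y d 1] by simp_all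
  note unif = local_ring_uniformizer[OF _ u v v']
  have pow: "?L (u ^ k) (0 ^ k)" for k by (intro local_ring_power local_ring.fst)
  have adj: "\<exists>k r. ?L (f * u ^ k) r" if "f \<in> adjoin_ring x y" for f
    using that
  proof (induction rule: adjoin_ring_induct)
    case (const c)
    show ?case using local_ring.const[of u 0 y d c] by (intro exI[of _ 0] exI[of _ c]) simp
  next
    case fst
    show ?case using local_ring.const[of u 0 y d 1] xu[of 1] by (intro exI[of _ 1] exI[of _ 1]) simp
  next
    case snd
    show ?case using local_ring.snd[of u 0 y d] by (intro exI[of _ 0] exI[of _ d]) simp
  next
    case (add z w)
    then obtain i r j t where "?L (z * u ^ i) r" "?L (w * u ^ j) t" by blast
    hence "?L (z * u ^ i * u ^ j + w * u ^ j * u ^ i) (r * 0 ^ j + t * 0 ^ i)"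
      by (intro local_ring.add local_ring.mult pow)
    thus ?case by (intro exI[of _ "i + j"]) (auto simp: algebra_simps power_add)
  next
    case (mult z w)
    then obtain i r j t where "?L (z * u ^ i) r" "?L (w * u ^ j) t" by blast
    hence "?L (z * u ^ i * (w * u ^ j)) (r * t)" by (rule local_ring.mult)
    thus ?case by (intro exI[of _ "i + j"]) (auto simp: algebra_simps power_add)
  qed
  have ring: "unit_times_power u 0 y d u f" if f: "f \<in> adjoin_ring x y" "f \<noteq> 0" for f
  proof -
    obtain g h where g: "g \<in> adjoin_ring x y" "h \<noteq> 0" "f * g = eval1 \<iota> h x"
      using eliminate[OF f] .
    obtain i r j t where ij: "?L (f * u ^ i) r" "?L (g * u ^ j) t" using adj f(1) g(1) by metis
    \<comment> \<open>Scaled by \<open>u ^ degree p\<close>, a polynomial in \<open>x\<close> has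
      its leading coefficient as residue.\<close>
    have ev: "p \<noteq> 0 \<Longrightarrow> ?L (eval1 \<iota> p x * u ^ degree p) (lead_coeff p)" for p
    proof (induction p)
      case (pCons c p)
      show ?case
      proof (cases "p = 0")
        case False
        have "?L (\<iota> c * u ^ Suc (degree p) + eval1 \<iota> p x * u ^ degree p)
            (c * 0 ^ Suc (degree p) + lead_coeff p)"
          using pCons False by (intro local_ring.add local_ring.mult local_ring.const pow) auto
        moreover have "eval1 \<iota> (pCons c p) x * u ^ degree (pCons c p)
            = \<iota> c * u ^ Suc (degree p) + eval1 \<iota> p x * u ^ degree p"
          using False xu[of 1] by (simp add: algebra_simps)
        ultimately show ?thesis using False by simp
      qed (use local_ring.const in auto)
    qed simp
    have lc: "lead_coeff h \<noteq> 0" using g(2) by simp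
    have "(f * u ^ i) * (g * u ^ j * u ^ degree h) = (f * g) * u ^ degree h * u ^ (i + j)"
      by (simp add: power_add mult_ac)
    also have "\<dots> = u ^ (i + j) * (eval1 \<iota> h x * u ^ degree h)" unfolding g by (simp add: mult_ac)
    finally have eq: "(f * u ^ i) * (g * u ^ j * u ^ degree h) =
      u ^ (i + j) * (eval1 \<iota> h x * u ^ degree h)" .
    from V.uniformizer_factorization[OF resu res(2) u0(1) unif ev[OF g(2)] lc ij(1)
        local_ring.mult[OF ij(2) pow] eq]
    obtain e w t where w: "?L w t" "t \<noteq> 0" "f * u ^ i = u ^ e * w" by blast
    moreover have "w \<noteq> 0" using w(3) f(2) u0 by auto
    ultimately show ?thesis unfolding unit_times_power_def by blast
  qed
  show "V = V'"
  proof (rule valuation_ring_unique[OF V resu res(2) _ res'(2) u0(1)])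
    show "u - \<iota> 0 \<in> maximal_ideal_of V'" "u \<in> V.M" "u \<in> maximal_ideal_of V'"
      using res res' by (simp_all add: u_def)
    show "unit_times_power u 0 y d u z" if z: "z \<in> K" "z \<noteq> 0" for z
    proof -
      obtain f g where "z = f / g" "f \<in> adjoin_ring x y" "g \<in> adjoin_ring x y" "g \<noteq> 0"
        using z(1) unfolding adjoin2_eq by blast
      thus ?thesis using z(2) unit_times_power_divide[OF ring ring u0(1)] by auto
    qed
  qed
qed

end

section \<open>Finite fields and the generic point\<close>

lemma finite_field_power_card:
  fixes c :: "'k::{field,finite}"
  assumes "c \<noteq> 0" shows "c ^ (CARD('k) - 1) = 1"
proof -
  have "(\<Prod>d\<in>UNIV-{0}. c * d) = (\<Prod>d\<in>UNIV-{0}. d)"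
    by (rule prod.reindex_bij_witness[of _ "\<lambda>d. d / c" "\<lambda>d. c * d"]) (use assms in auto)
  hence "c ^ (CARD('k) - 1) * (\<Prod>d\<in>UNIV-{0}. d) = 1 * (\<Prod>d\<in>UNIV-{0}. d :: 'k)"
    by (simp add: prod.distrib card_Diff_singleton)
  moreover have "(\<Prod>d\<in>UNIV-{0}. d :: 'k) \<noteq> 0" by simp
  ultimately show ?thesis by (metis mult_right_cancel)
qed

lemma of_nat_card_eq_0: "of_nat CARD('k) = (0::'k::{field,finite})"
proof -
  have "(\<Sum>c\<in>UNIV. c + 1) = (\<Sum>c\<in>UNIV. c :: 'k)"
    by (rule sum.reindex_bij_witness[of _ "\<lambda>c. c - 1" "\<lambda>c. c + 1"]) auto
  thus ?thesis by (simp add: sum.distrib)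
qed

lemma card_power_eq_le: "0 < n \<Longrightarrow> card {c :: 'k::field. c ^ n = t} \<le> n"
proof -
  assume n: "0 < n"
  define p where "p = monom 1 n + [:- t:]"
  have deg: "degree p = n" unfolding p_def using n
    by (subst degree_add_eq_left) (auto simp: degree_monom_eq)
  hence "p \<noteq> 0" using n by auto
  moreover have "{c. c ^ n = t} = {c. poly p c = 0}" by (simp add: p_def poly_monom)
  ultimately show ?thesis using card_poly_roots_bound[of p] deg by simp
qed

text \<open>The polynomial \<open>(1 + T) ^ q - 1 - T ^ q\<close> has degree less than \<open>q\<close> and vanishes on \<open>'k\<close>.\<close>
lemma power_card_add:
  fixes \<iota> :: "'k::{field,finite} \<Rightarrow> 'a::field" and u v :: 'a
  assumes "field_hom \<iota>"
  shows "(u + v) ^ CARD('k) = u ^ CARD('k) + v ^ CARD('k)"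
proof -
  interpret field_hom \<iota> by fact
  define q where "q = CARD('k)"
  have q0: "0 < q" by (simp add: q_def)
  have pow: "c ^ q = c" for c :: 'k
  proof (cases "c = 0")
    case False
    have "c ^ q = c * c ^ (q - 1)" using q0 by (cases q) auto
    thus ?thesis using finite_field_power_card[OF False] by (simp add: q_def)
  qed (use q0 in \<open>simp add: power_0_left\<close>)
  define p :: "'k poly" where "p = [:1, 1:] ^ q - 1 - monom 1 q"
  have deg: "degree ([:1, 1:] ^ q :: 'k poly) = q" by (simp add: degree_power_eq)
  have lead: "coeff ([:1, 1:] ^ q :: 'k poly) q = 1"
    using lead_coeff_power[of "[:1, 1:] :: 'k poly" q] by (simp add: deg)
  have p0: "p = 0"
  proof (rule ccontr)
    assume p: "p \<noteq> 0"
    have "degree p \<le> q"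
      unfolding p_def by (intro degree_diff_le) (auto simp: deg degree_monom_le)
    moreover have "coeff p q = 0" using lead q0 by (simp add: p_def)
    ultimately have "degree p < q" using p by (metis le_neq_implies_less leading_coeff_0_iff)
    moreover have "{c. poly p c = 0} = UNIV"
      by (auto simp: p_def poly_monom pow)
    ultimately show False using card_poly_roots_bound[OF p] by (simp add: q_def)
  qed
  have one: "(1 + w) ^ q = 1 + w ^ q" for w :: 'a
  proof -
    have "eval1 \<iota> p w = (1 + w) ^ q - 1 - w ^ q"
      by (simp add: p_def eval1_diff eval1_power eval1_monom)
    thus ?thesis using p0 by (simp add: algebra_simps)
  qed
  show ?thesis
  proof (cases "v = 0")
    case False
    have "u + v = v * (1 + u / v)" using False by (simp add: field_simps)
    hence "(u + v) ^ q = v ^ q * (1 + (u / v) ^ q)" by (simp add: power_mult_distrib one)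
    also have "\<dots> = v ^ q + v ^ q * (u ^ q / v ^ q)" by (simp add: distrib_left power_divide)
    finally show ?thesis using False by (simp add: q_def[symmetric])
  qed (use q0 in \<open>simp add: q_def\<close>)
qed

lemma curve_poly_altdef:
  fixes a b :: "'k::field"
  shows "curve_poly a b n = monom (monom a n - 1) n + [:[:b:] - monom 1 n:]"
proof -
  have X: "[:[:0, 1:]:] ^ n = [:monom (1::'k::field) n:]"
    by (induction n) (auto simp: monom_Suc one_pCons)
  have Y: "[:0, 1:] ^ n = (monom 1 n :: 'k poly poly)" by (simp add: monom_altdef)
  have 1: "curve_poly a b n = smult (smult a (monom 1 n)) (monom 1 n) - [:monom 1 n:] - monom 1 n + [:[:b:]:]"
    by (simp add: curve_poly_def Let_def X Y)
  have 2: "monom (monom a n - 1) n = smult (smult a (monom 1 n)) (monom 1 n) - monom 1 n"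
    by (simp add: smult_monom diff_monom)
  have 3: "[:[:b:] - monom 1 n:] = [:[:b:]:] - [:monom 1 n:]" by simp
  have "p - q - r + t = p - r + (t - q)" for p q r t :: "'k poly poly" by simp
  thus ?thesis unfolding 1 2 3 .
qed

lemma coeff_curve_poly:
  assumes "0 < n" "a \<noteq> 0"
  shows "degree (curve_poly a b n) = n" "degree (coeff (curve_poly a b n) n) = n"
proof -
  have eq: "degree (monom a n - 1) = n"
    using assms degree_add_eq_left[of "- 1" "monom a n"] by (simp add: degree_monom_eq)
  hence nz: "monom a n - 1 \<noteq> 0" using assms by auto
  show deg: "degree (curve_poly a b n) = n" unfolding curve_poly_altdef
    using assms nz by (subst degree_add_eq_left) (auto simp: degree_monom_eq)
  have "coeff (curve_poly a b n) n = monom a n - 1"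
    using assms unfolding curve_poly_altdef by (simp add: coeff_pCons split: nat.split)
  thus "degree (coeff (curve_poly a b n) n) = n" using eq by simp
qed

text \<open>Independence of the powers of y holds because \<open>F\<close> has degree
  \<open>n\<close> in Y. For the powers of x the reason is that the leading coefficient of
  \<open>F\<close> in Y has degree \<open>n\<close> in X, so a multiple of \<open>F\<close> whose
  coefficients have degree below \<open>n\<close> in X must vanish.\<close>

lemma generic_point_kummer_curve:
  fixes \<iota> :: "'k::field \<Rightarrow> 'a::field"
  assumes gen: "generic_point \<iota> (curve_poly a b n) x y"
    and n: "0 < n" "of_nat n \<noteq> (0::'k)" and ab: "a \<noteq> 0" "b \<noteq> 0" "a * b \<noteq> 1"
  shows "kummer_curve \<iota> x y a b n"
proof -
  interpret field_hom \<iota> using gen by (simp add: generic_point_def)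
  define F where "F = curve_poly a b n"
  have dvd: "eval2 \<iota> P x y = 0 \<longleftrightarrow> F dvd P" for P
    using gen by (simp add: generic_point_def F_def)
  have F: "degree F = n" "degree (coeff F n) = n"
    unfolding F_def using coeff_curve_poly n ab by blast+
  show ?thesis
  proof unfold_locales
    have "eval2 \<iota> F x y = 0" using dvd by simp
    thus "\<iota> a * x ^ n * y ^ n - x ^ n - y ^ n + \<iota> b = 0"
      by (simp add: F_def curve_poly_altdef eval2_add eval2_monom eval1_diff eval1_monom algebra_simps)
    show "P = 0" if "degree P < n" "eval2 \<iota> P x y = 0" for P
      using that dvd F dvd_imp_degree_le[of F P] by fastforce
    fix P assume P: "degree P < n" "eval2 \<iota> P y x = 0"
    \<comment> \<open>This is \<open>P\<close> with its two variables exchanged.\<close>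
    define Q where "Q = (\<Sum>i\<le>degree P. smult (monom 1 i) (map_poly (\<lambda>c. [:c:]) (coeff P i)))"
    have coeffQ: "coeff Q j = (\<Sum>i\<le>degree P. monom (coeff (coeff P i) j) i)" for j
      by (simp add: Q_def coeff_sum coeff_map_poly smult_monom mult.commute)
    have "eval2 \<iota> (map_poly (\<lambda>c. [:c:]) p) x y = eval1 \<iota> p y" for p
      by (induction p) (auto simp: map_poly_pCons)
    hence "eval2 \<iota> Q x y = (\<Sum>i\<le>degree P. x ^ i * eval1 \<iota> (coeff P i) y)"
      by (simp add: Q_def eval2_sum eval2_smult eval1_monom)
    also have "\<dots> = eval2 \<iota> (\<Sum>i\<le>degree P. monom (coeff P i) i) y x"
      by (simp add: eval2_sum eval2_monom mult.commute)
    also have "\<dots> = 0" using P(2) by (simp add: poly_as_sum_of_monoms)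
    finally obtain G where G: "Q = F * G" using dvd by auto
    have degQ: "degree (coeff Q j) < n" for j
    proof -
      have "degree (coeff Q j) \<le> degree P" unfolding coeffQ
        by (rule degree_sum_le) (auto intro: order.trans[OF degree_monom_le])
      thus ?thesis using P(1) by simp
    qed
    have "Q = 0"
    proof (rule ccontr)
      assume "Q \<noteq> 0"
      hence "lead_coeff Q \<noteq> 0" by (rule leading_coeff_neq_0)
      moreover have "lead_coeff Q = coeff F n * lead_coeff G"
        unfolding G lead_coeff_mult F(1) ..
      ultimately have "lead_coeff Q = coeff F n * lead_coeff G" "lead_coeff Q \<noteq> 0" by blast+
      hence "degree (lead_coeff Q) = n + degree (lead_coeff G)"
        using F by (metis degree_mult_eq mult_eq_0_iff)
      thus False using degQ[of "degree Q"] by simp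
    qed
    show "P = 0"
    proof (rule poly_eqI)
      fix i show "coeff P i = coeff 0 i"
      proof (cases "i \<le> degree P")
        case True
        have "coeff (coeff P i) j = coeff (coeff Q j) i" for j
          using True unfolding coeffQ by (simp add: coeff_sum sum.delta)
        thus ?thesis using \<open>Q = 0\<close> by (simp add: poly_eq_iff)
      qed (simp add: coeff_eq_0)
    qed
  qed (use n ab in auto)
qed

lemma card_le_of_unique:
  assumes "finite P" "\<And>v. v \<in> R \<Longrightarrow> \<exists>p\<in>P. rel v p"
    and "\<And>v w p. v \<in> R \<Longrightarrow> w \<in> R \<Longrightarrow> p \<in> P \<Longrightarrow> rel v p \<Longrightarrow> rel w p \<Longrightarrow> v = w"
  shows "card R \<le> card P"
proof -
  obtain f where f: "\<And>v. v \<in> R \<Longrightarrow> f v \<in> P \<and> rel v (f v)" using assms(2) by metis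
  have "inj_on f R" using f assms(3) by (intro inj_onI) metis
  thus ?thesis using f assms(1) by (intro card_inj_on_le[of f]) auto
qed

section \<open>Counting rational points\<close>

context kummer_curve begin

lemma rational_point_place: "V \<in> rational_points \<iota> K \<Longrightarrow> place \<iota> K V"
  by unfold_locales (auto simp: rational_points_def intro: adjoin2_mult adjoin2_inverse)

lemma rational_point_residue:
  "V \<in> rational_points \<iota> K \<Longrightarrow> z \<in> V \<Longrightarrow> \<exists>c. z - \<iota> c \<in> maximal_ideal_of V"
  by (auto simp: rational_points_def)

lemma xy_mem_K: "x \<in> K" "y \<in> K"
  by (auto intro: adjoin_ring_subset adjoin_ring_gens)

text \<open>For \<open>u = inverse x\<close> the curve equation divided by \<open>x ^ n\<close>
  reads \<open>\<iota> a * y ^ n - 1 = (y ^ n - \<iota> b) * u ^ n\<close>. If \<open>y\<close> had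
  a pole as well, a further division by \<open>y ^ n\<close> would put the nonzero constant
  \<open>\<iota> a\<close> into the maximal ideal.\<close>

lemma infinite_place_residue:
  assumes V: "V \<in> rational_points \<iota> K" and x: "x \<notin> V"
  shows "\<exists>d. a * d ^ n = 1 \<and> inverse x \<in> maximal_ideal_of V \<and> y - \<iota> d \<in> maximal_ideal_of V"
proof -
  interpret V: place \<iota> K V by (rule rational_point_place[OF V])
  define u where "u = inverse x"
  have u: "u \<in> V.M" unfolding u_def by (rule V.inverse_M[OF xy_mem_K(1) x])
  have pow: "z ^ k \<in> V" if "z \<in> V" for z k
    using that by (induction k) (auto intro: V.one_mem V.mult_mem)
  have powM: "z ^ n \<in> V.M" if "z \<in> V.M" for z
  proof -
    have "z ^ n = z ^ (n - 1) * z" using n by (cases n) auto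
    thus ?thesis using V.M_mult[OF pow[OF V.M_subset[OF that]] that] by simp
  qed
  have xu: "x ^ n * u ^ n = 1" using xy_nonzero by (simp add: u_def flip: power_mult_distrib)
  have "(\<iota> a * x ^ n * y ^ n - x ^ n - y ^ n + \<iota> b) * u ^ n = 0" using relation by simp
  also have "(\<iota> a * x ^ n * y ^ n - x ^ n - y ^ n + \<iota> b) * u ^ n =
      (x ^ n * u ^ n) * (\<iota> a * y ^ n) - x ^ n * u ^ n - y ^ n * u ^ n + \<iota> b * u ^ n"
    by (simp add: algebra_simps)
  finally have rel: "\<iota> a * y ^ n - 1 = (y ^ n - \<iota> b) * u ^ n" unfolding xu by (simp add: algebra_simps)
  have y: "y \<in> V"
  proof (rule ccontr)
    assume y: "y \<notin> V"
    define w where "w = inverse y"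
    have w: "w \<in> V.M" unfolding w_def by (rule V.inverse_M[OF xy_mem_K(2) y])
    have yw: "y ^ n * w ^ n = 1" using xy_nonzero by (simp add: w_def flip: power_mult_distrib)
    have "(\<iota> a * y ^ n - 1) * w ^ n = (y ^ n - \<iota> b) * u ^ n * w ^ n" unfolding rel ..
    hence "\<iota> a * (y ^ n * w ^ n) = w ^ n + (y ^ n * w ^ n) * u ^ n - \<iota> b * w ^ n * u ^ n"
      by (simp add: algebra_simps)
    hence "\<iota> a = w ^ n + u ^ n + - ((\<iota> b * w ^ n) * u ^ n)" unfolding yw by simp
    also have "\<dots> \<in> V.M"
      by (intro V.M_add V.M_uminus V.M_mult V.mult_mem V.const_mem powM u w V.M_subset[OF powM[OF w]])
    finally show False using V.const_M ab by simp
  qed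
  then obtain d where d: "y - \<iota> d \<in> V.M" using rational_point_residue[OF V] by blast
  have dn: "y ^ n - \<iota> (d ^ n) \<in> V.M"
    using V.local_ring_residue[OF local_ring_power[OF local_ring.fst] d d] by simp
  have "\<iota> a * y ^ n - 1 \<in> V.M" unfolding rel
    by (intro V.M_mult powM u V.diff_mem V.const_mem pow y)
  hence "\<iota> a * y ^ n - \<iota> 1 \<in> V.M" by simp
  moreover have "\<iota> a * y ^ n - \<iota> (a * d ^ n) \<in> V.M"
    by (intro V.residue_mult V.residue_const dn)
  ultimately have "a * d ^ n = 1" using V.residue_unique by blast
  thus ?thesis using u d by (auto simp: u_def)
qed

lemma card_rational_points_infinite:
  assumes "finite (UNIV :: 'k set)"
  shows "card {V \<in> rational_points \<iota> K. x \<notin> V} \<le> card {d. d ^ n = inverse a}"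
proof (rule card_le_of_unique[where rel = "\<lambda>V d. inverse x \<in> maximal_ideal_of V \<and> y - \<iota> d \<in> maximal_ideal_of V"])
  have eq: "a * d ^ n = 1 \<longleftrightarrow> d ^ n = inverse a" for d using ab by (auto simp: field_simps)
  show "finite {d. d ^ n = inverse a}" by (rule finite_subset[OF subset_UNIV assms])
  show "\<exists>d\<in>{d. d ^ n = inverse a}. inverse x \<in> maximal_ideal_of V \<and> y - \<iota> d \<in> maximal_ideal_of V"
    if "V \<in> {V \<in> rational_points \<iota> K. x \<notin> V}" for V
    using infinite_place_residue[of V] that eq by blast
  show "V = W" if "V \<in> {V \<in> rational_points \<iota> K. x \<notin> V}" "W \<in> {V \<in> rational_points \<iota> K. x \<notin> V}"
    "d \<in> {d. d ^ n = inverse a}" "inverse x \<in> maximal_ideal_of V \<and> y - \<iota> d \<in> maximal_ideal_of V"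
    "inverse x \<in> maximal_ideal_of W \<and> y - \<iota> d \<in> maximal_ideal_of W" for V W d
    using that eq infinite_place_unique[OF _ rational_point_place rational_point_place] by blast
qed

lemma card_rational_points_affine:
  assumes "finite (UNIV :: 'k set)"
  shows "card {V \<in> rational_points \<iota> K. x \<in> V \<and> y \<in> V}
    \<le> card {(c, d). a * c ^ n * d ^ n - c ^ n - d ^ n + b = 0}"
proof (rule card_le_of_unique[where rel = "\<lambda>V (c, d). x - \<iota> c \<in> maximal_ideal_of V \<and> y - \<iota> d \<in> maximal_ideal_of V"])
  interpret s: kummer_curve \<iota> y x a b n by (rule swap)
  have sK: "s.K = K" by (rule adjoin2_swap)
  show "finite {(c, d). a * c ^ n * d ^ n - c ^ n - d ^ n + b = 0}"
    by (rule finite_subset[OF subset_UNIV]) (simp add: finite_prod assms)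
  show "\<exists>p\<in>{(c, d). a * c ^ n * d ^ n - c ^ n - d ^ n + b = 0}.
      case p of (c, d) \<Rightarrow> x - \<iota> c \<in> maximal_ideal_of V \<and> y - \<iota> d \<in> maximal_ideal_of V"
    if V: "V \<in> {V \<in> rational_points \<iota> K. x \<in> V \<and> y \<in> V}" for V
  proof -
    obtain c d where "x - \<iota> c \<in> maximal_ideal_of V" "y - \<iota> d \<in> maximal_ideal_of V"
      using rational_point_residue[of V] V by blast
    thus ?thesis using residue_relation[OF rational_point_place] V by blast
  qed
  fix V W p
  assume V: "V \<in> {V \<in> rational_points \<iota> K. x \<in> V \<and> y \<in> V}"
    and W: "W \<in> {V \<in> rational_points \<iota> K. x \<in> V \<and> y \<in> V}"
    and p: "p \<in> {(c, d). a * c ^ n * d ^ n - c ^ n - d ^ n + b = 0}"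
    and rel: "case p of (c, d) \<Rightarrow> x - \<iota> c \<in> maximal_ideal_of V \<and> y - \<iota> d \<in> maximal_ideal_of V"
      "case p of (c, d) \<Rightarrow> x - \<iota> c \<in> maximal_ideal_of W \<and> y - \<iota> d \<in> maximal_ideal_of W"
  obtain c d where cd: "p = (c, d)" by fastforce
  have pl: "place \<iota> K V" "place \<iota> K W" using V W rational_point_place by auto
  show "V = W"
  proof (cases "d = 0")
    case False
    show ?thesis by (rule affine_place_unique[OF False pl]) (use rel in \<open>auto simp: cd\<close>)
  next
    case True
    \<comment> \<open>\<open>d = 0\<close> gives \<open>c ^ n = b\<close>, so the roles of
      \<open>x\<close> and \<open>y\<close> can be exchanged.\<close>
    hence "c \<noteq> 0" using p ab n by (auto simp: cd power_0_left)
    show ?thesis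
      by (rule s.affine_place_unique[OF \<open>c \<noteq> 0\<close>, unfolded sK, OF pl])
        (use rel in \<open>auto simp: cd\<close>)
  qed
qed

end

text \<open>Four kinds of points lie outside the good values: x = 0 or y = 0, where the other
  coordinate is an n-th root of \<open>b\<close>, and the poles of x or of y, where the other one is
  an n-th root of \<open>1 / a\<close>. Each kind has at most as many points as there are such
  roots, whence the factors 2.\<close>

theorem card_rational_points_le:
  fixes \<iota> :: "'k::{field,finite} \<Rightarrow> 'a::field"
  assumes "kummer_curve \<iota> x y a b n" and q: "CARD('k) = n * m + 1"
  shows "card (rational_points \<iota> (adjoin2 \<iota> x y)) \<le> n\<^sup>2 * card (kummer.good_values a b m)
    + 2 * card {c. c ^ n = b} + 2 * card {c. c ^ n = inverse a}"
proof -
  interpret kummer_curve \<iota> x y a b n by fact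
  interpret s: kummer_curve \<iota> y x a b n by (rule swap)
  have sK: "s.K = K" by (rule adjoin2_swap)
  define R where "R = rational_points \<iota> K"
  define Z where "Z = good_values m"
  define B where "B = {c. c ^ n = b}"
  define P where "P = {(c, d). a * c ^ n * d ^ n - c ^ n - d ^ n + b = 0}"
  define f where "f t = (t - b) / (a * t - 1)" for t
  have fin: "finite (UNIV :: 'k set)" by simp
  have pow: "c ^ n \<noteq> 0 \<Longrightarrow> (c ^ n) ^ m = 1" for c :: 'k
    using finite_field_power_card[of c] n by (auto simp: q power_mult)
  have "P \<subseteq> {0} \<times> B \<union> B \<times> {0} \<union> (\<Union>t\<in>Z. {c. c ^ n = t} \<times> {d. d ^ n = f t})"
  proof
    fix p assume "p \<in> P"
    then obtain c d where p: "p = (c, d)" and cd: "a * c ^ n * d ^ n - c ^ n - d ^ n + b = 0"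
      by (auto simp: P_def)
    show "p \<in> {0} \<times> B \<union> B \<times> {0} \<union> (\<Union>t\<in>Z. {c. c ^ n = t} \<times> {d. d ^ n = f t})"
    proof (cases "c = 0 \<or> d = 0")
      case True
      thus ?thesis using cd n by (auto simp: p B_def power_0_left)
    next
      case False
      define t where "t = c ^ n"
      have rel: "d ^ n * (a * t - 1) = t - b" using cd by (simp add: t_def algebra_simps)
      have t: "t \<noteq> 0" "a * t \<noteq> 1"
      proof -
        show "t \<noteq> 0" using False by (simp add: t_def)
        show "a * t \<noteq> 1" using rel ab by auto
      qed
      have d: "d ^ n = f t" using rel t by (simp add: f_def field_simps)
      have "d ^ n \<noteq> 0" using False by simp
      hence "t \<noteq> b" "f t ^ m = 1" using d pow[of d] by (auto simp: f_def)
      moreover have "t ^ m = 1" using pow[of c] t by (simp add: t_def)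
      ultimately have "t \<in> Z" using t by (simp add: Z_def good_values_def f_def)
      thus ?thesis using d by (auto simp: p t_def)
    qed
  qed
  hence "card P \<le> card ({0} \<times> B \<union> B \<times> {0} \<union> (\<Union>t\<in>Z. {c. c ^ n = t} \<times> {d. d ^ n = f t}))"
    by (intro card_mono) auto
  also have "\<dots> \<le> card ({0} \<times> B) + card (B \<times> {0::'k}) + (\<Sum>t\<in>Z. card ({c. c ^ n = t} \<times> {d. d ^ n = f t}))"
    by (intro order.trans[OF card_Un_le] add_mono card_UN_le) auto
  also have "(\<Sum>t\<in>Z. card ({c. c ^ n = t} \<times> {d. d ^ n = f t})) \<le> (\<Sum>t\<in>Z. n\<^sup>2)"
    unfolding card_cartesian_product power2_eq_square
    by (intro sum_mono mult_mono card_power_eq_le n) auto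
  finally have P: "card P \<le> n\<^sup>2 * card Z + 2 * card B" by (simp add: mult.commute)
  have "R = {V \<in> R. x \<in> V \<and> y \<in> V} \<union> {V \<in> R. x \<notin> V} \<union> {V \<in> R. y \<notin> V}" by auto
  hence "card R \<le> card {V \<in> R. x \<in> V \<and> y \<in> V} + card {V \<in> R. x \<notin> V} + card {V \<in> R. y \<notin> V}"
    by (metis (no_types, lifting) card_Un_le add_le_mono1 order.trans)
  also have "\<dots> \<le> card P + card {d. d ^ n = inverse a} + card {d. d ^ n = inverse a}"
    using card_rational_points_affine[OF fin] card_rational_points_infinite[OF fin]
      s.card_rational_points_infinite[OF fin]
    unfolding R_def P_def sK by (intro add_mono)
  finally show ?thesis using P by (simp add: R_def Z_def B_def)
qed

section \<open>Hasse derivatives and the bound\<close>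

context kummer_curve begin

text \<open>By the product rule, sending \<open>f\<close> to the series of all \<open>D i f\<close>
  is a ring homomorphism. Applied to the curve equation it yields the relation between the series of
  x and y, which are then divided by x and y to get constant term 1.\<close>

lemma hasse_series:
  assumes D: "hasse_derivatives \<iota> K t D" and t: "t \<in> K"
  obtains A B where "series_relation (\<iota> a) (\<iota> b) n (x ^ n) (y ^ n) A B" "A $ 1 \<noteq> 0"
    "\<And>i j k. D k (x ^ i * y ^ j) = x ^ i * y ^ j * (A ^ i * B ^ j) $ k"
proof
  define T where "T f = Abs_fps (\<lambda>i. D i f)" for f
  have D0: "D 0 f = f" if "f \<in> K" for f
    using D that by (simp add: hasse_derivatives_def)
  have D_mult: "D i (f * g) = (\<Sum>j\<le>i. D j f * D (i - j) g)" if "f \<in> K" "g \<in> K" for f g i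
    using D that by (simp add: hasse_derivatives_def)
  have D_add: "D i (f + g) = D i f + D i g" if "f \<in> K" "g \<in> K" for f g i
    using D that by (simp add: hasse_derivatives_def)
  have D_const: "D i (\<iota> c * f) = \<iota> c * D i f" if "f \<in> K" for f i c
    using D that by (simp add: hasse_derivatives_def)
  have D_t: "D i (t ^ m) = of_nat (m choose i) * t ^ (m - i)" for i m
    using D by (simp add: hasse_derivatives_def)
  have ring: "f \<in> K" if "f \<in> adjoin_ring x y" for f
    by (rule adjoin_ring_subset[OF that])
  have const: "\<iota> c \<in> K" for c by (intro ring adjoin_ring_gens)
  have one: "1 \<in> K" using const[of 1] by simp
  have pow: "f ^ k \<in> K" if "f \<in> K" for f k
    by (induction k) (auto intro: one adjoin2_mult that)
  have T_mult: "T (f * g) = T f * T g" if "f \<in> K" "g \<in> K" for f g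
    by (rule fps_ext) (simp add: T_def D_mult[OF that] fps_mult_nth atMost_atLeast0)
  have T_add: "T (f + g) = T f + T g" if "f \<in> K" "g \<in> K" for f g
    by (rule fps_ext) (simp add: T_def D_add[OF that])
  have T_1: "T 1 = 1"
    using D_t[of _ 0] by (intro fps_ext) (simp add: T_def binomial_eq_0)
  have T_const: "T (\<iota> c) = fps_const (\<iota> c)" for c
  proof (rule fps_ext)
    fix i
    have "D i (\<iota> c * 1) = \<iota> c * D i 1" by (rule D_const[OF one])
    moreover have "D i 1 = (if i = 0 then 1 else 0)"
      using arg_cong[OF T_1, of "\<lambda>f. f $ i"] by (simp add: T_def)
    ultimately show "T (\<iota> c) $ i = fps_const (\<iota> c) $ i" by (auto simp: T_def)
  qed
  have T_power: "T (f ^ k) = T f ^ k" if "f \<in> K" for f k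
    by (induction k) (simp_all add: T_1 T_mult that pow)
  define A where "A = fps_const (inverse x) * T x"
  define B where "B = fps_const (inverse y) * T y"
  have Tx: "T x = fps_const x * A" and Ty: "T y = fps_const y * B"
    using xy_nonzero by (simp_all add: A_def B_def flip: mult.assoc)
  have Txn: "T (x ^ k) = fps_const (x ^ k) * A ^ k" and Tyn: "T (y ^ k) = fps_const (y ^ k) * B ^ k" for k
    by (simp_all add: T_power xy_mem_K Tx Ty power_mult_distrib fps_const_power)
  have "T (\<iota> a * x ^ n * y ^ n + \<iota> b) = T (x ^ n + y ^ n)"
    using relation by (simp add: algebra_simps)
  hence "fps_const (\<iota> a) * (fps_const (x ^ n) * A ^ n) * (fps_const (y ^ n) * B ^ n) + fps_const (\<iota> b)
      = fps_const (x ^ n) * A ^ n + fps_const (y ^ n) * B ^ n"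
    by (simp only: T_add T_mult T_const Txn Tyn adjoin2_mult const pow xy_mem_K)
  moreover have "fps_const (\<iota> a * x ^ n * y ^ n) * A ^ n * B ^ n =
      fps_const (\<iota> a) * (fps_const (x ^ n) * A ^ n) * (fps_const (y ^ n) * B ^ n)"
    unfolding fps_const_mult[symmetric] by (simp only: mult_ac)
  ultimately have rel: "fps_const (\<iota> a * x ^ n * y ^ n) * A ^ n * B ^ n - fps_const (x ^ n) * A ^ n
      - fps_const (y ^ n) * B ^ n + fps_const (\<iota> b) = 0"
    by (metis (no_types, lifting) add_diff_cancel_left' cancel_comm_monoid_add_class.diff_cancel
        diff_add_eq diff_diff_add)
  have AB0: "A $ 0 = 1" "B $ 0 = 1"
    using xy_nonzero D0[OF xy_mem_K(1)] D0[OF xy_mem_K(2)] by (simp_all add: A_def B_def T_def)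
  show rel': "series_relation (\<iota> a) (\<iota> b) n (x ^ n) (y ^ n) A B"
    unfolding series_relation_def using rel AB0 by blast
  show "D k (x ^ i * y ^ j) = x ^ i * y ^ j * (A ^ i * B ^ j) $ k" for i j k
  proof -
    have "T (x ^ i * y ^ j) = fps_const (x ^ i * y ^ j) * (A ^ i * B ^ j)"
      unfolding T_mult[OF pow[OF xy_mem_K(1)] pow[OF xy_mem_K(2)]] Txn Tyn fps_const_mult[symmetric]
      by (simp only: mult_ac)
    from arg_cong[OF this, of "\<lambda>f. f $ k"] show ?thesis by (simp add: T_def)
  qed
  \<comment> \<open>If \<open>A $ 1\<close> were 0, so would be \<open>B $ 1\<close>, and the
    derivation \<open>D 1\<close> would vanish on x and y, hence on every quotient of polynomials in
    them, in particular on \<open>t\<close>. But \<open>D 1 t = 1\<close>.\<close>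
  show "A $ 1 \<noteq> 0"
  proof
    assume A1: "A $ 1 = 0"
    have n': "of_nat n \<noteq> (0::'a)" using n by (metis hom_of_nat hom_0_iff)
    have "(x ^ n - \<iota> b) * B $ 1 = 0"
      using series_relation_nth_1[OF rel' n'] A1 by simp
    hence B1: "B $ 1 = 0" using X_minus_const_nonzero[of b] by simp
    have Dx: "D 1 x = 0" and Dy: "D 1 y = 0"
      using arg_cong[OF Tx, of "\<lambda>f. f $ 1"] arg_cong[OF Ty, of "\<lambda>f. f $ 1"] A1 B1
      by (simp_all add: T_def)
    have D1_mult: "D 1 (f * g) = f * D 1 g + D 1 f * g" if "f \<in> K" "g \<in> K" for f g
      using D_mult[OF that, of 1] D0 that by (simp add: atMost_Suc add.commute)
    have D1: "D 1 f = 0" if "f \<in> adjoin_ring x y" for f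
    proof -
      have "f \<in> adjoin_ring x y \<and> D 1 f = 0" using that
      proof (induction rule: adjoin_ring_induct)
        case (const c)
        show ?case using arg_cong[OF T_const[of c], of "\<lambda>f. f $ 1"] adjoin_ring_gens(1)
          by (simp add: T_def)
      next
        case (add z w)
        thus ?case using D_add[OF ring ring, of z w 1] by (simp add: adjoin_ring_add)
      next
        case (mult z w)
        thus ?case using D1_mult[OF ring ring, of z w] by (simp add: adjoin_ring_mult)
      qed (use Dx Dy in \<open>simp_all add: adjoin_ring_gens\<close>)
      thus ?thesis by simp
    qed
    obtain f g where fg: "t = f / g" "f \<in> adjoin_ring x y" "g \<in> adjoin_ring x y" "g \<noteq> 0"
      using t unfolding adjoin2_eq by blast
    have "D 1 (t * g) = D 1 t * g" using D1_mult[OF t ring[OF fg(3)]] D1[OF fg(3)] by simp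
    moreover have "t * g = f" using fg by simp
    ultimately have "D 1 t = 0" using D1[OF fg(2)] fg(4) by simp
    thus False using D_t[of 1 1] by simp
  qed
qed

end

section \<open>Counting exponents\<close>

lemma concat_map_product:
  "concat (map (\<lambda>i. concat (map (\<lambda>j. if P i j then [f i j] else []) ys)) xs) =
    map (\<lambda>(i, j). f i j) (filter (\<lambda>(i, j). P i j) (List.product xs ys))"
proof -
  have "concat (map (\<lambda>j. if P i j then [f i j] else []) ys) =
      map (\<lambda>(i, j). f i j) (filter (\<lambda>(i, j). P i j) (map (Pair i) ys))" for i
    by (induction ys) auto
  thus ?thesis by (induction xs) auto
qed

definition exponent_list :: "nat \<Rightarrow> (nat \<times> nat) list" where
  "exponent_list s = filter (\<lambda>(i, j). i + j \<le> s) (List.product [0..<s] [0..<s])"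

lemma exponent_list: "distinct (exponent_list s)" "set (exponent_list s) = exponents s"
  by (auto simp: exponent_list_def exponents_def distinct_product)

lemma series_coords_eq: "series_coords x y s = map (\<lambda>(i, j). x ^ i * y ^ j) (exponent_list s)"
  unfolding series_coords_def exponent_list_def concat_map_product[symmetric] by simp

text \<open>The exponent set is the triangle \<open>i + j \<le> s\<close> without the corners (s, 0)
  and (0, s). Line \<open>j\<close> of the triangle has \<open>s + 1 - j\<close> entries, and the
  corners account for \<open>h 0\<close> and \<open>h s\<close>.\<close>

lemma sum_exponents:
  fixes h :: "nat \<Rightarrow> int"
  assumes "2 \<le> s"
  shows "(\<Sum>(i, j)\<in>exponents s. h j) = (\<Sum>j\<le>s. (int s + 1 - int j) * h j) - h 0 - h s"
proof -
  define F where "F = (SIGMA j:{..s}. {..s - j})"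
  have fin: "finite F" by (simp add: F_def)
  have ex: "prod.swap ` exponents s = F - {(0, s), (s, 0)}"
    by (force simp: F_def exponents_def image_iff)
  have sub: "{(0, s), (s, 0)} \<subseteq> F" by (auto simp: F_def)
  have "(\<Sum>(i, j)\<in>exponents s. h j) = (\<Sum>p\<in>prod.swap ` exponents s. h (fst p))"
    by (subst sum.reindex) (auto simp: split_beta)
  also have "\<dots> = (\<Sum>p\<in>F. h (fst p)) - (\<Sum>p\<in>{(0, s), (s, 0)}. h (fst p))"
    unfolding ex by (rule sum_diff[OF fin sub])
  also have "(\<Sum>p\<in>{(0, s), (s, 0)}. h (fst p)) = h 0 + h s" using assms by simp
  also have "(\<Sum>p\<in>F. h (fst p)) = (\<Sum>j\<le>s. \<Sum>i\<le>s - j. h j)"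
    unfolding F_def by (subst sum.Sigma) (auto simp: split_beta)
  also have "\<dots> = (\<Sum>j\<le>s. (int s + 1 - int j) * h j)"
    by (intro sum.cong) (auto simp: of_nat_diff)
  finally show ?thesis by simp
qed

lemma card_exponents:
  assumes "2 \<le> s"
  shows "2 * int (card (exponents s)) = (int s + 1) * (int s + 2) - 4"
proof -
  have "2 * (\<Sum>j\<le>k. int s + 1 - int j) = (int k + 1) * (2 * int s + 2 - int k)" for k
    by (induction k) (auto simp: algebra_simps)
  from this[of s] show ?thesis using sum_exponents[OF assms, of "\<lambda>_. 1"]
    by (simp add: split_beta algebra_simps)
qed

lemma weight_eq:
  assumes "2 \<le> s"
  shows "6 * weight s = int s * (int s + 1) * (int s + 2) - 6 * int s"
proof -
  have "6 * (\<Sum>j\<le>k. (int s + 1 - int j) * int j) = int k * (int k + 1) * (3 * int s + 2 - 2 * int k)" for k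
    by (induction k) (auto simp: algebra_simps)
  from this[of s] show ?thesis using sum_exponents[OF assms, of int]
    by (simp add: weight_def algebra_simps)
qed

text \<open>As \<open>q = n * m + 1\<close>, the q-th power of x ^ i y ^ j is x ^ i y ^ j times a
  monomial in \<open>(x ^ n) ^ m\<close> and \<open>(y ^ n) ^ m\<close>. So row 0 and the derivative
  rows share the factor x ^ i y ^ j in each column.\<close>

lemma frobenius_matrix_eq:
  assumes ps: "length ps = Suc N"
    and D: "\<And>i j k. D k (x ^ i * y ^ j) = x ^ i * y ^ j * (A ^ i * B ^ j) $ k"
    and q: "q = n * m + 1"
  shows "frobenius_matrix q D (map (\<lambda>(i, j). x ^ i * y ^ j) ps) [0..<N] =
    frobenius_fps_matrix
      (\<lambda>c. (case ps ! c of (i, j) \<Rightarrow> x ^ i * y ^ j) *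
        (case ps ! c of (i, j) \<Rightarrow> ((x ^ n) ^ m) ^ i * ((y ^ n) ^ m) ^ j))
      (\<lambda>c. fps_const (case ps ! c of (i, j) \<Rightarrow> x ^ i * y ^ j) *
        (case ps ! c of (i, j) \<Rightarrow> A ^ i * B ^ j)) N"
  unfolding frobenius_matrix_def frobenius_fps_matrix_def length_map ps
proof (rule cong_mat)
  fix r c assume rc: "r < Suc N" "c < Suc N"
  obtain i j where c: "ps ! c = (i, j)" by fastforce
  have "(x ^ i * y ^ j) ^ q = x ^ i * y ^ j * (((x ^ n) ^ m) ^ i * ((y ^ n) ^ m) ^ j)"
    by (simp add: q power_mult_distrib power_add mult_ac flip: power_mult)
  thus "(case (r, c) of (r, c) \<Rightarrow> case r of 0 \<Rightarrow> map (\<lambda>(i, j). x ^ i * y ^ j) ps ! c ^ q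
        | Suc i \<Rightarrow> D ([0..<N] ! i) (map (\<lambda>(i, j). x ^ i * y ^ j) ps ! c)) =
      (case (r, c) of (r, c) \<Rightarrow> case r of
        0 \<Rightarrow> (case ps ! c of (i, j) \<Rightarrow> x ^ i * y ^ j) *
          (case ps ! c of (i, j) \<Rightarrow> ((x ^ n) ^ m) ^ i * ((y ^ n) ^ m) ^ j)
        | Suc i \<Rightarrow> (fps_const (case ps ! c of (i, j) \<Rightarrow> x ^ i * y ^ j) *
          (case ps ! c of (i, j) \<Rightarrow> A ^ i * B ^ j)) $ i)"
    using rc ps by (cases r) (simp_all add: c D)
qed simp_all

text \<open>Frobenius classicality enters through one fact: for some \<open>t\<close> and its Hasse
  derivatives, the determinant with orders 0, ..., N - 1 is nonzero.\<close>

theorem card_good_values_le: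
  fixes \<iota> :: "'k::{field,finite} \<Rightarrow> 'a::field"
  assumes "kummer_curve \<iota> x y a b n" and q: "CARD('k) = n * m + 1" "0 < m" and s: "2 \<le> s"
    and N: "card (exponents s) = Suc N" "2 \<le> N"
    and cl: "frobenius_classical \<iota> (adjoin2 \<iota> x y) (series_coords x y s)"
  shows "int N * int (card (kummer.good_values a b m)) + 4 * weight s \<le> 2 * int (\<Sum>i<N. i)
    + 2 * (if b ^ m = 1 then 0 else int s - 1) + 2 * (int s - 1) * int m
    + 2 * (if a ^ m = 1 then 0 else 1)"
proof -
  interpret kummer_curve \<iota> x y a b n by fact
  define ps where "ps = exponent_list s"
  have ps: "distinct ps" "set ps = exponents s"
    by (simp_all add: ps_def exponent_list)
  have len: "length ps = Suc N" using distinct_card[OF ps(1)] ps(2) N(1) by simp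
  have coords: "series_coords x y s = map (\<lambda>(i, j). x ^ i * y ^ j) ps"
    unfolding ps_def by (rule series_coords_eq)
  obtain t D where t: "t \<in> K" and D: "hasse_derivatives \<iota> K t D"
    and adm: "[0..<N] \<in> frobenius_admissible CARD('k) D (series_coords x y s)"
    using cl unfolding frobenius_classical_def frobenius_order_sequence_def
    by (auto simp: coords len separating_variable_def)
  obtain A B where AB: "series_relation (\<iota> a) (\<iota> b) n (x ^ n) (y ^ n) A B" "A $ 1 \<noteq> 0"
    "\<And>i j k. D k (x ^ i * y ^ j) = x ^ i * y ^ j * (A ^ i * B ^ j) $ k"
    using hasse_series[OF D t] by metis
  have "det (frobenius_matrix CARD('k) D (series_coords x y s) [0..<N]) \<noteq> 0"
    using adm by (auto simp: frobenius_admissible_def)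
  hence "det (monomial_matrix ps ((x ^ n) ^ m) ((y ^ n) ^ m) A B) \<noteq> 0"
    unfolding coords frobenius_matrix_eq[OF len AB(3) q(1)] det_frobenius_fps_matrix_scale
    by (simp add: monomial_matrix_def len)
  \<comment> \<open>The curve equation is raised to the q-th power; Frobenius is additive and fixes
    the constants from k.\<close>
  moreover have "\<iota> a * (x ^ n) ^ (n * m + 1) * (y ^ n) ^ (n * m + 1)
      - (x ^ n) ^ (n * m + 1) - (y ^ n) ^ (n * m + 1) + \<iota> b = 0"
  proof -
    have hom: "field_hom \<iota>" by unfold_locales
    have c: "\<iota> c ^ CARD('k) = \<iota> c" for c
    proof (cases "c = 0")
      case False
      have "c ^ CARD('k) = c * c ^ (CARD('k) - 1)" by (simp add: q(1))
      thus ?thesis using finite_field_power_card[OF False] by (simp flip: hom_power)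
    qed simp
    have "(\<iota> a * x ^ n * y ^ n + \<iota> b) ^ CARD('k) = (x ^ n + y ^ n) ^ CARD('k)"
      using relation by (simp add: algebra_simps)
    hence "\<iota> a * (x ^ n) ^ CARD('k) * (y ^ n) ^ CARD('k) + \<iota> b = (x ^ n) ^ CARD('k) + (y ^ n) ^ CARD('k)"
      unfolding power_card_add[OF hom] power_mult_distrib c .
    thus ?thesis unfolding q(1) by (simp add: algebra_simps)
  qed
  ultimately show ?thesis
    by (intro card_good_values_bound[OF AB(1) n(2) q(2) _ AB(2) ps len N(2)]) auto
qed

theorem corollary3p3:
  fixes \<iota> :: "'k::{field,finite} \<Rightarrow> 'a::field"
    and a b :: 'k and x y :: 'a and n s q N \<delta> n\<^sub>1 n\<^sub>2 :: nat and \<alpha> \<beta> \<gamma> :: real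
  assumes "q = CARD('k)"
    and "n dvd q - 1"
    and "a * b \<notin> {0, 1}"
    and "generic_point \<iota> (curve_poly a b n) x y"
    and "s \<in> {2..n - 1}"
    and "N = (s + 2 choose 2) - 3"
    and "\<delta> = 2 * n * (s - 1)"
    and "frobenius_classical \<iota> (adjoin2 \<iota> x y) (series_coords x y s)"
    and "n\<^sub>1 = card {c :: 'k. poly (monom 1 n - [:b:]) c = 0}"
    and "n\<^sub>2 = card {c :: 'k. poly (monom 1 n - [:inverse a:]) c = 0}"
    and "\<alpha> = 1 + (real s - 1) * real n - real N"
    and "\<beta> = (real s - 1) * (real n + 1) - real N"
    and "\<gamma> = 2 * (real n + 1) - real s * (4 * real n + 3) - real N * (real N - 1)
              + (real s * (2 * real n + 3) - 3) * ((real N + 3) / 3)"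
  shows "real (card (rational_points \<iota> (adjoin2 \<iota> x y)))
    \<le> (real N - 1) * (real n ^ 2 - 2 * real n) + real \<delta> * (real q + real N) / real N
      - 2 * ((real n\<^sub>1 * \<alpha> + real n\<^sub>2 * \<beta> + real n * \<gamma>) / real N)"
proof -
  have s: "2 \<le> s" "s < n" using assms(5) by auto
  have n: "0 < n" using s by simp
  obtain m where "q - 1 = n * m" using assms(2) by (elim dvdE)
  moreover have "2 \<le> CARD('k)" using card_mono[of UNIV "{0, 1 :: 'k}"] by simp
  ultimately have q: "CARD('k) = n * m + 1" "0 < m"
    using assms(1) by (auto intro: Nat.gr0I)
  \<comment> \<open>\<open>q\<close> is 0 in k, so \<open>n * m = - 1\<close> there and
    \<open>n\<close> is invertible.\<close>
  have "of_nat n * of_nat m + 1 = (0::'k)"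
    using of_nat_card_eq_0[where 'k = 'k] unfolding q(1) by (simp add: add.commute)
  hence n': "of_nat n \<noteq> (0::'k)" by auto
  have ab: "a \<noteq> 0" "b \<noteq> 0" "a * b \<noteq> 1" using assms(3) by auto
  have curve: "kummer_curve \<iota> x y a b n"
    by (rule generic_point_kummer_curve[OF assms(4) n n' ab])
  define C where "C = (s + 2 choose 2)"
  have C: "C * 2 = (s + 2) * (s + 1)" by (simp add: C_def choose_two)
  \<comment> \<open>This gives \<open>6 \<le> C\<close>, so the natural subtraction
    \<open>C - 3\<close> that defines \<open>N\<close> is a true one and \<open>N\<close> is at
    least 3.\<close>
  moreover have "12 \<le> (s + 2) * (s + 1)"
    using mult_le_mono[of 4 "s + 2" 3 "s + 1"] s by simp
  ultimately have C6: "6 \<le> C" by linarith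
  have "int (C * 2) = int ((s + 2) * (s + 1))" unfolding C ..
  hence "2 * int C = (int s + 1) * (int s + 2)" by (simp add: algebra_simps)
  moreover have "int N = int C - 3" using assms(6) C6 by (simp add: C_def)
  ultimately have N2: "2 * int N = (int s + 1) * (int s + 2) - 6" by simp
  have N3: "3 \<le> N" using assms(6) C6 by (simp add: C_def)
  have ex: "card (exponents s) = Suc N" using card_exponents[OF s(1)] N2 by simp
  define z where "z = card (kummer.good_values a b m)"
  define \<epsilon> :: real where "\<epsilon> = (if b ^ m = 1 then 0 else real s - 1)"
  define \<eta> :: real where "\<eta> = (if a ^ m = 1 then 0 else 1)"
  have pow: "c ^ m = 1" if "d ^ n = c" "c \<noteq> 0" for c d :: 'k
    using finite_field_power_card[of d] that n by (auto simp: q power_mult)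
  have n1: "n\<^sub>1 = card {c. c ^ n = b}" and n2: "n\<^sub>2 = card {c. c ^ n = inverse a}"
    using assms(9,10) by (simp_all add: poly_monom)
  have le1: "real n\<^sub>1 \<le> real n" "real n\<^sub>2 \<le> real n"
    unfolding n1 n2 by (simp_all add: card_power_eq_le n)
  \<comment> \<open>If \<open>b\<close> has an n-th root, then \<open>b ^ m = 1\<close> and there is
    no defect; otherwise \<open>n\<^sub>1\<close> is 0. The same alternative holds for
    \<open>1 / a\<close>.\<close>
  have eps: "n\<^sub>1 = 0 \<and> \<epsilon> \<le> real s - 1 \<or> \<epsilon> = 0"
  proof (cases "\<exists>c. c ^ n = b")
    case True
    thus ?thesis using pow ab by (auto simp: \<epsilon>_def)
  qed (use s in \<open>simp add: n1 \<epsilon>_def\<close>)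
  have eta: "n\<^sub>2 = 0 \<and> \<eta> \<le> 1 \<or> \<eta> = 0"
  proof (cases "\<exists>c. c ^ n = inverse a")
    case True
    hence "inverse a ^ m = 1" using pow[of _ "inverse a"] ab by auto
    thus ?thesis by (simp add: \<eta>_def power_inverse)
  qed (simp add: n2 \<eta>_def)
  have T: "2 * real (\<Sum>i<N. i) = real N * (real N - 1)" for N
    by (induction N) (simp_all add: algebra_simps)
  have "real_of_int (int N * int z + 4 * weight s) \<le> real_of_int (2 * int (\<Sum>i<N. i)
      + 2 * (if b ^ m = 1 then 0 else int s - 1) + 2 * (int s - 1) * int m
      + 2 * (if a ^ m = 1 then 0 else 1))"
    unfolding of_int_le_iff z_def
    by (rule card_good_values_le[OF curve q s(1) ex _ assms(8)]) (use N3 in simp)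
  hence bound: "real N * real z \<le> real N * (real N - 1) + 2 * \<epsilon> + 2 * (real s - 1) * real m + 2 * \<eta>
      - 4 * real_of_int (weight s)"
    using T[of N] by (simp add: \<epsilon>_def \<eta>_def split: if_splits)
  define R where "R = real (card (rational_points \<iota> (adjoin2 \<iota> x y)))"
  have "R \<le> real (n\<^sup>2 * z + 2 * n\<^sub>1 + 2 * n\<^sub>2)"
    unfolding R_def z_def n1 n2 of_nat_le_iff by (rule card_rational_points_le[OF curve q(1)])
  hence "real N * R \<le> real N * real (n\<^sup>2 * z + 2 * n\<^sub>1 + 2 * n\<^sub>2)" by (rule mult_left_mono) simp
  also have "\<dots> = (real n)\<^sup>2 * (real N * real z) + 2 * real N * (real n\<^sub>1 + real n\<^sub>2)"
    by (simp add: algebra_simps)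
  also have "\<dots> \<le> (real n)\<^sup>2 * (real N * (real N - 1) + 2 * \<epsilon> + 2 * (real s - 1) * real m + 2 * \<eta>
      - 4 * real_of_int (weight s)) + 2 * real N * (real n\<^sub>1 + real n\<^sub>2)"
    using bound by (intro add_right_mono mult_left_mono) auto
  also have "\<dots> \<le> real N * (real N - 1) * ((real n)\<^sup>2 - 2 * real n) + real \<delta> * (real q + real N)
      - 2 * (real n\<^sub>1 * \<alpha> + real n\<^sub>2 * \<beta> + real n * \<gamma>)"
  proof -
    have w: "real_of_int (weight s) = real s * (real N + 3) / 3 - real s"
    proof -
      have "real_of_int (6 * weight s) = real_of_int (int s * (int s + 1) * (int s + 2) - 6 * int s)"
        unfolding weight_eq[OF s(1)] ..
      moreover have "real_of_int (2 * int N) = real_of_int ((int s + 1) * (int s + 2) - 6)"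
        unfolding N2 ..
      hence "2 * (real N + 3) = (real s + 1) * (real s + 2)" by (simp add: algebra_simps)
      hence "real s * (2 * (real N + 3)) = real s * ((real s + 1) * (real s + 2))" by simp
      ultimately show ?thesis by (simp add: algebra_simps)
    qed
    have qr: "real q = real n * real m + 1" using q(1) assms(1) by simp
    have \<delta>: "real \<delta> = 2 * real n * (real s - 1)" using assms(7) s by (simp add: of_nat_diff)
    \<comment> \<open>The right side minus the left side is twice the sum of this quantity and the
      next one. The factors \<open>1 + (s - 1) * n\<close> and \<open>(s - 1) * (n + 1)\<close> are
      \<open>\<alpha> + N\<close> and \<open>\<beta> + N\<close>, where \<open>N\<close> comes from
      \<open>2 * N * (n\<^sub>1 + n\<^sub>2)\<close> on the left; \<gamma> makes all remaining terms
      cancel.\<close>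
    have "0 \<le> (real n - real n\<^sub>1) * (1 + (real s - 1) * real n) - (real n)\<^sup>2 * \<epsilon>"
    proof (cases "\<epsilon> = 0")
      case True
      thus ?thesis using le1 s by simp
    next
      case False
      hence e: "n\<^sub>1 = 0" "\<epsilon> \<le> real s - 1" using eps by auto
      have "(real n)\<^sup>2 * \<epsilon> \<le> (real n)\<^sup>2 * (real s - 1)" by (rule mult_left_mono[OF e(2)]) simp
      thus ?thesis using e(1) by (simp add: algebra_simps power2_eq_square)
    qed
    moreover have "0 \<le> (real n - real n\<^sub>2) * ((real s - 1) * (real n + 1)) - (real n)\<^sup>2 * \<eta>"
    proof (cases "\<eta> = 0")
      case True
      thus ?thesis using le1 s by simp
    next
      case False
      hence e: "n\<^sub>2 = 0" "\<eta> \<le> 1" using eta by auto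
      have "(real n)\<^sup>2 * \<eta> \<le> (real n)\<^sup>2 * 1" by (rule mult_left_mono[OF e(2)]) simp
      also have "\<dots> \<le> real n * (1 * (real n + 1))" by (simp add: algebra_simps power2_eq_square)
      also have "\<dots> \<le> real n * ((real s - 1) * (real n + 1))"
        using s by (intro mult_left_mono mult_right_mono) auto
      finally show ?thesis using e(1) by simp
    qed
    ultimately show ?thesis unfolding w assms(11-13) qr \<delta>
      by (simp add: field_simps power2_eq_square)
  qed
  finally have "real N * R \<le> real N * (real N - 1) * ((real n)\<^sup>2 - 2 * real n) + real \<delta> * (real q + real N)
      - 2 * (real n\<^sub>1 * \<alpha> + real n\<^sub>2 * \<beta> + real n * \<gamma>)" .
  hence "R \<le> (real N * (real N - 1) * ((real n)\<^sup>2 - 2 * real n) + real \<delta> * (real q + real N)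
      - 2 * (real n\<^sub>1 * \<alpha> + real n\<^sub>2 * \<beta> + real n * \<gamma>)) / real N"
    using N3 by (simp add: pos_le_divide_eq mult.commute)
  thus ?thesis using N3 unfolding R_def[symmetric]
    by (simp add: add_divide_distrib diff_divide_distrib)
qed

end
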